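(* Let $\varepsilon=\varepsilon(n)=(3\log\log n)/(\log n)$. Let $p=p(n)$, $d=p(n-1)$, and suppose that $\log^5 n\ll d\le n(1-\varepsilon)$. Let $i\ge0$ be the largest integer such that $d^i=o(n)$, let $c=c(n)=d^{i+1}/n$, and let $$q=\begin{cases}(e^{-c})^2+(1-e^{-c})^2 & \text{if } p=o(1),\\ p^2+(1-p)^2 & \text{if } p=\Theta(1).\end{cases}$$ Suppose that $e^c\le\varepsilon^{-1}=(\log n)/(3\log\log n)$. Let $G=(V,E)\in G(n,p)$. Then a.a.s. $$\beta(G)\ge(1+o(1))\frac{2\log n}{\log(1/q)}.$$
   Context: For a finite connected graph $G=(V,E)$ and $R=\{r_1,\dots,r_k\}\subseteq V$, $d_R(v)$ is the vector of graph distances from $v$ to $r_1,\dots,r_k$; $R$ is resolving if $d_R(v)\ne d_R(w)$ for all distinct $v,w$; the metric dimension $\beta(G)$ is the minimum size of a resolving set. $G(n,p)$ is the binomial random graph on $\{1,\dots,n\}$ with each pair an edge independently with probability $p=p(n)$. Asymptotics are as $n\to\infty$; a.a.s. means with probability tending to $1$; $f\ll g$ means $f=o(g)$. $\log$ is the natural logarithm. *)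

theory Defs
  imports "HOL-Probability.Probability" "HOL-Library.Landau_Symbols" "HOL-Library.Extended_Nat"
begin

text \<open>
  A finite simple graph is given by its vertex set and its set of edges, an edge being a
  two-element set of vertices.
\<close>

definition adj :: "'a set set \<Rightarrow> ('a \<times> 'a) set" where
  "adj E = {(u, v). {u, v} \<in> E}"

text \<open>
  \<open>adj E ^^ k\<close> relates the endpoints of walks of length \<open>k\<close>. The distance is \<open>\<infinity>\<close>
  between different components (infimum of the empty set); on connected graphs it is the usual
  finite distance.
\<close>

definition graph_dist :: "'a set set \<Rightarrow> 'a \<Rightarrow> 'a \<Rightarrow> enat" where
  "graph_dist E u v = (INF k \<in> {k. (u, v) \<in> adj E ^^ k}. enat k)"

text \<open>The distance vector \<open>d\<^sub>R(v)\<close>, indexed by the elements of \<open>R\<close>.\<close>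

definition dist_vector :: "'a set set \<Rightarrow> 'a set \<Rightarrow> 'a \<Rightarrow> 'a \<Rightarrow> enat" where
  "dist_vector E R v = (\<lambda>r\<in>R. graph_dist E v r)"

definition resolving :: "'a set \<Rightarrow> 'a set set \<Rightarrow> 'a set \<Rightarrow> bool" where
  "resolving V E R \<longleftrightarrow>
     R \<subseteq> V \<and> (\<forall>v\<in>V. \<forall>w\<in>V. v \<noteq> w \<longrightarrow> dist_vector E R v \<noteq> dist_vector E R w)"

text \<open>For finite \<open>V\<close> the minimum exists, since \<open>V\<close> itself is resolving.\<close>

definition metric_dimension :: "'a set \<Rightarrow> 'a set set \<Rightarrow> nat" where
  "metric_dimension V E = Min (card ` {R. resolving V E R})"

definition vertex_pairs :: "nat \<Rightarrow> nat set set" where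
  "vertex_pairs n = {e. e \<subseteq> {1..n} \<and> card e = 2}"

text \<open>The distribution of the edge set of \<open>G(n,p)\<close> on the vertex set \<open>{1..n}\<close>.\<close>

definition random_graph :: "nat \<Rightarrow> real \<Rightarrow> nat set set pmf" where
  "random_graph n p =
     map_pmf (\<lambda>f. {e \<in> vertex_pairs n. f e})
       (Pi_pmf (vertex_pairs n) False (\<lambda>_. bernoulli_pmf p))"

text \<open>
  \<open>i = i(n)\<close> is the largest exponent with \<open>d\<^sup>i = o(n)\<close>. The exponent has to be allowed to
  depend on \<open>n\<close>: if \<open>d\<close> is a power of \<open>log n\<close>, then \<open>d\<^sup>k = o(n)\<close> for every constant \<open>k\<close>.
  Since \<open>o(n)\<close> is insensitive to finitely many \<open>n\<close>, sequences of exponents are compared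
  for all large \<open>n\<close>.
\<close>

definition largest_exponent :: "(nat \<Rightarrow> real) \<Rightarrow> (nat \<Rightarrow> nat) \<Rightarrow> bool" where
  "largest_exponent d i \<longleftrightarrow>
     (\<lambda>n. d n ^ i n) \<in> o(\<lambda>n. real n) \<and>
     (\<forall>j. (\<lambda>n. d n ^ j n) \<in> o(\<lambda>n. real n) \<longrightarrow> (\<forall>\<^sub>F n in sequentially. j n \<le> i n))"

end

theory Submission
  imports Defs "HOL-Real_Asymp.Real_Asymp"
begin

text \<open>
  Fix \<open>R\<close> with fewer than \<open>(1 - \<kappa>) 2 ln n / ln (1 / q)\<close> elements and explore the graph from \<open>R\<close> up to
  distance \<open>i\<close>. The edges between the last layer \<open>W\<close> and the set \<open>X\<close> of remaining vertices are
  still unexposed, and since a.a.s. all distances are at most \<open>i + 2\<close>, the distance vector of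
  \<open>v \<in> X\<close> is determined by the set of those \<open>r \<in> R\<close> whose \<open>i\<close>-th sphere contains a neighbour of \<open>v\<close>
  in \<open>W\<close>. These traces are independent and identically distributed for \<open>v \<in> X\<close>.

  Exposing the layers one by one, Chernoff bounds give \<open>card R d^i (1 + o(1 / ln n))\<close> vertices at
  distance \<open>i\<close> from \<open>R\<close>, simultaneously for all \<open>R\<close>; this is where \<open>ln^5 n = o(d)\<close> is needed.
  Comparing \<open>R\<close> with its singletons shows that the \<open>i\<close>-th spheres of the elements of \<open>R\<close> hardly
  overlap, so two traces coincide with probability at least \<open>q^(card R) n^(-o(1))\<close>, which is at least
  \<open>n^(-2 + \<kappa>)\<close>. A birthday bound then makes all traces distinct with probability at most
  \<open>exp (- n^(\<kappa> / 3))\<close>, which beats the \<open>exp (O(ln^3 n))\<close> choices of \<open>R\<close>.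
\<close>

subsection \<open>Random sets and exposure of edges\<close>

text \<open>Since R may depend on the graph, all estimates must hold for every R at once, so failure
  probabilities have to beat the number of sets of size card R. With relative error \<eta> per layer
  a Chernoff bound fails with probability exp (- const \<eta>^2 d card R), which asks for \<eta>^2 d
  to be a large multiple of ln n. On the other hand, errors accumulate over up to ln n / (5 ln (ln
  n)) layers. Each of the possibly ln^2 n / ln (ln n) elements of R then contributes an error of
  order c i \<eta> to the exponent of the collision probability, where c can reach ln (ln n). The
  total is o(ln n) for \<eta> = 1 / ln^2 n, and with this choice the first condition becomes d >>
  ln^5 n. The bound on the size of R holds because 1 - q is at least of order \<epsilon>: this
  follows from e^c \<le> 1 / \<epsilon> for p = o(1), and from d \<le> n (1 - \<epsilon>) for
  constant order p. Overlaps of spheres are never estimated one by one: the layer of R is nearly as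
  large as the sum of the spheres around its elements, and counting with multiplicity leaves little
  room for shared vertices.\<close>

definition rset :: "'a set \<Rightarrow> real \<Rightarrow> 'a set pmf" where
  "rset A p = map_pmf (\<lambda>f. {e \<in> A. f e}) (Pi_pmf A False (\<lambda>_. bernoulli_pmf p))"

lemma set_pmf_rset: "set_pmf (rset A p) \<subseteq> Pow A"
  by (auto simp: rset_def)

lemma random_graph_rset: "random_graph n p = rset (vertex_pairs n) p"
  by (simp add: random_graph_def rset_def)

lemma finite_vertex_pairs: "finite (vertex_pairs n)"
  by (auto simp: vertex_pairs_def intro: finite_subset[of _ "Pow {1..n}"])

lemma prob_rset_cylinder:
  assumes A: "finite A" and D: "D \<subseteq> A" and F: "F \<subseteq> D" and p: "0 \<le> p" "p \<le> 1"
  shows "measure_pmf.prob (rset A p) {E. E \<inter> D = F} = (\<Prod>e\<in>D. if e \<in> F then p else 1 - p)"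
proof -
  have eq: "(\<lambda>f. {e \<in> A. f e}) -` {E. E \<inter> D = F} = Pi A (\<lambda>e. if e \<in> D then {e \<in> F} else UNIV)"
    using D F by (auto simp: Pi_def) 
  have "measure_pmf.prob (rset A p) {E. E \<inter> D = F} =
      (\<Prod>e\<in>A. measure_pmf.prob (bernoulli_pmf p) (if e \<in> D then {e \<in> F} else UNIV))"
    unfolding rset_def measure_map_pmf eq by (rule measure_Pi_pmf_Pi[OF A])
  also have "\<dots> = (\<Prod>e\<in>D. measure_pmf.prob (bernoulli_pmf p) (if e \<in> D then {e \<in> F} else UNIV))"
    using A D by (intro prod.mono_neutral_right) auto
  also have "\<dots> = (\<Prod>e\<in>D. if e \<in> F then p else 1 - p)"
    using p by (intro prod.cong) (auto simp: measure_pmf_single)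
  finally show ?thesis .
qed

lemma pmf_rset:
  assumes "finite A" "0 \<le> p" "p \<le> 1" "F \<subseteq> A"
  shows "pmf (rset A p) F = (\<Prod>e\<in>A. if e \<in> F then p else 1 - p)"
proof -
  have "pmf (rset A p) F = measure_pmf.prob (rset A p) {F}"
    by (simp add: measure_pmf_single)
  also have "\<dots> = measure_pmf.prob (rset A p) {E. E \<inter> A = F}"
    using set_pmf_rset[of A p] assms by (intro measure_prob_cong_0) (auto simp: set_pmf_eq)
  finally show ?thesis using assms by (simp add: prob_rset_cylinder)
qed

lemma rset_Un:
  assumes "finite A" "finite B" "A \<inter> B = {}" "0 \<le> p" "p \<le> 1"
  shows "rset (A \<union> B) p = map_pmf (\<lambda>(S, T). S \<union> T) (pair_pmf (rset A p) (rset B p))"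
  using assms unfolding rset_def
  by (subst Pi_pmf_union) (auto simp: pair_map_pmf1 pair_map_pmf2 map_pmf_comp case_prod_unfold intro!: map_pmf_cong)

lemma prob_pair_pmf_Times:
  "measure_pmf.prob (pair_pmf M N) (A \<times> B) = measure_pmf.prob M A * measure_pmf.prob N B"
proof -
  \<comment> \<open>Restricting both factors to their supports makes them countable, as the product
    rule requires.\<close>
  have "measure_pmf.prob (pair_pmf M N) (A \<times> B) =
      measure_pmf.prob (pair_pmf M N) ((A \<inter> set_pmf M) \<times> (B \<inter> set_pmf N))"
    by (rule measure_prob_cong_0) (auto simp: pmf_pair pmf_eq_0_set_pmf)
  also have "\<dots> = measure_pmf.prob M (A \<inter> set_pmf M) * measure_pmf.prob N (B \<inter> set_pmf N)"
    by (rule measure_pmf_prob_product) (auto intro: countable_subset[OF _ countable_set_pmf])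
  finally show ?thesis by (simp add: measure_Int_set_pmf)
qed

text \<open>\<open>T\<close> is a stopping set: whether it equals a given set is decided by the part of \<open>E\<close> inside it.
  Hence the part outside may be replaced by an independent copy.\<close>

lemma rset_resample:
  assumes A: "finite A" and p: "0 \<le> p" "p \<le> 1"
    and T: "\<And>E F. E \<inter> T E = F \<inter> T E \<Longrightarrow> T F = T E"
  shows "rset A p = map_pmf (\<lambda>(E, F). (E \<inter> T E) \<union> (F - T E)) (pair_pmf (rset A p) (rset A p))"
    (is "_ = map_pmf ?h ?PP")
proof (rule pmf_eqI)
  fix H
  have supp: "set_pmf ?PP \<subseteq> Pow A \<times> Pow A"
    using set_pmf_rset[of A p] by auto
  show "pmf (rset A p) H = pmf (map_pmf ?h ?PP) H"
  proof (cases "H \<subseteq> A")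
    case False
    have "H \<notin> set_pmf (rset A p)" using False set_pmf_rset[of A p] by blast
    moreover have "H \<notin> set_pmf (map_pmf ?h ?PP)"
    proof
      assume "H \<in> set_pmf (map_pmf ?h ?PP)"
      then obtain x where "x \<in> set_pmf ?PP" "H = ?h x" by auto
      then show False using False supp by (cases x) auto
    qed
    ultimately show ?thesis unfolding pmf_eq_0_set_pmf[symmetric] by (rule trans[OF _ sym])
  next
    case H: True
    \<comment> \<open>The result \<open>H\<close> agrees with \<open>E\<close> on
      \<open>T E\<close>, so \<open>T H = T E\<close>: the exposed region can be recovered from the
      result. The event becomes a rectangle of two cylinders over complementary regions.\<close>
    have key: "?h (E, F) = H \<longleftrightarrow> E \<inter> (A \<inter> T H) = H \<inter> T H \<and> F \<inter> (A - T H) = H - T H"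
      if "E \<subseteq> A" "F \<subseteq> A" for E F
    proof
      assume h: "?h (E, F) = H"
      then have "E \<inter> T E = H \<inter> T E" by auto
      then have "T H = T E" by (rule T)
      then show "E \<inter> (A \<inter> T H) = H \<inter> T H \<and> F \<inter> (A - T H) = H - T H"
        using h that by auto
    next
      assume h: "E \<inter> (A \<inter> T H) = H \<inter> T H \<and> F \<inter> (A - T H) = H - T H"
      then have "H \<inter> T H = E \<inter> T H" using that by auto
      then have "T E = T H" by (rule T)
      then show "?h (E, F) = H" using h that H by auto
    qed
    define C where "C = {E. E \<inter> (A \<inter> T H) = H \<inter> T H} \<times> {F. F \<inter> (A - T H) = H - T H}"
    have key': "x \<in> ?h -` {H} \<longleftrightarrow> x \<in> C" if "x \<in> set_pmf ?PP" for x
    proof -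
      obtain E F where x: "x = (E, F)" by force
      then have "E \<subseteq> A" "F \<subseteq> A" using supp that by auto
      from key[OF this] show ?thesis
        unfolding x C_def by (simp only: vimage_eq singleton_iff mem_Sigma_iff mem_Collect_eq)
    qed
    have "pmf (map_pmf ?h ?PP) H = measure_pmf.prob ?PP (?h -` {H})"
      by (simp only: pmf_map)
    also have "\<dots> = measure_pmf.prob ?PP C"
    proof (rule measure_prob_cong_0)
      show "pmf ?PP x = 0" if "x \<in> ?h -` {H} - C" for x
        using key'[of x] that by (simp only: pmf_eq_0_set_pmf) blast
      show "pmf ?PP x = 0" if "x \<in> C - ?h -` {H}" for x
        using key'[of x] that by (simp only: pmf_eq_0_set_pmf) blast
    qed
    also have "\<dots> = measure_pmf.prob (rset A p) {E. E \<inter> (A \<inter> T H) = H \<inter> T H} *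
        measure_pmf.prob (rset A p) {F. F \<inter> (A - T H) = H - T H}"
      unfolding C_def by (rule prob_pair_pmf_Times)
    also have "measure_pmf.prob (rset A p) {E. E \<inter> (A \<inter> T H) = H \<inter> T H} =
        (\<Prod>e\<in>A \<inter> T H. if e \<in> H \<inter> T H then p else 1 - p)"
      using A H p by (intro prob_rset_cylinder) auto
    also have "measure_pmf.prob (rset A p) {F. F \<inter> (A - T H) = H - T H} =
        (\<Prod>e\<in>A - T H. if e \<in> H - T H then p else 1 - p)"
      using A H p by (intro prob_rset_cylinder) auto
    also have "(\<Prod>e\<in>A \<inter> T H. if e \<in> H \<inter> T H then p else 1 - p) * (\<Prod>e\<in>A - T H. if e \<in> H - T H then p else 1 - p) =
        (\<Prod>e\<in>A \<inter> T H. if e \<in> H then p else 1 - p) * (\<Prod>e\<in>A - T H. if e \<in> H then p else 1 - p)"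
      by (intro arg_cong2[where f="(*)"] prod.cong) auto
    also have "\<dots> = (\<Prod>e\<in>A. if e \<in> H then p else 1 - p)"
      using A by (subst prod.union_disjoint[symmetric]) (auto intro!: prod.cong)
    finally show ?thesis using A H p by (simp add: pmf_rset)
  qed
qed

lemma prob_pair_pmf_eq:
  "measure_pmf.prob (pair_pmf M N) B =
    measure_pmf.expectation M (\<lambda>x. measure_pmf.prob N {y. (x, y) \<in> B})"
proof -
  have "ennreal (measure_pmf.prob (pair_pmf M N) B) = (\<integral>\<^sup>+x. emeasure N {y. (x, y) \<in> B} \<partial>M)"
    unfolding pair_pmf_def measure_pmf.emeasure_eq_measure[symmetric]
    by (simp add: emeasure_bind_pmf indicator_def vimage_def flip: nn_integral_indicator)
  also have "\<dots> = (\<integral>\<^sup>+x. ennreal (measure_pmf.prob N {y. (x, y) \<in> B}) \<partial>M)"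
    by (simp add: measure_pmf.emeasure_eq_measure)
  also have "\<dots> = ennreal (measure_pmf.expectation M (\<lambda>x. measure_pmf.prob N {y. (x, y) \<in> B}))"
    by (intro nn_integral_eq_integral measure_pmf.integrable_const_bound[where B = 1]) auto
  finally show ?thesis by simp
qed

lemma prob_pair_pmf_le:
  assumes "\<And>x. x \<in> set_pmf M \<Longrightarrow> measure_pmf.prob N {y. (x, y) \<in> B} \<le> b"
  shows "measure_pmf.prob (pair_pmf M N) B \<le> b"
proof -
  have "measure_pmf.prob (pair_pmf M N) B \<le> measure_pmf.expectation M (\<lambda>_. b)"
    unfolding prob_pair_pmf_eq
    by (rule integral_mono_AE) (auto intro!: measure_pmf.integrable_const_bound[where B = 1] AE_pmfI assms)
  then show ?thesis by simp
qed

text \<open>In \<open>b\<close> the set \<open>E\<close> is frozen and only \<open>F\<close> is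
  random. This is conditioning on the part inside \<open>T E\<close>, and a bound valid for every
  frozen \<open>E\<close> survives averaging.\<close>

lemma rset_exposure:
  assumes A: "finite A" and p: "0 \<le> p" "p \<le> 1"
    and T: "\<And>E F. E \<inter> T E = F \<inter> T E \<Longrightarrow> T F = T E"
    and b: "\<And>E. E \<subseteq> A \<Longrightarrow> measure_pmf.prob (rset A p) {F. E \<inter> T E \<union> (F - T E) \<in> B} \<le> b"
  shows "measure_pmf.prob (rset A p) B \<le> b"
proof -
  have "measure_pmf.prob (rset A p) B =
      measure_pmf.prob (pair_pmf (rset A p) (rset A p)) ((\<lambda>(E, F). (E \<inter> T E) \<union> (F - T E)) -` B)"
    by (subst rset_resample[OF A p T]) (auto simp: measure_map_pmf)
  also have "\<dots> \<le> b"
    using set_pmf_rset[of A p] b by (intro prob_pair_pmf_le) (auto simp: vimage_def)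
  finally show ?thesis .
qed

text \<open>The value \<open>{}\<close> off \<open>X\<close> matches the default value of the
  product measure in \<open>map_rset_nbhds\<close>.\<close>

definition nbhds :: "nat set \<Rightarrow> nat set \<Rightarrow> nat set set \<Rightarrow> nat \<Rightarrow> nat set" where
  "nbhds X W E v = (if v \<in> X then {w \<in> W. {w, v} \<in> E} else {})"

text \<open>As \<open>X\<close> and \<open>W\<close> are disjoint, a pair between them determines
  its endpoint in \<open>X\<close>. Neighbourhoods of different vertices are thus read off from
  disjoint sets of pairs and are independent.\<close>

lemma map_rset_nbhds:
  assumes XW: "X \<subseteq> {1..n}" "W \<subseteq> {1..n}" "X \<inter> W = {}" and p: "0 \<le> p" "p \<le> 1"
  shows "map_pmf (nbhds X W) (rset (vertex_pairs n) p) = Pi_pmf X {} (\<lambda>_. rset W p)"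
proof (rule pmf_eqI)
  fix N
  define D where "D = (\<lambda>(v, w). {w, v}) ` (X \<times> W)"
  have fin: "finite X" "finite W"
    using XW finite_subset[of X "{1..n}"] finite_subset[of W "{1..n}"]
    by auto
  have inj: "inj_on (\<lambda>(v, w). {w, v}) (X \<times> W)"
    using XW by (auto simp: inj_on_def doubleton_eq_iff)
  have D: "D \<subseteq> vertex_pairs n"
  proof
    fix e assume "e \<in> D"
    then obtain v w where "v \<in> X" "w \<in> W" "e = {w, v}" by (auto simp: D_def)
    moreover from this have "v \<noteq> w" using XW by blast
    ultimately show "e \<in> vertex_pairs n" using XW by (auto simp: vertex_pairs_def)
  qed
  show "pmf (map_pmf (nbhds X W) (rset (vertex_pairs n) p)) N = pmf (Pi_pmf X {} (\<lambda>_. rset W p)) N"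
  proof (cases "(\<forall>v\<in>X. N v \<subseteq> W) \<and> (\<forall>v. v \<notin> X \<longrightarrow> N v = {})")
    case False
    have "N \<noteq> nbhds X W E" for E
      using False by (auto simp: nbhds_def)
    then have "N \<notin> set_pmf (map_pmf (nbhds X W) (rset (vertex_pairs n) p))" by auto
    moreover have "N \<notin> set_pmf (Pi_pmf X {} (\<lambda>_. rset W p))"
      using False set_pmf_rset[of W p] fin by (auto simp: set_Pi_pmf PiE_dflt_def)
    ultimately show ?thesis unfolding pmf_eq_0_set_pmf[symmetric] by (rule trans[OF _ sym])
  next
    case N: True
    define F where "F = (\<lambda>(v, w). {w, v}) ` {(v, w). v \<in> X \<and> w \<in> N v}"
    have F: "F \<subseteq> D" using N by (auto simp: F_def D_def)
    have memF: "{w, v} \<in> F \<longleftrightarrow> w \<in> N v" if "v \<in> X" "w \<in> W" for v w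
    proof
      assume "{w, v} \<in> F"
      then obtain v' w' where "v' \<in> X" "w' \<in> N v'" "{w, v} = {w', v'}" by (auto simp: F_def)
      then show "w \<in> N v" using N XW that by (auto simp: doubleton_eq_iff)
    qed (use that in \<open>auto simp: F_def\<close>)
    have "nbhds X W E = N \<longleftrightarrow> E \<inter> D = F" for E
    proof -
      have "nbhds X W E = N \<longleftrightarrow> (\<forall>v\<in>X. nbhds X W E v = N v)"
        using N by (auto simp: nbhds_def fun_eq_iff)
      also have "\<dots> \<longleftrightarrow> (\<forall>v\<in>X. \<forall>w\<in>W. {w, v} \<in> E \<longleftrightarrow> w \<in> N v)"
        by (rule ball_cong[OF refl]) (use N in \<open>auto simp: nbhds_def\<close>)
      also have "\<dots> \<longleftrightarrow> (\<forall>e\<in>D. e \<in> E \<longleftrightarrow> e \<in> F)"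
        using memF by (simp add: D_def)
      also have "\<dots> \<longleftrightarrow> E \<inter> D = F" using F by blast
      finally show ?thesis .
    qed
    then have "nbhds X W -` {N} = {E. E \<inter> D = F}" by auto
    then have "pmf (map_pmf (nbhds X W) (rset (vertex_pairs n) p)) N =
        measure_pmf.prob (rset (vertex_pairs n) p) {E. E \<inter> D = F}"
      by (simp add: pmf_map)
    also have "\<dots> = (\<Prod>e\<in>D. if e \<in> F then p else 1 - p)"
      by (rule prob_rset_cylinder) (use finite_vertex_pairs D F p in auto)
    also have "\<dots> = (\<Prod>(v, w)\<in>X \<times> W. if {w, v} \<in> F then p else 1 - p)"
      unfolding D_def by (subst prod.reindex[OF inj]) (simp add: o_def case_prod_unfold)
    also have "\<dots> = (\<Prod>v\<in>X. \<Prod>w\<in>W. if w \<in> N v then p else 1 - p)"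
      unfolding prod.cartesian_product[symmetric] using memF by (intro prod.cong) auto
    also have "\<dots> = (\<Prod>v\<in>X. pmf (rset W p) (N v))"
      using N fin p by (intro prod.cong) (auto simp: pmf_rset)
    also have "\<dots> = pmf (Pi_pmf X {} (\<lambda>_. rset W p)) N"
      using N fin by (simp add: pmf_Pi)
    finally show ?thesis .
  qed
qed

subsection \<open>Breadth-first layers and distances\<close>

text \<open>The open ball: distance from \<open>R\<close> strictly less than \<open>k\<close>, so that \<open>layer E R k\<close> below is the
  sphere of radius \<open>k\<close>.\<close>

primrec reach :: "'a set set \<Rightarrow> 'a set \<Rightarrow> nat \<Rightarrow> 'a set" where
  "reach E R 0 = {}"
| "reach E R (Suc k) = R \<union> {v. \<exists>w\<in>reach E R k. {w, v} \<in> E}"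

definition layer :: "'a set set \<Rightarrow> 'a set \<Rightarrow> nat \<Rightarrow> 'a set" where
  "layer E R k = reach E R (Suc k) - reach E R k"

lemma reach_subset_Suc: "reach E R k \<subseteq> reach E R (Suc k)"
  by (induction k) auto

lemma reach_mono: "k \<le> m \<Longrightarrow> reach E R k \<subseteq> reach E R m"
  by (rule lift_Suc_mono_le[of "reach E R"]) (rule reach_subset_Suc)

lemma reach_UN: "reach E R k = (\<Union>r\<in>R. reach E {r} k)"
  by (induction k) auto

lemma reach_mono_sources: "S \<subseteq> R \<Longrightarrow> reach E S k \<subseteq> reach E R k"
  by (subst (1 2) reach_UN) auto

lemma layer_0 [simp]: "layer E R 0 = R"
  by (simp add: layer_def)

lemma reach_subset_vertices:
  assumes "R \<subseteq> {1..n}" "E \<subseteq> vertex_pairs n"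
  shows "reach E R k \<subseteq> {1..n}"
  using assms by (induction k) (auto simp: vertex_pairs_def)

lemma finite_reach:
  assumes "R \<subseteq> {1..n}" "E \<subseteq> vertex_pairs n"
  shows "finite (reach E R k)"
  by (rule finite_subset[OF reach_subset_vertices[OF assms]]) simp

lemma reach_eq_UN_layer: "reach E R (Suc k) = (\<Union>m\<le>k. layer E R m)"
proof (induction k)
  case (Suc k)
  have "reach E R (Suc (Suc k)) = reach E R (Suc k) \<union> layer E R (Suc k)"
    using reach_subset_Suc[of E R "Suc k"] by (auto simp: layer_def)
  then show ?case using Suc by (auto simp: atMost_Suc)
qed simp

section \<open>Exposing one layer of the random graph\<close>

definition outer :: "nat \<Rightarrow> nat set set \<Rightarrow> nat set \<Rightarrow> nat \<Rightarrow> nat set" where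
  "outer n E R k = {1..n} - reach E R (Suc k)"

abbreviation outer_nbhds :: "nat \<Rightarrow> nat set set \<Rightarrow> nat set \<Rightarrow> nat \<Rightarrow> nat \<Rightarrow> nat set" where
  "outer_nbhds n E R k \<equiv> nbhds (outer n E R k) (layer E R k) E"

text \<open>A neighbour at distance less than \<open>k\<close> would place the vertex itself in the
  ball, so the neighbours that matter lie on the sphere. The next layer is therefore a function of
  the unexposed pairs.\<close>

lemma layer_Suc_eq:
  assumes "R \<subseteq> {1..n}" "E \<subseteq> vertex_pairs n"
  shows "layer E R (Suc k) = {v \<in> outer n E R k. outer_nbhds n E R k v \<noteq> {}}"
proof (rule set_eqI)
  fix v
  have "v \<in> {1..n}" if "v \<in> reach E R (Suc (Suc k))"
    using reach_subset_vertices[OF assms] that by blast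
  then have "v \<in> layer E R (Suc k) \<longleftrightarrow>
      v \<in> outer n E R k \<and> (\<exists>w\<in>reach E R (Suc k). {w, v} \<in> E)"
    by (auto simp: layer_def outer_def)
  also have "\<dots> \<longleftrightarrow> v \<in> outer n E R k \<and> (\<exists>w\<in>layer E R k. {w, v} \<in> E)"
    by (auto simp: layer_def outer_def)
  finally show "v \<in> layer E R (Suc k) \<longleftrightarrow> v \<in> {v \<in> outer n E R k. outer_nbhds n E R k v \<noteq> {}}"
    by (auto simp: nbhds_def)
qed

text \<open>Enlarging a ball by one inspects only edges with an endpoint in it, so the edges
  touching \<open>reach E R k\<close> decide everything up to index \<open>Suc k\<close>. Subsets
  \<open>S\<close> are covered because the traces refer to balls around single elements of
  \<open>R\<close>.\<close>

lemma reach_cong_touching: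
  assumes EF: "\<And>e. e \<inter> reach E R k \<noteq> {} \<Longrightarrow> e \<in> E \<longleftrightarrow> e \<in> F"
    and "S \<subseteq> R" "m \<le> Suc k"
  shows "reach F S m = reach E S m"
  using \<open>m \<le> Suc k\<close>
proof (induction m)
  case (Suc m)
  have "reach E S m \<subseteq> reach E R k"
    using Suc.prems reach_mono_sources[OF \<open>S \<subseteq> R\<close>, of E m] reach_mono[of m k E R] by auto
  then have "{w, v} \<in> E \<longleftrightarrow> {w, v} \<in> F" if "w \<in> reach E S m" for v w
    using that by (intro EF) auto
  then show ?case using Suc by auto
qed simp

text \<open>\<open>\<Phi> E N\<close> separates the two sources of randomness: \<open>E\<close>
  enters only through explored balls, \<open>N\<close> stands for the still independent
  neighbourhoods. One implication in the hypothesis suffices, since \<open>E\<close> and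
  \<open>F\<close> can be exchanged.\<close>

lemma random_graph_exposure:
  assumes R: "R \<subseteq> {1..n}" and p: "0 \<le> p" "p \<le> 1"
    and \<Phi>: "\<And>E F N. (\<And>S m. S \<subseteq> R \<Longrightarrow> m \<le> Suc k \<Longrightarrow> reach F S m = reach E S m) \<Longrightarrow> \<Phi> F N \<Longrightarrow> \<Phi> E N"
    and b: "\<And>E. E \<subseteq> vertex_pairs n \<Longrightarrow>
      measure_pmf.prob (Pi_pmf (outer n E R k) {} (\<lambda>_. rset (layer E R k) p)) {N. \<Phi> E N} \<le> b"
  shows "measure_pmf.prob (random_graph n p) {E. \<Phi> E (outer_nbhds n E R k)} \<le> b"
  unfolding random_graph_rset
proof (rule rset_exposure[where T = "\<lambda>E. {e. e \<inter> reach E R k \<noteq> {}}"])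
  show "{e. e \<inter> reach F R k \<noteq> {}} = {e. e \<inter> reach E R k \<noteq> {}}"
    if "E \<inter> {e. e \<inter> reach E R k \<noteq> {}} = F \<inter> {e. e \<inter> reach E R k \<noteq> {}}" for E F
  proof -
    have "e \<in> E \<longleftrightarrow> e \<in> F" if "e \<inter> reach E R k \<noteq> {}" for e
      using that \<open>E \<inter> _ = F \<inter> _\<close> by blast
    from reach_cong_touching[OF this, of R k] show ?thesis by simp
  qed
  fix E assume E: "E \<subseteq> vertex_pairs n"
  define T X W where "T = {e. e \<inter> reach E R k \<noteq> {}}" and "X = outer n E R k" and "W = layer E R k"
  have XW: "X \<subseteq> {1..n}" "W \<subseteq> {1..n}" "X \<inter> W = {}"
    using reach_subset_vertices[OF R E, of "Suc k"] by (auto simp: X_def W_def outer_def layer_def)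
  have eq: "\<Phi> H (outer_nbhds n H R k) \<longleftrightarrow> \<Phi> E (nbhds X W F)" if H: "H = E \<inter> T \<union> (F - T)" for F H
  proof -
    have same: "reach H S m = reach E S m" if "S \<subseteq> R" "m \<le> Suc k" for S m
      using that by (intro reach_cong_touching) (auto simp: H T_def)
    have "nbhds X W H = nbhds X W F"
    proof
      fix v
      \<comment> \<open>Neither endpoint is at distance less than \<open>k\<close> from
        \<open>R\<close>, so the pair lies outside \<open>T\<close> and is taken from the fresh
        copy.\<close>
      have "{w, v} \<in> H \<longleftrightarrow> {w, v} \<in> F" if "w \<in> W" "v \<in> X" for w
        using that reach_subset_Suc[of E R k]
        by (auto simp: H T_def W_def X_def layer_def outer_def simp del: reach.simps)
      then show "nbhds X W H v = nbhds X W F v" by (auto simp: nbhds_def)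
    qed
    moreover have "outer n H R k = X" "layer H R k = W"
      unfolding X_def W_def outer_def layer_def using same[of R] by (simp_all del: reach.simps)
    moreover have "\<Phi> H N \<longleftrightarrow> \<Phi> E N" for N
      using \<Phi>[of H E N] \<Phi>[of E H N] same by (auto simp del: reach.simps)
    ultimately show ?thesis by simp
  qed
  have "{F. E \<inter> T \<union> (F - T) \<in> {E. \<Phi> E (outer_nbhds n E R k)}} = nbhds X W -` {N. \<Phi> E N}"
    using eq by auto
  then have "measure_pmf.prob (rset (vertex_pairs n) p) {F. E \<inter> T \<union> (F - T) \<in> {E. \<Phi> E (outer_nbhds n E R k)}}
      = measure_pmf.prob (map_pmf (nbhds X W) (rset (vertex_pairs n) p)) {N. \<Phi> E N}"
    by (simp add: measure_map_pmf)
  also have "\<dots> \<le> b"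
    unfolding map_rset_nbhds[OF XW p] unfolding X_def W_def by (rule b[OF E])
  finally show "measure_pmf.prob (rset (vertex_pairs n) p)
      {F. E \<inter> {e. e \<inter> reach E R k \<noteq> {}} \<union> (F - {e. e \<inter> reach E R k \<noteq> {}}) \<in> {E. \<Phi> E (outer_nbhds n E R k)}} \<le> b"
    by (simp only: T_def)
qed (use p finite_vertex_pairs in auto)

section \<open>Distances and resolving sets in terms of balls\<close>

lemma mem_reach_singleton: "v \<in> reach E {r} (Suc k) \<longleftrightarrow> (\<exists>m\<le>k. (v, r) \<in> adj E ^^ m)"
proof (induction k arbitrary: v)
  case (Suc k)
  have "v \<in> reach E {r} (Suc (Suc k)) \<longleftrightarrow> v = r \<or> (\<exists>w\<in>reach E {r} (Suc k). {w, v} \<in> E)"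
    by (simp del: reach.simps add: reach.simps(2)[of _ _ "Suc k"])
  \<comment> \<open>The ball grows away from \<open>r\<close> while the walk is read from
    \<open>v\<close>, so the new edge becomes its first step.\<close>
  also have "\<dots> \<longleftrightarrow> v = r \<or> (\<exists>m\<le>k. \<exists>w. (v, w) \<in> adj E \<and> (w, r) \<in> adj E ^^ m)"
    unfolding Suc.IH bex_simps Bex_def by (auto simp: adj_def insert_commute)
  also have "\<dots> \<longleftrightarrow> v = r \<or> (\<exists>m\<le>k. (v, r) \<in> adj E ^^ Suc m)"
    by (meson relpow_Suc_I2 relpow_Suc_D2)
  also have "\<dots> \<longleftrightarrow> (\<exists>m\<le>Suc k. (v, r) \<in> adj E ^^ m)"
  proof
    assume "v = r \<or> (\<exists>m\<le>k. (v, r) \<in> adj E ^^ Suc m)"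
    then show "\<exists>m\<le>Suc k. (v, r) \<in> adj E ^^ m"
      by (metis Suc_le_mono relpow_0_I zero_le)
  next
    assume "\<exists>m\<le>Suc k. (v, r) \<in> adj E ^^ m"
    then obtain m where "m \<le> Suc k" "(v, r) \<in> adj E ^^ m" by blast
    then show "v = r \<or> (\<exists>m\<le>k. (v, r) \<in> adj E ^^ Suc m)" by (cases m) auto
  qed
  finally show ?case .
qed auto

lemma graph_dist_le_iff: "graph_dist E v r \<le> enat k \<longleftrightarrow> v \<in> reach E {r} (Suc k)"
proof -
  define K where "K = {k. (v, r) \<in> adj E ^^ k}"
  have "graph_dist E v r \<le> enat k \<longleftrightarrow> (\<exists>m\<in>K. m \<le> k)"
  proof
    assume le: "graph_dist E v r \<le> enat k"
    have "K \<noteq> {}"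
    proof
      assume "K = {}"
      then have "graph_dist E v r = \<infinity>" unfolding graph_dist_def K_def[symmetric] by (simp add: top_enat_def)
      then show False using le by simp
    qed
    then have "graph_dist E v r \<in> enat ` K"
      unfolding graph_dist_def K_def[symmetric] Inf_enat_def by (auto intro: LeastI)
    then show "\<exists>m\<in>K. m \<le> k" using le by auto
  next
    assume "\<exists>m\<in>K. m \<le> k"
    then obtain m where m: "m \<in> K" "m \<le> k" by blast
    then have "graph_dist E v r \<le> enat m"
      unfolding graph_dist_def K_def[symmetric] by (intro INF_lower)
    also have "\<dots> \<le> enat k" using m by simp
    finally show "graph_dist E v r \<le> enat k" .
  qed
  then show ?thesis unfolding mem_reach_singleton K_def by auto
qed

lemma resolving_vertices: "resolving V E V"
  unfolding resolving_def
proof (intro conjI ballI impI notI)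
  fix v w assume vw: "v \<in> V" "w \<in> V" "v \<noteq> w" "dist_vector E V v = dist_vector E V w"
  have "graph_dist E v v = graph_dist E w v"
    using vw(1) fun_cong[OF vw(4), of v] by (simp add: dist_vector_def)
  moreover have "graph_dist E v v \<le> enat 0" "\<not> graph_dist E w v \<le> enat 0"
    using vw by (auto simp: graph_dist_le_iff)
  ultimately show False by simp
qed simp

lemma metric_dimension_attained:
  assumes "finite V"
  obtains R where "resolving V E R" "card R = metric_dimension V E"
proof -
  have "finite {R. resolving V E R}"
    by (rule finite_subset[of _ "Pow V"]) (use assms in \<open>auto simp: resolving_def\<close>)
  then have "metric_dimension V E \<in> card ` {R. resolving V E R}"
    unfolding metric_dimension_def using resolving_vertices by (intro Min_in) auto
  then show thesis using that by auto
qed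

text \<open>Reduces equality of distances to membership in balls, infinite distances
  included.\<close>

lemma enat_eqI:
  fixes a b :: enat
  assumes "\<And>j. a \<le> enat j \<longleftrightarrow> b \<le> enat j"
  shows "a = b"
proof (rule antisym)
  show "a \<le> b" using assms by (cases b) auto
  show "b \<le> a" using assms by (cases a) auto
qed

text \<open>If all distances are at most \<open>k + 2\<close>, the distance from a vertex outside the ball of radius
  \<open>k\<close> around \<open>R\<close> to a vertex of \<open>R\<close> can only be \<open>k + 1\<close> or \<open>k + 2\<close>.\<close>

lemma resolving_imp_inj_on_trace:
  assumes res: "resolving {1..n} E R" and E: "E \<subseteq> vertex_pairs n"
    and diam: "\<And>u v. u \<in> {1..n} \<Longrightarrow> v \<in> {1..n} \<Longrightarrow> v \<in> reach E {u} (k + 3)"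
  shows "inj_on (\<lambda>v. {r \<in> R. outer_nbhds n E R k v \<inter> reach E {r} (Suc k) \<noteq> {}}) (outer n E R k)"
    (is "inj_on ?X _")
proof (rule inj_onI, rule ccontr)
  fix v w assume vw: "v \<in> outer n E R k" "w \<in> outer n E R k" "?X v = ?X w" "v \<noteq> w"
  have R: "R \<subseteq> {1..n}" using res by (simp add: resolving_def)
  have le: "graph_dist E v r \<le> enat j \<longleftrightarrow> j \<ge> Suc (Suc k) \<or> j = Suc k \<and> r \<in> ?X v"
    if r: "r \<in> R" and v: "v \<in> outer n E R k" for r j v
  proof -
    consider "j \<le> k" | "j = Suc k" | "j \<ge> Suc (Suc k)" by linarith
    then show ?thesis
    proof cases
      case 1
      have "reach E {r} (Suc j) \<subseteq> reach E R (Suc k)"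
        using 1 r reach_mono[of "Suc j" "Suc k" E "{r}"] reach_mono_sources[of "{r}" R E "Suc k"]
        by (auto simp del: reach.simps)
      then show ?thesis using 1 v by (auto simp: graph_dist_le_iff outer_def simp del: reach.simps)
    next
      case 2
      have "v \<in> reach E {r} (Suc j) \<longleftrightarrow> (\<exists>w\<in>reach E {r} (Suc k). {w, v} \<in> E)"
        using v r reach_mono[of 1 "Suc k" E R] 2
        by (auto simp del: reach.simps simp: reach.simps(2)[of _ _ "Suc k"] outer_def) auto
      also have "\<dots> \<longleftrightarrow> (\<exists>w\<in>layer E R k \<inter> reach E {r} (Suc k). {w, v} \<in> E)"
      proof -
        \<comment> \<open>A neighbour of \<open>v\<close> inside \<open>reach E R k\<close> would
          put \<open>v\<close> into \<open>reach E R (Suc k)\<close>.\<close>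
        have "w \<in> layer E R k" if w: "w \<in> reach E {r} (Suc k)" "{w, v} \<in> E" for w
        proof -
          have "w \<notin> reach E R k" using w(2) v by (auto simp: outer_def)
          moreover have "w \<in> reach E R (Suc k)"
            using w(1) reach_mono_sources[of "{r}" R E "Suc k"] r by blast
          ultimately show ?thesis by (simp add: layer_def del: reach.simps)
        qed
        then show ?thesis by blast
      qed
      also have "\<dots> \<longleftrightarrow> r \<in> ?X v"
        using r v by (auto simp: nbhds_def simp del: reach.simps)
      finally show ?thesis using 2 by (simp add: graph_dist_le_iff del: reach.simps)
    next
      case 3
      \<comment> \<open>\<open>reach\<close> is an open ball, so the index \<open>k + 3\<close>
        stands for distance at most \<open>k + 2\<close>.\<close>
      have "v \<in> reach E {r} (k + 3)"
        using v r R by (intro diam) (auto simp: outer_def)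
      also have "\<dots> \<subseteq> reach E {r} (Suc j)" using 3 by (intro reach_mono) simp
      finally show ?thesis using 3 by (simp add: graph_dist_le_iff del: reach.simps)
    qed
  qed
  have "graph_dist E v r = graph_dist E w r" if r: "r \<in> R" for r
  proof -
    have "graph_dist E v r \<le> enat j \<longleftrightarrow> graph_dist E w r \<le> enat j" for j
      unfolding le[OF r vw(1)] le[OF r vw(2)] vw(3) ..
    then show ?thesis by (rule enat_eqI)
  qed
  then have "dist_vector E R v = dist_vector E R w"
    by (auto simp: dist_vector_def)
  then show False using res vw by (auto simp: resolving_def outer_def)
qed

declare reach.simps(2) [simp del]

subsection \<open>Concentration, birthday and collision bounds\<close>

lemma Pi_pmf_count_mgf:
  assumes "finite X"
  shows "measure_pmf.expectation (Pi_pmf X d (\<lambda>_. \<mu>)) (\<lambda>N. exp (t * real (card {v \<in> X. P (N v)}))) =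
    (1 + measure_pmf.prob \<mu> {x. P x} * (exp t - 1)) ^ card X"
proof -
  have "exp (t * real (card {v \<in> X. P (N v)})) = (\<Prod>v\<in>X. if P (N v) then exp t else 1)" for N :: "'a \<Rightarrow> 'b"
  proof -
    have "(\<Prod>v\<in>X. if P (N v) then exp t else 1) = (\<Prod>v\<in>{v \<in> X. P (N v)}. exp t)"
      by (rule prod.inter_filter[OF assms, symmetric])
    then show ?thesis by (simp add: exp_of_nat_mult[symmetric] mult.commute)
  qed
  then have "measure_pmf.expectation (Pi_pmf X d (\<lambda>_. \<mu>)) (\<lambda>N. exp (t * real (card {v \<in> X. P (N v)}))) =
      (\<Prod>v\<in>X. measure_pmf.expectation \<mu> (\<lambda>x. if P x then exp t else 1))"
    by (simp only:) (rule expectation_prod_Pi_pmf[OF assms];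
        auto intro!: measure_pmf.integrable_const_bound[where B = "max (exp t) 1"])
  also have "(\<lambda>x. if P x then exp t else 1) = (\<lambda>x. 1 + (exp t - 1) * indicator {x. P x} x)"
    by (auto simp: indicator_def)
  also have "measure_pmf.expectation \<mu> \<dots> = 1 + (exp t - 1) * measure_pmf.prob \<mu> {x. P x}"
  proof -
    have "integrable (measure_pmf \<mu>) (indicator {x. P x} :: _ \<Rightarrow> real)"
      by (rule measure_pmf.integrable_const_bound[where B = 1]) auto
    then show ?thesis by simp
  qed
  finally show ?thesis by (simp add: mult.commute)
qed

text \<open>Serves both tails: for negative \<open>t\<close> the event bounds the count from
  above.\<close>

lemma Pi_pmf_count_chernoff:
  assumes X: "finite X" and t: "measure_pmf.prob \<mu> {x. P x} * real (card X) * (exp t - 1) \<le> b"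
  shows "measure_pmf.prob (Pi_pmf X d (\<lambda>_. \<mu>)) {N. a \<le> t * real (card {v \<in> X. P (N v)})} \<le> exp (b - a)"
proof -
  let ?u = "\<lambda>N. exp (t * real (card {v \<in> X. P (N v)}))"
  have int: "integrable (measure_pmf (Pi_pmf X d (\<lambda>_. \<mu>))) ?u"
  proof (rule measure_pmf.integrable_const_bound[where B = "exp (\<bar>t\<bar> * real (card X))"])
    have "t * real (card {v \<in> X. P (N v)}) \<le> \<bar>t\<bar> * real (card X)" for N
      by (rule order_trans[OF mult_right_mono[of t "\<bar>t\<bar>"]])
         (auto intro!: mult_left_mono card_mono X)
    then show "AE N in measure_pmf (Pi_pmf X d (\<lambda>_. \<mu>)). norm (?u N) \<le> exp (\<bar>t\<bar> * real (card X))"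
      by auto
  qed auto
  have "measure_pmf.prob (Pi_pmf X d (\<lambda>_. \<mu>)) {N. a \<le> t * real (card {v \<in> X. P (N v)})} =
      measure_pmf.prob (Pi_pmf X d (\<lambda>_. \<mu>)) {N \<in> space (measure_pmf (Pi_pmf X d (\<lambda>_. \<mu>))). exp a \<le> ?u N}"
    by simp
  also have "\<dots> \<le> measure_pmf.expectation (Pi_pmf X d (\<lambda>_. \<mu>)) ?u / exp a"
    by (rule integral_Markov_inequality_measure[OF int, where A = "{}"]) auto
  also have "measure_pmf.expectation (Pi_pmf X d (\<lambda>_. \<mu>)) ?u =
      (1 + measure_pmf.prob \<mu> {x. P x} * (exp t - 1)) ^ card X"
    by (rule Pi_pmf_count_mgf[OF X])
  also have "\<dots> \<le> exp (measure_pmf.prob \<mu> {x. P x} * (exp t - 1)) ^ card X"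
  proof (intro power_mono exp_ge_add_one_self)
    have "measure_pmf.prob \<mu> {x. P x} * (1 - exp t) \<le> 1"
      using mult_mono[of "measure_pmf.prob \<mu> {x. P x}" 1 "1 - exp t" 1]
      by (cases "exp t \<le> 1") (auto intro: order_trans[OF mult_nonneg_nonpos])
    then show "0 \<le> 1 + measure_pmf.prob \<mu> {x. P x} * (exp t - 1)" by (simp add: algebra_simps)
  qed
  also have "\<dots> = exp (measure_pmf.prob \<mu> {x. P x} * real (card X) * (exp t - 1))"
    by (simp add: exp_of_nat_mult[symmetric] mult_ac)
  also have "\<dots> \<le> exp b" using t by simp
  finally show ?thesis by (simp add: exp_diff divide_right_mono)
qed

text \<open>The choice t = \<eta> / 2, in place of the optimal ln (1 + \<eta>), gives the exponent M
  (\<eta> / 2 + \<eta>^2 / 4) - (\<eta> / 2) (1 + \<eta>) M = - \<eta>^2 M / 4.\<close>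

lemma Pi_pmf_count_upper_tail:
  assumes X: "finite X" and M: "measure_pmf.prob \<mu> {x. P x} * real (card X) \<le> M" and \<eta>: "0 < \<eta>" "\<eta> \<le> 1"
  shows "measure_pmf.prob (Pi_pmf X d (\<lambda>_. \<mu>)) {N. (1 + \<eta>) * M \<le> real (card {v \<in> X. P (N v)})} \<le> exp (- \<eta>\<^sup>2 * M / 4)"
proof -
  have "exp (\<eta> / 2) \<le> 1 + \<eta> / 2 + (\<eta> / 2)\<^sup>2"
    using \<eta> by (intro exp_bound) auto
  moreover have M0: "0 \<le> M" using M by (rule order_trans[rotated]) simp
  ultimately have "M * (exp (\<eta> / 2) - 1) \<le> M * (\<eta> / 2 + (\<eta> / 2)\<^sup>2)"
    by (intro mult_left_mono) auto
  moreover have "measure_pmf.prob \<mu> {x. P x} * real (card X) * (exp (\<eta> / 2) - 1) \<le> M * (exp (\<eta> / 2) - 1)"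
    using \<eta> by (intro mult_right_mono M) auto
  ultimately have "measure_pmf.prob \<mu> {x. P x} * real (card X) * (exp (\<eta> / 2) - 1) \<le> M * (\<eta> / 2 + (\<eta> / 2)\<^sup>2)"
    by linarith
  from Pi_pmf_count_chernoff[where P = P, OF X this, of d "\<eta> / 2 * ((1 + \<eta>) * M)"]
  have "measure_pmf.prob (Pi_pmf X d (\<lambda>_. \<mu>)) {N. \<eta> / 2 * ((1 + \<eta>) * M) \<le> \<eta> / 2 * real (card {v \<in> X. P (N v)})}
      \<le> exp (M * (\<eta> / 2 + (\<eta> / 2)\<^sup>2) - \<eta> / 2 * ((1 + \<eta>) * M))" .
  also have "M * (\<eta> / 2 + (\<eta> / 2)\<^sup>2) - \<eta> / 2 * ((1 + \<eta>) * M) = - \<eta>\<^sup>2 * M / 4"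
    by (simp add: field_simps power2_eq_square)
  finally show ?thesis using \<eta> by (simp only: mult_le_cancel_left_pos half_gt_zero)
qed

lemma Pi_pmf_count_lower_tail:
  assumes X: "finite X" and M: "M \<le> measure_pmf.prob \<mu> {x. P x} * real (card X)" "0 \<le> M" and \<eta>: "0 < \<eta>"
  shows "measure_pmf.prob (Pi_pmf X d (\<lambda>_. \<mu>)) {N. real (card {v \<in> X. P (N v)}) \<le> (1 - \<eta>) * M} \<le> exp (- \<eta>\<^sup>2 * M / 4)"
proof -
  have "1 + \<eta> / 2 \<le> exp (\<eta> / 2)" by simp
  then have "exp (- (\<eta> / 2)) \<le> 1 / (1 + \<eta> / 2)"
    using \<eta> by (simp add: exp_minus field_simps)
  also have "\<dots> \<le> 1 - \<eta> / 2 + (\<eta> / 2)\<^sup>2"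
    using \<eta> by (simp add: field_simps power2_eq_square)
  finally have "M * (exp (- (\<eta> / 2)) - 1) \<le> M * (- (\<eta> / 2) + (\<eta> / 2)\<^sup>2)"
    using M by (intro mult_left_mono) auto
  moreover have "measure_pmf.prob \<mu> {x. P x} * real (card X) * (exp (- (\<eta> / 2)) - 1) \<le> M * (exp (- (\<eta> / 2)) - 1)"
    using \<eta> by (intro mult_right_mono_neg M) auto
  ultimately have "measure_pmf.prob \<mu> {x. P x} * real (card X) * (exp (- (\<eta> / 2)) - 1) \<le> M * (- (\<eta> / 2) + (\<eta> / 2)\<^sup>2)"
    by linarith
  from Pi_pmf_count_chernoff[where P = P, OF X this, of d "- (\<eta> / 2) * ((1 - \<eta>) * M)"]
  have "measure_pmf.prob (Pi_pmf X d (\<lambda>_. \<mu>)) {N. - (\<eta> / 2) * ((1 - \<eta>) * M) \<le> - (\<eta> / 2) * real (card {v \<in> X. P (N v)})}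
      \<le> exp (M * (- (\<eta> / 2) + (\<eta> / 2)\<^sup>2) - - (\<eta> / 2) * ((1 - \<eta>) * M))" .
  also have "M * (- (\<eta> / 2) + (\<eta> / 2)\<^sup>2) - - (\<eta> / 2) * ((1 - \<eta>) * M) = - \<eta>\<^sup>2 * M / 4"
    by (simp add: field_simps power2_eq_square)
  finally show ?thesis using \<eta> by (simp only: mult_le_cancel_left_neg neg_less_0_iff_less half_gt_zero)
qed

text \<open>Birthday bound: the first half of the sample, if injective, occupies a set of mass
  \<open>\<Sum> pmf \<mu> (N a)\<close> which every point of the second half has to avoid.\<close>

lemma prob_Pi_pmf_inj_on_le:
  fixes \<mu> :: "'b pmf"
  assumes X: "finite X" and s: "2 * s \<le> card X"
    and Q: "0 \<le> Q" "Q \<le> measure_pmf.expectation \<mu> (pmf \<mu>)" and sQ: "1 \<le> real s * sqrt Q"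
  shows "measure_pmf.prob (Pi_pmf X d (\<lambda>_. \<mu>)) {N. inj_on N X} \<le> exp (- real s * sqrt Q / 2)"
proof -
  define Q0 y where "Q0 = measure_pmf.expectation \<mu> (pmf \<mu>)" and "y = real s * sqrt Q0"
  have Q0: "Q \<le> Q0" "0 \<le> Q0" using Q by (auto simp: Q0_def)
  have y: "1 \<le> y" "real s * sqrt Q \<le> y"
    using sQ Q0 by (auto simp: y_def intro: order_trans[OF _ mult_left_mono])
  have int: "integrable (measure_pmf \<mu>) (\<lambda>x. f (pmf \<mu> x))" if "\<And>z. 0 \<le> z \<Longrightarrow> z \<le> 1 \<Longrightarrow> \<bar>f z\<bar> \<le> c"
    for f :: "real \<Rightarrow> real" and c
    by (rule measure_pmf.integrable_const_bound[where B = c]) (use that in \<open>auto simp: pmf_le_1\<close>)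
  \<comment> \<open>The square of an atom is one of the terms of the collision probability. Hence
    \<open>real s * pmf \<mu> x\<close> never exceeds \<open>y\<close>.\<close>
  have pmf_le: "pmf \<mu> x \<le> sqrt Q0" for x
  proof -
    have "(pmf \<mu> x)\<^sup>2 = measure_pmf.expectation \<mu> (\<lambda>z. pmf \<mu> x * indicator {x} z)"
      by (simp add: power2_eq_square measure_pmf_single)
    also have "\<dots> \<le> Q0"
      unfolding Q0_def by (intro integral_mono int[of "\<lambda>z. z" 1])
        (auto simp: indicator_def intro!: measure_pmf.integrable_const_bound[where B = 1] pmf_le_1)
    finally show ?thesis by (simp add: real_le_rsqrt)
  qed
  obtain A where A: "A \<subseteq> X" "card A = s"
    using s by (metis obtain_subset_with_card_n mult_2 le_add1 order_trans)
  define B where "B = X - A"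
  have fin: "finite A" "finite B" "A \<inter> B = {}" "X = A \<union> B"
    using A X by (auto simp: B_def finite_subset)
  have cB: "s \<le> card B"
    unfolding B_def using A X s by (simp add: card_Diff_subset finite_subset)
  \<comment> \<open>The product form allows averaging over the independent values of
    \<open>f\<close>.\<close>
  have step: "measure_pmf.prob (Pi_pmf B d (\<lambda>_. \<mu>)) {g. inj_on (\<lambda>x. if x \<in> A then f x else g x) X}
      \<le> (\<Prod>a\<in>A. exp (- real s * pmf \<mu> (f a)))" for f
  proof (cases "inj_on f A")
    case False
    then have "{g. inj_on (\<lambda>x. if x \<in> A then f x else g x) X} = {}"
      using A by (auto simp: inj_on_def)
    then show ?thesis by (simp add: prod_nonneg)
  next
    case True
    have "measure_pmf.prob \<mu> (- f ` A) = 1 - measure_pmf.prob \<mu> (f ` A)"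
      using measure_pmf.prob_compl[of "f ` A" \<mu>] by (simp add: Compl_eq_Diff_UNIV)
    also have "measure_pmf.prob \<mu> (f ` A) = (\<Sum>a\<in>A. pmf \<mu> (f a))"
      using True fin by (simp add: measure_measure_pmf_finite sum.reindex)
    finally have mu: "measure_pmf.prob \<mu> (- f ` A) = 1 - (\<Sum>a\<in>A. pmf \<mu> (f a))" .
    have "measure_pmf.prob (Pi_pmf B d (\<lambda>_. \<mu>)) {g. inj_on (\<lambda>x. if x \<in> A then f x else g x) X}
        \<le> measure_pmf.prob (Pi_pmf B d (\<lambda>_. \<mu>)) (Pi B (\<lambda>_. - f ` A))"
    proof (intro measure_pmf.finite_measure_mono)
      show "{g. inj_on (\<lambda>x. if x \<in> A then f x else g x) X} \<subseteq> Pi B (\<lambda>_. - f ` A)"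
      proof (intro subsetI Pi_I)
        fix g b assume "g \<in> {g. inj_on (\<lambda>x. if x \<in> A then f x else g x) X}" and b: "b \<in> B"
        then have inj: "inj_on (\<lambda>x. if x \<in> A then f x else g x) X" by simp
        have "f a \<noteq> g b" if a: "a \<in> A" for a
        proof
          assume "f a = g b"
          then have "(if a \<in> A then f a else g a) = (if b \<in> A then f b else g b)"
            using a b by (simp add: B_def)
          from inj_onD[OF inj this] have "a = b" using a b A by (auto simp: B_def)
          then show False using a b by (simp add: B_def)
        qed
        then show "g b \<in> - f ` A" by (metis ComplI imageE)
      qed
    qed simp
    also have "\<dots> = (1 - (\<Sum>a\<in>A. pmf \<mu> (f a))) ^ card B"
      using fin by (simp add: measure_Pi_pmf_Pi mu)
    also have "\<dots> \<le> (1 - (\<Sum>a\<in>A. pmf \<mu> (f a))) ^ s"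
      using cB mu measure_pmf.prob_le_1[of \<mu> "- f ` A"] measure_nonneg[of \<mu> "- f ` A"]
      by (intro power_decreasing) auto
    also have "\<dots> \<le> exp (- (\<Sum>a\<in>A. pmf \<mu> (f a))) ^ s"
      using mu measure_nonneg[of \<mu> "- f ` A"] exp_ge_add_one_self[of "- (\<Sum>a\<in>A. pmf \<mu> (f a))"]
      by (intro power_mono) auto
    also have "\<dots> = exp (- real s * (\<Sum>a\<in>A. pmf \<mu> (f a)))"
      by (simp add: exp_of_nat_mult[symmetric])
    also have "\<dots> = (\<Prod>a\<in>A. exp (- real s * pmf \<mu> (f a)))"
      using fin by (simp add: exp_sum sum_distrib_left)
    finally show ?thesis .
  qed
  have one: "measure_pmf.expectation \<mu> (\<lambda>x. exp (- real s * pmf \<mu> x)) \<le> exp (- real s * Q0 / (1 + y))"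
  proof -
    \<comment> \<open>A bound linear in \<open>pmf \<mu> x\<close> has an expectation expressible by
      \<open>Q0\<close>. The denominator \<open>1 + y\<close> is available because of
      \<open>pmf_le\<close>.\<close>
    have "exp (- real s * pmf \<mu> x) \<le> 1 - real s * pmf \<mu> x / (1 + y)" for x
    proof -
      define z where "z = real s * pmf \<mu> x"
      have z: "0 \<le> z" "z \<le> y" using pmf_le[of x] by (auto simp: z_def y_def intro!: mult_left_mono)
      have "exp (- z) \<le> 1 / (1 + z)"
        using z exp_ge_add_one_self[of z] by (simp add: exp_minus field_simps)
      also have "\<dots> = 1 - z / (1 + z)" using z by (simp add: field_simps)
      also have "\<dots> \<le> 1 - z / (1 + y)" using z by (simp add: frac_le)
      finally show ?thesis by (simp add: z_def)
    qed
    then have "measure_pmf.expectation \<mu> (\<lambda>x. exp (- real s * pmf \<mu> x)) \<le>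
        measure_pmf.expectation \<mu> (\<lambda>x. 1 - real s * pmf \<mu> x / (1 + y))"
    proof (intro integral_mono int[of "\<lambda>z. exp (- real s * z)" 1]
        int[of "\<lambda>z. 1 - real s * z / (1 + y)" "1 + real s"])
      fix z :: real assume z: "0 \<le> z" "z \<le> 1"
      have "real s * z / (1 + y) \<le> real s * 1 / 1"
        using y z by (intro frac_le mult_left_mono) auto
      moreover have "0 \<le> real s * z / (1 + y)" using y z by simp
      ultimately show "\<bar>1 - real s * z / (1 + y)\<bar> \<le> 1 + real s" by simp
    qed auto
    also have "\<dots> = 1 - real s * Q0 / (1 + y)"
      unfolding Q0_def using int[of "\<lambda>z. z" 1] by (subst Bochner_Integration.integral_diff) auto
    also have "\<dots> \<le> exp (- real s * Q0 / (1 + y))"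
      using exp_ge_add_one_self[of "- real s * Q0 / (1 + y)"] by simp
    finally show ?thesis .
  qed
  have "measure_pmf.prob (Pi_pmf X d (\<lambda>_. \<mu>)) {N. inj_on N X} =
      measure_pmf.expectation (Pi_pmf A d (\<lambda>_. \<mu>)) (\<lambda>f. measure_pmf.prob (Pi_pmf B d (\<lambda>_. \<mu>))
        {g. inj_on (\<lambda>x. if x \<in> A then f x else g x) X})"
    unfolding \<open>X = A \<union> B\<close> using fin(1-3)
    by (simp add: Pi_pmf_union measure_map_pmf prob_pair_pmf_eq vimage_def)
  also have "\<dots> \<le> measure_pmf.expectation (Pi_pmf A d (\<lambda>_. \<mu>)) (\<lambda>f. \<Prod>a\<in>A. exp (- real s * pmf \<mu> (f a)))"
    by (intro integral_mono step measure_pmf.integrable_const_bound[where B = 1] AE_pmfI)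
       (auto simp: abs_prod intro!: prod_le_1)
  also have "\<dots> = (\<Prod>a\<in>A. measure_pmf.expectation \<mu> (\<lambda>x. exp (- real s * pmf \<mu> x)))"
    using fin by (intro expectation_prod_Pi_pmf int[of "\<lambda>z. exp (- real s * z)" 1]) auto
  also have "\<dots> = measure_pmf.expectation \<mu> (\<lambda>x. exp (- real s * pmf \<mu> x)) ^ s"
    by (simp add: A)
  also have "\<dots> \<le> exp (- real s * Q0 / (1 + y)) ^ s"
    by (intro power_mono one Bochner_Integration.integral_nonneg) auto
  also have "\<dots> = exp (- (y\<^sup>2 / (1 + y)))"
    using Q0 by (simp add: exp_of_nat_mult[symmetric] y_def power_mult_distrib) (simp add: power2_eq_square)
  \<comment> \<open>Here \<open>1 \<le> y\<close> enters, that is, \<open>s\<close> is at least the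
    birthday threshold 1 / sqrt Q.\<close>
  also have "\<dots> \<le> exp (- (y / 2))"
    using y by (simp add: field_simps power2_eq_square)
  also have "\<dots> \<le> exp (- real s * sqrt Q / 2)" using y by simp
  finally show ?thesis .
qed


section \<open>Collision probability of traces on overlapping sets\<close>

lemma prob_rset_avoid:
  assumes "finite A" "D \<subseteq> A" "0 \<le> p" "p \<le> 1"
  shows "measure_pmf.prob (rset A p) {N. N \<inter> D = {}} = (1 - p) ^ card D"
  using prob_rset_cylinder[OF assms(1,2), of "{}" p] assms by simp

lemma prob_rset_hit:
  assumes "finite A" "D \<subseteq> A" "0 \<le> p" "p \<le> 1"
  shows "measure_pmf.prob (rset A p) {N. N \<inter> D \<noteq> {}} = 1 - (1 - p) ^ card D"
  using prob_rset_avoid[OF assms] measure_pmf.prob_compl[of "{N. N \<inter> D = {}}" "rset A p"]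
  by (simp add: Collect_neg_eq[symmetric] Compl_eq_Diff_UNIV[symmetric])

lemma prob_rset_blocks:
  assumes I: "finite I" and P: "\<And>i. i \<in> I \<Longrightarrow> finite (P i)" "disjoint_family_on P I"
    and p: "0 \<le> p" "p \<le> 1"
  shows "measure_pmf.prob (rset (\<Union>i\<in>I. P i) p) {N. \<forall>i\<in>I. N \<inter> P i \<noteq> {} \<longleftrightarrow> i \<in> x} =
    (\<Prod>i\<in>I. if i \<in> x then 1 - (1 - p) ^ card (P i) else (1 - p) ^ card (P i))"
  using I P
proof (induction I rule: finite_induct)
  case (insert i I)
  define U where "U = (\<Union>j\<in>I. P j)"
  have U: "finite U" "P i \<inter> U = {}" "finite (P i)"
    using insert by (auto simp: U_def disjoint_family_on_def)
  define B where "B = {N. \<forall>j\<in>I. N \<inter> P j \<noteq> {} \<longleftrightarrow> j \<in> x}"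
  have "measure_pmf.prob (rset (P i \<union> U) p) {N. \<forall>j\<in>insert i I. N \<inter> P j \<noteq> {} \<longleftrightarrow> j \<in> x} =
      measure_pmf.prob (pair_pmf (rset (P i) p) (rset U p))
        ((\<lambda>(S, T). S \<union> T) -` {N. \<forall>j\<in>insert i I. N \<inter> P j \<noteq> {} \<longleftrightarrow> j \<in> x})"
    using U p by (simp add: rset_Un measure_map_pmf)
  also have "\<dots> = measure_pmf.prob (pair_pmf (rset (P i) p) (rset U p)) ({S. S \<inter> P i \<noteq> {} \<longleftrightarrow> i \<in> x} \<times> B)"
  proof (rule measure_pmf.finite_measure_eq_AE)
    show "AE y in pair_pmf (rset (P i) p) (rset U p).
      y \<in> (\<lambda>(S, T). S \<union> T) -` {N. \<forall>j\<in>insert i I. N \<inter> P j \<noteq> {} \<longleftrightarrow> j \<in> x} \<longleftrightarrow>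
      y \<in> {S. S \<inter> P i \<noteq> {} \<longleftrightarrow> i \<in> x} \<times> B"
    proof (rule AE_pmfI)
      fix y assume "y \<in> set_pmf (pair_pmf (rset (P i) p) (rset U p))"
      then obtain S T where y: "y = (S, T)" "S \<subseteq> P i" "T \<subseteq> U"
        using set_pmf_rset[of "P i" p] set_pmf_rset[of U p] by (cases y) auto
      have "(S \<union> T) \<inter> P i = S \<inter> P i" using y U by blast
      moreover have "(S \<union> T) \<inter> P j = T \<inter> P j" if "j \<in> I" for j
        using y U that by (auto simp: U_def)
      ultimately show "y \<in> (\<lambda>(S, T). S \<union> T) -` {N. \<forall>j\<in>insert i I. N \<inter> P j \<noteq> {} \<longleftrightarrow> j \<in> x} \<longleftrightarrow>
          y \<in> {S. S \<inter> P i \<noteq> {} \<longleftrightarrow> i \<in> x} \<times> B"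
        by (simp add: y(1) B_def)
    qed
  qed auto
  also have "\<dots> = measure_pmf.prob (rset (P i) p) {S. S \<inter> P i \<noteq> {} \<longleftrightarrow> i \<in> x} * measure_pmf.prob (rset U p) B"
    by (rule prob_pair_pmf_Times)
  also have "measure_pmf.prob (rset (P i) p) {S. S \<inter> P i \<noteq> {} \<longleftrightarrow> i \<in> x} =
      (if i \<in> x then 1 - (1 - p) ^ card (P i) else (1 - p) ^ card (P i))"
    using U p by (simp add: prob_rset_avoid prob_rset_hit)
  also have "measure_pmf.prob (rset U p) B =
      (\<Prod>j\<in>I. if j \<in> x then 1 - (1 - p) ^ card (P j) else (1 - p) ^ card (P j))"
    unfolding B_def U_def using insert by (intro insert.IH) (auto simp: disjoint_family_on_def)
  finally show ?case using insert by (simp add: U_def)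
qed simp

text \<open>On the event of avoiding the common part \<open>C\<close>, the traces on the overlapping sets \<open>D r\<close> are
  decided by the disjoint private parts \<open>P r\<close>, hence independent.\<close>

lemma trace_collision_ge:
  fixes D P :: "'r \<Rightarrow> 'a set"
  assumes W: "finite W" and R: "finite R" and p: "0 \<le> p" "p \<le> 1"
    and C: "C \<subseteq> W" and P: "disjoint_family_on P R" "\<And>r. r \<in> R \<Longrightarrow> P r \<subseteq> W - C"
      "\<And>r. r \<in> R \<Longrightarrow> P r \<subseteq> D r" "\<And>r. r \<in> R \<Longrightarrow> D r \<inter> W \<subseteq> P r \<union> C"
  defines "\<mu> \<equiv> map_pmf (\<lambda>N. {r \<in> R. N \<inter> D r \<noteq> {}}) (rset W p)"
  shows "(1 - p) ^ (2 * card C) * (\<Prod>r\<in>R. (1 - (1 - p) ^ card (P r))\<^sup>2 + ((1 - p) ^ card (P r))\<^sup>2)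
    \<le> measure_pmf.expectation \<mu> (pmf \<mu>)"
proof -
  define a where "a = (\<lambda>r. (1 - p) ^ card (P r))"
  have a: "0 \<le> a r" "a r \<le> 1" for r using p by (auto simp: a_def power_le_one)
  define U where "U = (\<Union>r\<in>R. P r)"
  have U: "finite U" "U \<subseteq> W" "C \<subseteq> W - U" "\<And>r. r \<in> R \<Longrightarrow> finite (P r)"
    using P C W R by (auto simp: U_def intro: finite_subset)
  have low: "(1 - p) ^ card C * ((\<Prod>r\<in>x. 1 - a r) * (\<Prod>r\<in>R - x. a r)) \<le> pmf \<mu> x" if x: "x \<subseteq> R" for x
  proof -
    define B where "B = {N. \<forall>r\<in>R. N \<inter> P r \<noteq> {} \<longleftrightarrow> r \<in> x}"
    have "measure_pmf.prob (rset U p) B = (\<Prod>r\<in>R. if r \<in> x then 1 - a r else a r)"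
      unfolding B_def U_def a_def using R P p U by (intro prob_rset_blocks) auto
    also have "\<dots> = (\<Prod>r\<in>x. 1 - a r) * (\<Prod>r\<in>R - x. a r)"
      using R x by (subst prod.subset_diff[OF x R]) (simp add: mult.commute)
    finally have "(1 - p) ^ card C * ((\<Prod>r\<in>x. 1 - a r) * (\<Prod>r\<in>R - x. a r)) =
        measure_pmf.prob (rset U p) B * measure_pmf.prob (rset (W - U) p) {N. N \<inter> C = {}}"
      using W p U by (simp add: prob_rset_avoid)
    also have "\<dots> = measure_pmf.prob (pair_pmf (rset U p) (rset (W - U) p)) (B \<times> {N. N \<inter> C = {}})"
      by (rule prob_pair_pmf_Times[symmetric])
    also have "\<dots> \<le> measure_pmf.prob (pair_pmf (rset U p) (rset (W - U) p))
        ((\<lambda>(S, T). S \<union> T) -` ((\<lambda>N. {r \<in> R. N \<inter> D r \<noteq> {}}) -` {x}))"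
    proof (rule measure_pmf.finite_measure_mono_AE)
      show "AE y in pair_pmf (rset U p) (rset (W - U) p). y \<in> B \<times> {N. N \<inter> C = {}} \<longrightarrow>
          y \<in> (\<lambda>(S, T). S \<union> T) -` ((\<lambda>N. {r \<in> R. N \<inter> D r \<noteq> {}}) -` {x})"
      proof (rule AE_pmfI, rule impI)
        fix y assume "y \<in> set_pmf (pair_pmf (rset U p) (rset (W - U) p))" and y: "y \<in> B \<times> {N. N \<inter> C = {}}"
        then obtain S T where ST: "y = (S, T)" "S \<subseteq> U" "T \<subseteq> W - U"
          using set_pmf_rset[of U p] set_pmf_rset[of "W - U" p] by (cases y) auto
        have "(S \<union> T) \<inter> D r \<noteq> {} \<longleftrightarrow> r \<in> x" if r: "r \<in> R" for r
        proof -
          have "P r \<subseteq> U" using r by (auto simp: U_def)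
          then have "(S \<union> T) \<inter> D r = S \<inter> P r"
            using P(3,4)[OF r] ST y U by blast
          then show ?thesis using y r ST by (auto simp: B_def)
        qed
        then show "y \<in> (\<lambda>(S, T). S \<union> T) -` ((\<lambda>N. {r \<in> R. N \<inter> D r \<noteq> {}}) -` {x})"
          using ST x by auto
      qed
    qed simp
    also have "\<dots> = pmf \<mu> x"
    proof -
      have "rset W p = map_pmf (\<lambda>(S, T). S \<union> T) (pair_pmf (rset U p) (rset (W - U) p))"
        using rset_Un[of U "W - U" p] U W p by (simp add: Un_absorb1)
      then show ?thesis by (simp only: \<mu>_def pmf_map measure_map_pmf)
    qed
    finally show ?thesis .
  qed
  \<comment> \<open>Expanding the product gives one summand for each trace \<open>x\<close>, the
    square of the lower bound \<open>low\<close>. The sum of the squared point masses is the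
    collision probability.\<close>
  have "(1 - p) ^ (2 * card C) * (\<Prod>r\<in>R. (1 - a r)\<^sup>2 + (a r)\<^sup>2) =
      (\<Sum>x\<in>Pow R. ((1 - p) ^ card C * ((\<Prod>r\<in>x. 1 - a r) * (\<Prod>r\<in>R - x. a r)))\<^sup>2)"
    by (simp add: prod_add[OF R] sum_distrib_left power_mult_distrib prod_power_distrib power_mult[symmetric] mult.commute[of _ 2])
  also have "\<dots> \<le> (\<Sum>x\<in>Pow R. (pmf \<mu> x)\<^sup>2)"
    using p a by (intro sum_mono power_mono low mult_nonneg_nonneg prod_nonneg) auto
  also have "\<dots> = measure_pmf.expectation \<mu> (pmf \<mu>)"
    by (subst integral_measure_pmf_real[where A = "Pow R"])
       (use R in \<open>auto simp: \<mu>_def power2_eq_square\<close>)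
  finally show ?thesis by (simp add: a_def)
qed

text \<open>The probability that two independent bits agree, each being 0 with probability exp (-
  x). The bit records whether a vertex has a neighbour in a given sphere.\<close>

definition agree :: "real \<Rightarrow> real" where
  "agree x = (exp (- x))\<^sup>2 + (1 - exp (- x))\<^sup>2"

lemma agree_ge_half: "1 / 2 \<le> agree x"
proof -
  have "agree x - 1 / 2 = 2 * (exp (- x) - 1 / 2)\<^sup>2"
    by (simp add: agree_def power2_eq_square algebra_simps)
  then show ?thesis by (smt (verit) zero_le_power2)
qed

text \<open>In terms of a = exp (- x), which is 1-Lipschitz in x \<ge> 0, \<open>agree\<close> is
  a^2 + (1 - a)^2 with slope at most 2 on [0, 1]. As \<open>agree\<close> is at least 1 / 2, its
  logarithm is 4-Lipschitz.\<close>

lemma ln_agree_ge: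
  assumes "0 \<le> x" "0 \<le> y"
  shows "ln (agree y) - 4 * \<bar>x - y\<bar> \<le> ln (agree x)"
proof -
  have exp_diff_le: "exp (- u) - exp (- v) \<le> \<bar>u - v\<bar>" if "0 \<le> u" "0 \<le> v" for u v :: real
  proof (cases "u \<le> v")
    case True
    have "exp (- u) - exp (- v) = exp (- u) * (1 - exp (- (v - u)))"
      by (simp add: algebra_simps flip: exp_add)
    also have "\<dots> \<le> 1 * (v - u)"
    proof (intro mult_mono)
      have "1 + (u - v) \<le> exp (u - v)" by (rule exp_ge_add_one_self)
      moreover have "- (v - u) = u - v" by simp
      ultimately show "1 - exp (- (v - u)) \<le> v - u" by (simp only:)
    qed (use that True in auto)
    finally show ?thesis using True by simp
  next
    case False
    then have "exp (- u) \<le> exp (- v)" by simp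
    then show ?thesis by linarith
  qed
  define a b where "a = exp (- x)" and "b = exp (- y)"
  have ab: "0 \<le> a" "a \<le> 1" "0 \<le> b" "b \<le> 1" "\<bar>a - b\<bar> \<le> \<bar>x - y\<bar>"
    using assms exp_diff_le[of x y] exp_diff_le[of y x] by (auto simp: a_def b_def)
  have "agree y - agree x = 2 * ((b - a) * (a + b - 1))"
    by (simp add: agree_def a_def[symmetric] b_def[symmetric] power2_eq_square algebra_simps)
  also have "\<dots> \<le> 2 * (\<bar>b - a\<bar> * \<bar>a + b - 1\<bar>)"
    by (simp add: abs_mult[symmetric])
  also have "\<dots> \<le> 2 * (\<bar>x - y\<bar> * 1)"
    using ab by (intro mult_left_mono mult_mono) auto
  finally have diff: "agree y - agree x \<le> 2 * \<bar>x - y\<bar>" by simp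
  have pos: "0 < agree x" "0 < agree y" using agree_ge_half[of x] agree_ge_half[of y] by linarith+
  have "ln (agree y) - ln (agree x) = ln (agree y / agree x)"
    using pos by (simp add: ln_div)
  also have "\<dots> \<le> agree y / agree x - 1"
    using pos by (intro ln_le_minus_one) simp
  also have "\<dots> = (agree y - agree x) / agree x" using pos by (simp add: field_simps)
  also have "\<dots> \<le> 2 * \<bar>x - y\<bar> / agree x" using diff pos by (intro divide_right_mono) auto
  also have "\<dots> \<le> 2 * \<bar>x - y\<bar> / (1 / 2)" using agree_ge_half[of x] by (intro divide_left_mono) (auto intro: less_le_trans)
  finally show ?thesis by simp
qed

subsection \<open>Growth of the layers and the diameter\<close>

lemma set_pmf_random_graph: "E \<in> set_pmf (random_graph n p) \<Longrightarrow> E \<subseteq> vertex_pairs n"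
  unfolding random_graph_rset using set_pmf_rset[of "vertex_pairs n" p] by auto

lemma prob_random_graph_mono:
  assumes "\<And>E. E \<subseteq> vertex_pairs n \<Longrightarrow> P E \<Longrightarrow> Q E"
  shows "measure_pmf.prob (random_graph n p) {E. P E} \<le> measure_pmf.prob (random_graph n p) {E. Q E}"
  by (rule measure_pmf.finite_measure_mono_AE)
     (auto intro!: AE_pmfI dest: set_pmf_random_graph simp: assms)

lemma prob_disj_le:
  "measure_pmf.prob M {x. P x \<or> Q x} \<le> measure_pmf.prob M {x. P x} + measure_pmf.prob M {x. Q x}"
  by (simp add: Collect_disj_eq measure_Un_le)

lemma prob_bex_le:
  assumes "finite A"
  shows "measure_pmf.prob M {x. \<exists>a\<in>A. P a x} \<le> (\<Sum>a\<in>A. measure_pmf.prob M {x. P a x})"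
proof -
  have "{x. \<exists>a\<in>A. P a x} = (\<Union>a\<in>A. {x. P a x})" by auto
  then show ?thesis using measure_UNION_le[OF assms, of "\<lambda>a. {x. P a x}" M] by simp
qed

lemma one_minus_power_le_exp:
  fixes p :: real
  assumes "p \<le> 1"
  shows "(1 - p) ^ s \<le> exp (- p * real s)"
proof -
  have "(1 - p) ^ s \<le> exp (- p) ^ s"
    using assms exp_ge_add_one_self[of "- p"] by (intro power_mono) auto
  then show ?thesis by (simp add: exp_of_nat_mult[symmetric] mult.commute)
qed

text \<open>The mean z = p s overestimates the probability of a hit by a relative error of at most
  z. This follows from exp (- z) \<le> 1 / (1 + z) and (1 - z + z^2) (1 + z) = 1 + z^3.\<close>

lemma one_minus_power_le_quadratic:
  fixes p :: real
  assumes "0 \<le> p" "p \<le> 1"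
  shows "p * real s * (1 - p * real s) \<le> 1 - (1 - p) ^ s"
proof -
  define z where "z = p * real s"
  have z: "0 \<le> z" using assms by (simp add: z_def)
  have "(1 - p) ^ s \<le> exp (- z)" using one_minus_power_le_exp[of p s] assms by (simp add: z_def)
  also have "\<dots> \<le> 1 / (1 + z)"
    using z exp_ge_add_one_self[of z] by (simp add: exp_minus field_simps)
  also have "\<dots> \<le> 1 - z * (1 - z)"
  proof -
    have "(1 - z * (1 - z)) * (1 + z) = 1 + z ^ 3" by (simp add: algebra_simps power3_eq_cube)
    then show ?thesis using z by (simp add: divide_le_eq)
  qed
  finally show ?thesis by (simp add: z_def)
qed

text \<open>\<open>r\<close> bounds the size of the source sets, and \<open>\<eta>\<close> is the relative error admitted in each layer.
  The bound \<open>exp (- 4 * card R * ln n)\<close> which \<open>conc\<close> yields beats the \<open>n ^ card R\<close> choices of \<open>R\<close>.\<close>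

locale gnp =
  fixes n r i :: nat and p d \<eta> :: real
  assumes n2: "2 \<le> n" and r1: "1 \<le> r" and p0: "0 < p" and p1: "p < 1"
    and d_eq: "d = p * (real n - 1)" and d2: "2 \<le> d"
    and eta0: "0 < \<eta>" and eta1: "\<eta> \<le> 1 / 2" and i_eta: "real i * \<eta> \<le> 1 / 2"
    and sparse: "8 * real r * d ^ i \<le> \<eta> * (real n - 1)"
    and conc: "256 * ln (real n) \<le> \<eta>\<^sup>2 * d"
begin

abbreviation prG :: "nat set set set \<Rightarrow> real" where
  "prG \<equiv> measure_pmf.prob (random_graph n p)"

text \<open>The reference value card R d^m is that of pairwise disjoint spheres. Comparing it with
  the spheres around single vertices later forces the overlaps to be small.\<close>

definition good :: "nat set set \<Rightarrow> nat set \<Rightarrow> nat \<Rightarrow> bool" where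
  "good E R k \<longleftrightarrow> (\<forall>m\<le>k.
     real (card R) * d ^ m * (1 - \<eta>) ^ m \<le> real (card (layer E R m)) \<and>
     real (card (layer E R m)) \<le> real (card R) * d ^ m * (1 + \<eta>) ^ m)"

lemma good_0: "good E R 0"
  by (simp add: good_def)

lemma good_cong:
  assumes "\<And>m. m \<le> Suc k \<Longrightarrow> reach F R m = reach E R m"
  shows "good F R k \<longleftrightarrow> good E R k"
  using assms by (simp add: good_def layer_def)

text \<open>As i \<eta> \<le> 1 / 2, the error compounded over all layers stays linear in i \<eta>,
  the form in which it enters \<open>code_rate\<close>.\<close>

lemma power_up:
  assumes "m \<le> i"
  shows "(1 + \<eta>) ^ m \<le> 1 + 2 * real i * \<eta>"
proof -
  have "(1 + \<eta>) ^ m \<le> (1 + \<eta>) ^ i" using assms eta0 by (intro power_increasing) auto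
  also have "\<dots> \<le> exp \<eta> ^ i" using eta0 exp_ge_add_one_self[of \<eta>] by (intro power_mono) auto
  also have "\<dots> = exp (real i * \<eta>)" by (simp add: exp_of_nat_mult[symmetric])
  also have "\<dots> \<le> 1 + real i * \<eta> + (real i * \<eta>)\<^sup>2"
    using i_eta eta0 by (intro exp_bound) auto
  also have "(real i * \<eta>)\<^sup>2 \<le> real i * \<eta> * 1"
    unfolding power2_eq_square using i_eta eta0 by (intro mult_left_mono) auto
  finally show ?thesis by (simp add: mult_ac)
qed

lemma power_up_le_2: "m \<le> i \<Longrightarrow> (1 + \<eta>) ^ m \<le> 2"
  using power_up[of m] i_eta by linarith

lemma power_down:
  assumes "m \<le> i"
  shows "1 - real i * \<eta> \<le> (1 - \<eta>) ^ m"
proof -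
  have "1 + real i * (- \<eta>) \<le> (1 + - \<eta>) ^ i"
    using eta1 by (intro Bernoulli_inequality) auto
  also have "\<dots> \<le> (1 - \<eta>) ^ m" using assms eta0 eta1 by (auto intro: power_decreasing)
  finally show ?thesis by simp
qed

lemma power_down_ge_half: "m \<le> i \<Longrightarrow> 1 / 2 \<le> (1 - \<eta>) ^ m"
  using power_down[of m] i_eta by linarith

lemma card_layer_bounds:
  assumes "good E R k" "m \<le> k" "k \<le> i"
  shows "real (card R) * d ^ m / 2 \<le> real (card (layer E R m))"
    and "real (card (layer E R m)) \<le> 2 * real (card R) * d ^ m"
proof -
  have "real (card R) * d ^ m * (1 / 2) \<le> real (card R) * d ^ m * (1 - \<eta>) ^ m"
    using assms d2 by (intro mult_left_mono power_down_ge_half) auto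
  also have "\<dots> \<le> real (card (layer E R m))" using assms by (simp add: good_def)
  finally show "real (card R) * d ^ m / 2 \<le> real (card (layer E R m))" by simp
  have "real (card (layer E R m)) \<le> real (card R) * d ^ m * (1 + \<eta>) ^ m"
    using assms by (simp add: good_def)
  also have "\<dots> \<le> real (card R) * d ^ m * 2"
    using assms d2 by (intro mult_left_mono power_up_le_2) auto
  finally show "real (card (layer E R m)) \<le> 2 * real (card R) * d ^ m" by simp
qed

lemma geometric_sum_le: "(\<Sum>m\<le>k. d ^ m) \<le> 2 * d ^ k"
proof (induction k)
  case (Suc k)
  have "2 * d ^ k \<le> d * d ^ k" using d2 by (intro mult_right_mono) auto
  then show ?case using Suc by simp
qed simp

lemma card_reach_le:
  assumes "good E R k" "k \<le> i"
  shows "real (card (reach E R (Suc k))) \<le> 4 * real (card R) * d ^ k"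
proof -
  have "real (card (reach E R (Suc k))) \<le> (\<Sum>m\<le>k. real (card (layer E R m)))"
    unfolding reach_eq_UN_layer using card_UN_le[of "{..k}" "layer E R"]
    by (metis finite_atMost of_nat_mono of_nat_sum)
  also have "\<dots> \<le> (\<Sum>m\<le>k. 2 * real (card R) * d ^ m)"
    using assms by (intro sum_mono card_layer_bounds) auto
  also have "\<dots> = 2 * real (card R) * (\<Sum>m\<le>k. d ^ m)" by (simp add: sum_distrib_left)
  also have "\<dots> \<le> 2 * real (card R) * (2 * d ^ k)"
    by (intro mult_left_mono geometric_sum_le) auto
  finally show ?thesis by simp
qed

lemma card_outer:
  assumes "R \<subseteq> {1..n}" "E \<subseteq> vertex_pairs n"
  shows "real (card (outer n E R k)) = real n - real (card (reach E R (Suc k)))"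
proof -
  have sub: "reach E R (Suc k) \<subseteq> {1..n}" by (rule reach_subset_vertices[OF assms])
  then have "card (outer n E R k) = n - card (reach E R (Suc k))"
    unfolding outer_def by (subst card_Diff_subset) (auto intro: finite_subset)
  moreover have "card (reach E R (Suc k)) \<le> n" using card_mono[OF _ sub] by simp
  ultimately show ?thesis by (simp add: of_nat_diff)
qed

lemma finite_layer:
  assumes "R \<subseteq> {1..n}" "E \<subseteq> vertex_pairs n"
  shows "finite (layer E R k)"
  unfolding layer_def using finite_reach[OF assms] by auto

lemma finite_outer: "finite (outer n E R k)"
  by (simp add: outer_def)

lemma prob_nbhd_nonempty:
  assumes "finite W"
  shows "measure_pmf.prob (rset W p) {N. N \<noteq> {}} = 1 - (1 - p) ^ card W"
proof -
  have "measure_pmf.prob (rset W p) {N. N \<noteq> {}} = measure_pmf.prob (rset W p) {N. N \<inter> W \<noteq> {}}"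
    using set_pmf_rset[of W p] by (intro measure_pmf.finite_measure_eq_AE AE_pmfI) auto
  then show ?thesis using assms p0 p1 by (simp add: prob_rset_hit)
qed

text \<open>Given a layer of size s, the next one is a binomial count with mean between d s (1 -
  \<eta> / 2) and d s. Upwards the whole factor 1 + \<eta> is left to the Chernoff bound; downwards
  1 - \<eta> is split into two factors 1 - \<eta> / 2, one for the mean and one for the
  fluctuation.\<close>

lemma growth_step:
  assumes R: "R \<subseteq> {1..n}" "1 \<le> card R" "card R \<le> r" and k: "k < i"
  shows "prG {E. good E R k \<and> \<not> good E R (Suc k)} \<le> 2 * exp (- 4 * real (card R) * ln (real n))"
proof -
  define \<rho> lo hi where "\<rho> = real (card R)" and "lo = \<rho> * d ^ Suc k * (1 - \<eta>) ^ Suc k"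
    and "hi = \<rho> * d ^ Suc k * (1 + \<eta>) ^ Suc k"
  have \<rho>: "1 \<le> \<rho>" "\<rho> \<le> real r" using R by (auto simp: \<rho>_def)
  have dk: "d ^ Suc k \<le> d ^ i" using k d2 by (intro power_increasing) auto
  have n1: "0 < real n - 1" using n2 by simp
  define \<Phi> where "\<Phi> = (\<lambda>E (N :: nat \<Rightarrow> nat set). good E R k \<and>
    (real (card {v \<in> outer n E R k. N v \<noteq> {}}) < lo \<or> hi < real (card {v \<in> outer n E R k. N v \<noteq> {}})))"
  have "prG {E. good E R k \<and> \<not> good E R (Suc k)} \<le> prG {E. \<Phi> E (outer_nbhds n E R k)}"
  proof (rule prob_random_graph_mono)
    fix E assume "E \<subseteq> vertex_pairs n" "good E R k \<and> \<not> good E R (Suc k)"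
    then show "\<Phi> E (outer_nbhds n E R k)"
      unfolding \<Phi>_def lo_def hi_def \<rho>_def layer_Suc_eq[OF R(1) \<open>E \<subseteq> vertex_pairs n\<close>, symmetric]
      by (auto simp: good_def le_Suc_eq simp del: power_Suc)
  qed
  also have "\<dots> \<le> 2 * exp (- 4 * \<rho> * ln (real n))"
  proof (rule random_graph_exposure[OF R(1)])
    show "\<Phi> E N" if "\<And>S m. S \<subseteq> R \<Longrightarrow> m \<le> Suc k \<Longrightarrow> reach F S m = reach E S m" "\<Phi> F N" for E F N
      using that(2) that(1)[of R] good_cong[of k F R E] by (simp add: \<Phi>_def outer_def)
    fix E assume E: "E \<subseteq> vertex_pairs n"
    define W X where "W = layer E R k" and "X = outer n E R k"
    have fin: "finite W" "finite X"
      using finite_layer[OF R(1) E] finite_outer by (auto simp: W_def X_def)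
    define s where "s = real (card W)"
    define M where "M = d * s * (1 - \<eta> / 2)"
    let ?pr = "measure_pmf.prob (Pi_pmf X {} (\<lambda>_. rset W p))"
    let ?Y = "\<lambda>N. real (card {v \<in> X. N v \<noteq> {}})"
    show "measure_pmf.prob (Pi_pmf (outer n E R k) {} (\<lambda>_. rset (layer E R k) p)) {N. \<Phi> E N}
        \<le> 2 * exp (- 4 * \<rho> * ln (real n))"
    proof (cases "good E R k")
      case False
      then show ?thesis by (simp add: \<Phi>_def)
    next
      case True
      have s_lo: "\<rho> * d ^ k * (1 - \<eta>) ^ k \<le> s" and s_hi: "s \<le> \<rho> * d ^ k * (1 + \<eta>) ^ k"
        using True by (auto simp: good_def s_def W_def \<rho>_def)
      have s_half: "\<rho> * d ^ k / 2 \<le> s" and s_two: "s \<le> 2 * \<rho> * d ^ k"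
        using card_layer_bounds[OF True, of k] k by (auto simp: s_def W_def \<rho>_def)
      have "\<rho> / 2 \<le> \<rho> * d ^ k / 2" using \<rho> d2 by simp
      then have s_rho: "\<rho> / 2 \<le> s" using s_half by linarith
      have s0: "0 \<le> s" by (simp add: s_def)
      have rdi: "\<rho> * d ^ Suc k \<le> real r * d ^ i"
        using \<rho> dk d2 by (intro mult_mono) auto
      have pi_le: "1 - (1 - p) ^ card W \<le> p * s"
        using Bernoulli_inequality[of "- p" "card W"] p1 by (simp add: s_def mult.commute)
      have card_X: "real (card X) = real n - real (card (reach E R (Suc k)))"
        unfolding X_def by (rule card_outer[OF R(1) E])
      have "R \<subseteq> reach E R (Suc k)" by (auto simp: reach.simps(2))
      then have "card R \<le> card (reach E R (Suc k))"
        using finite_reach[OF R(1) E] by (intro card_mono) auto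
      \<comment> \<open>At least one vertex is already explored, which matches the factor
        \<open>real n - 1\<close> in \<open>d\<close>.\<close>
      then have X_le: "real (card X) \<le> real n - 1" using card_X R by simp
      have upper: "?pr {N. (1 + \<eta>) * (d * s) \<le> ?Y N} \<le> exp (- \<eta>\<^sup>2 * (d * s) / 4)"
      proof (rule Pi_pmf_count_upper_tail[OF fin(2)])
        have "(1 - (1 - p) ^ card W) * real (card X) \<le> p * s * (real n - 1)"
          using pi_le X_le p0 s0 by (intro mult_mono) auto
        then show "measure_pmf.prob (rset W p) {x. x \<noteq> {}} * real (card X) \<le> d * s"
          using fin by (simp add: prob_nbhd_nonempty d_eq mult_ac)
      qed (use eta0 eta1 in auto)
      have lower: "?pr {N. ?Y N \<le> (1 - \<eta> / 2) * M} \<le> exp (- (\<eta> / 2)\<^sup>2 * M / 4)"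
      proof (rule Pi_pmf_count_lower_tail[OF fin(2)])
        have "p * s \<le> p * (2 * \<rho> * d ^ k)" using p0 s_two by (intro mult_left_mono) auto
        also have "\<dots> = 2 * (\<rho> * d ^ Suc k) / (real n - 1)" using n1 by (simp add: d_eq field_simps)
        also have "\<dots> \<le> 2 * (real r * d ^ i) / (real n - 1)"
          using rdi n1 by (intro divide_right_mono) auto
        also have "\<dots> \<le> \<eta> / 4" using sparse n1 by (simp add: field_simps)
        finally have ps: "p * s \<le> \<eta> / 4" .
        have "2 * (\<rho> * d ^ k) \<le> \<rho> * d ^ Suc k"
          using mult_right_mono[OF d2, of "\<rho> * d ^ k"] \<rho> d2 by (simp add: mult_ac)
        then have "4 * \<rho> * d ^ k \<le> \<eta> * (real n - 1) / 4"
          using rdi sparse by simp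
        then have "real (card (reach E R (Suc k))) \<le> \<eta> * (real n - 1) / 4"
          using card_reach_le[OF True] k by (simp add: \<rho>_def)
        then have X_ge: "(real n - 1) * (1 - \<eta> / 4) \<le> real (card X)"
        proof -
          have "(real n - 1) * (1 - \<eta> / 4) = (real n - 1) - \<eta> * (real n - 1) / 4"
            by (simp add: field_simps)
          then show ?thesis using card_X \<open>real (card (reach E R (Suc k))) \<le> _\<close> by linarith
        qed
        \<comment> \<open>One factor 1 - \<eta> / 4 pays for vertices with several neighbours in the
          layer, the other for the vertices already explored. Both rest on
          \<open>sparse\<close>.\<close>
        have "(1 - \<eta> / 2) * (real n - 1) \<le> ((1 - \<eta> / 4) * (1 - \<eta> / 4)) * (real n - 1)"
          using n1 by (intro mult_right_mono) (auto simp: algebra_simps)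
        also have "\<dots> \<le> (1 - p * s) * real (card X)"
          unfolding mult.assoc using ps X_ge eta0 eta1 n1 by (intro mult_mono) (auto simp: mult.commute)
        finally have "p * s * ((1 - \<eta> / 2) * (real n - 1)) \<le> p * s * ((1 - p * s) * real (card X))"
          using p0 s0 by (intro mult_left_mono) auto
        then have "M \<le> p * s * (1 - p * s) * real (card X)"
          by (simp add: M_def d_eq mult_ac)
        also have "\<dots> \<le> (1 - (1 - p) ^ card W) * real (card X)"
          unfolding s_def using p0 p1 by (intro mult_right_mono one_minus_power_le_quadratic) auto
        finally show "M \<le> measure_pmf.prob (rset W p) {x. x \<noteq> {}} * real (card X)"
          using fin by (simp add: prob_nbhd_nonempty)
        show "0 \<le> M" using d2 s0 eta1 by (simp add: M_def)
      qed (use eta0 in auto)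
      have ds: "d * \<rho> / 2 \<le> d * s" using mult_left_mono[OF s_rho, of d] d2 by simp
      have conc': "256 * (\<rho> * ln (real n)) \<le> \<eta>\<^sup>2 * (d * \<rho>)"
        using mult_right_mono[OF conc, of \<rho>] \<rho> by (simp add: mult_ac)
      have ln0: "0 \<le> \<rho> * ln (real n)" using \<rho> n2 by simp
      have exp1: "exp (- \<eta>\<^sup>2 * (d * s) / 4) \<le> exp (- 4 * \<rho> * ln (real n))"
      proof -
        have "\<eta>\<^sup>2 * (d * \<rho> / 2) \<le> \<eta>\<^sup>2 * (d * s)" using ds by (intro mult_left_mono) auto
        then show ?thesis using conc' ln0 by simp
      qed
      \<comment> \<open>Origin of the 256 in \<open>conc\<close>: M is at least d \<rho> / 4, so the
        exponent is at least \<eta>^2 d \<rho> / 64, hence at least 4 \<rho> ln n.\<close>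
      have exp2: "exp (- (\<eta> / 2)\<^sup>2 * M / 4) \<le> exp (- 4 * \<rho> * ln (real n))"
      proof -
        have "d * \<rho> / 2 * (1 / 2) \<le> M"
          unfolding M_def using ds eta1 d2 \<rho> s0 by (intro mult_mono) auto
        then have "\<eta>\<^sup>2 * (d * \<rho> / 4) \<le> \<eta>\<^sup>2 * M" by (intro mult_left_mono) auto
        then show ?thesis using conc' ln0 by (simp add: power_divide)
      qed
      have hi_ge: "(1 + \<eta>) * (d * s) \<le> hi"
        using mult_left_mono[OF s_hi, of "(1 + \<eta>) * d"] d2 eta0 by (simp add: hi_def mult_ac)
      have lo_le: "lo \<le> (1 - \<eta> / 2) * M"
      proof -
        have "lo \<le> (1 - \<eta>) * (d * s)"
          using mult_left_mono[OF s_lo, of "(1 - \<eta>) * d"] d2 eta1 by (simp add: lo_def mult_ac)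
        also have "\<dots> \<le> (1 - \<eta> / 2) * (1 - \<eta> / 2) * (d * s)"
          using d2 s0 by (intro mult_right_mono) (auto simp: algebra_simps)
        finally show ?thesis by (simp add: M_def mult_ac)
      qed
      have "?pr {N. \<Phi> E N} \<le> ?pr {N. ?Y N \<le> (1 - \<eta> / 2) * M \<or> (1 + \<eta>) * (d * s) \<le> ?Y N}"
        using hi_ge lo_le by (intro measure_pmf.finite_measure_mono) (auto simp: \<Phi>_def X_def)
      also have "\<dots> \<le> ?pr {N. ?Y N \<le> (1 - \<eta> / 2) * M} + ?pr {N. (1 + \<eta>) * (d * s) \<le> ?Y N}"
        by (rule prob_disj_le)
      also have "\<dots> \<le> 2 * exp (- 4 * \<rho> * ln (real n))"
        using upper lower exp1 exp2 by linarith
      finally show ?thesis by (simp add: X_def W_def)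
    qed
  qed (use p0 p1 in auto)
  finally show ?thesis by (simp add: \<rho>_def)
qed

lemma growth:
  assumes R: "R \<subseteq> {1..n}" "1 \<le> card R" "card R \<le> r" and k: "k \<le> i"
  shows "prG {E. \<not> good E R k} \<le> 2 * real k * exp (- 4 * real (card R) * ln (real n))"
  using k
proof (induction k)
  case (Suc k)
  have "prG {E. \<not> good E R (Suc k)} \<le> prG {E. \<not> good E R k \<or> (good E R k \<and> \<not> good E R (Suc k))}"
    by (intro measure_pmf.finite_measure_mono) auto
  also have "\<dots> \<le> prG {E. \<not> good E R k} + prG {E. good E R k \<and> \<not> good E R (Suc k)}"
    by (rule prob_disj_le)
  also have "\<dots> \<le> 2 * real k * exp (- 4 * real (card R) * ln (real n)) + 2 * exp (- 4 * real (card R) * ln (real n))"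
    using Suc growth_step[OF R, of k] by simp
  finally show ?case by (simp add: algebra_simps)
qed (simp add: good_0)

text \<open>Lower bound for the probability of having a neighbour in a layer of size at least \<open>d ^ i / 2\<close>.\<close>

definition reach_rate :: real where
  "reach_rate = 1 - exp (- p * d ^ i / 2)"

lemma reach_rate_nonneg: "0 \<le> reach_rate"
  using p0 d2 by (simp add: reach_rate_def)

lemma card_outer_ge_half:
  assumes R: "R \<subseteq> {1..n}" "card R \<le> r" and E: "E \<subseteq> vertex_pairs n" and g: "good E R i"
  shows "real n / 2 \<le> real (card (outer n E R i))"
proof -
  have "real (card (reach E R (Suc i))) \<le> 4 * real (card R) * d ^ i" by (rule card_reach_le[OF g]) simp
  also have "\<dots> \<le> 4 * real r * d ^ i" using R d2 by (intro mult_right_mono) auto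
  also have "\<dots> \<le> \<eta> * (real n - 1) / 2" using sparse by simp
  also have "\<dots> \<le> 1 / 2 * (real n - 1) / 2" using eta1 n2 by (intro divide_right_mono mult_right_mono) auto
  finally show ?thesis using card_outer[OF R(1) E, of i] by simp
qed

text \<open>Two more layers suffice. At distance i + 1 from \<open>u\<close> there are at least n
  \<open>reach_rate\<close> / 4 vertices, and a given remaining vertex misses all of them with
  probability at most exp (- p n reach_rate / 4).\<close>

lemma diameter:
  assumes u: "u \<in> {1..n}"
  shows "prG {E. \<exists>v\<in>{1..n}. v \<notin> reach E {u} (i + 3)} \<le>
    2 * real i * exp (- 4 * ln (real n)) + exp (- real n * reach_rate / 32) + real n * exp (- d * reach_rate / 4)"
proof -
  let ?g = "reach_rate"
  have R: "{u} \<subseteq> {1..n}" using u by simp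
  define \<Phi>1 where "\<Phi>1 = (\<lambda>E (N :: nat \<Rightarrow> nat set). good E {u} i \<and> real (card {v \<in> outer n E {u} i. N v \<noteq> {}}) < real n * ?g / 4)"
  define \<Phi>2 where "\<Phi>2 = (\<lambda>E (N :: nat \<Rightarrow> nat set). real n * ?g / 4 \<le> real (card (layer E {u} (Suc i))) \<and>
    (\<exists>v\<in>outer n E {u} (Suc i). N v = {}))"
  have "prG {E. \<exists>v\<in>{1..n}. v \<notin> reach E {u} (i + 3)} \<le>
      prG {E. \<not> good E {u} i \<or> (\<Phi>1 E (outer_nbhds n E {u} i) \<or> \<Phi>2 E (outer_nbhds n E {u} (Suc i)))}"
  proof (rule prob_random_graph_mono)
    fix E assume E: "E \<subseteq> vertex_pairs n" and ex: "\<exists>v\<in>{1..n}. v \<notin> reach E {u} (i + 3)"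
    then obtain v where v: "v \<in> {1..n}" "v \<notin> reach E {u} (Suc (Suc (Suc i)))"
      by (auto simp: numeral_3_eq_3)
    then have out: "v \<in> outer n E {u} (Suc i)"
      using reach_subset_Suc[of E "{u}" "Suc (Suc i)"] by (auto simp: outer_def)
    have "v \<notin> layer E {u} (Suc (Suc i))" using v by (simp add: layer_def)
    then have "outer_nbhds n E {u} (Suc i) v = {}"
      using out layer_Suc_eq[OF R E, of "Suc i"] by simp
    then show "\<not> good E {u} i \<or> (\<Phi>1 E (outer_nbhds n E {u} i) \<or> \<Phi>2 E (outer_nbhds n E {u} (Suc i)))"
      using out unfolding \<Phi>1_def \<Phi>2_def layer_Suc_eq[OF R E, of i] by force
  qed
  also have "\<dots> \<le> prG {E. \<not> good E {u} i} + (prG {E. \<Phi>1 E (outer_nbhds n E {u} i)} +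
      prG {E. \<Phi>2 E (outer_nbhds n E {u} (Suc i))})"
    by (intro order_trans[OF prob_disj_le] add_mono order_refl prob_disj_le)
  also have "prG {E. \<not> good E {u} i} \<le> 2 * real i * exp (- 4 * ln (real n))"
    using growth[OF R, of i] r1 by simp
  also have "prG {E. \<Phi>1 E (outer_nbhds n E {u} i)} \<le> exp (- real n * ?g / 32)"
  proof (rule random_graph_exposure[OF R])
    show "\<Phi>1 E N" if "\<And>S m. S \<subseteq> {u} \<Longrightarrow> m \<le> Suc i \<Longrightarrow> reach F S m = reach E S m" "\<Phi>1 F N" for E F N
      using that(2) that(1)[of "{u}"] good_cong[of i F "{u}" E] by (simp add: \<Phi>1_def outer_def)
    fix E assume E: "E \<subseteq> vertex_pairs n"
    define W X where "W = layer E {u} i" and "X = outer n E {u} i"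
    have fin: "finite W" "finite X"
      using finite_layer[OF R E] finite_outer by (auto simp: W_def X_def)
    show "measure_pmf.prob (Pi_pmf (outer n E {u} i) {} (\<lambda>_. rset (layer E {u} i) p)) {N. \<Phi>1 E N}
        \<le> exp (- real n * ?g / 32)"
    proof (cases "good E {u} i")
      case False
      then show ?thesis by (simp add: \<Phi>1_def)
    next
      case True
      have X: "real n / 2 \<le> real (card X)"
        unfolding X_def using r1 by (intro card_outer_ge_half[OF R _ E True]) simp
      have "d ^ i / 2 \<le> real (card W)"
        using card_layer_bounds(1)[OF True, of i] by (simp add: W_def)
      then have "p * (d ^ i / 2) \<le> p * real (card W)" using p0 by (intro mult_left_mono) auto
      then have "?g \<le> 1 - exp (- p * real (card W))" by (simp add: reach_rate_def)
      also have "\<dots> \<le> 1 - (1 - p) ^ card W" using one_minus_power_le_exp[of p "card W"] p1 by simp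
      finally have pi: "?g \<le> 1 - (1 - p) ^ card W" .
      have "?g * (real n / 2) \<le> (1 - (1 - p) ^ card W) * real (card X)"
        using pi X reach_rate_nonneg by (intro mult_mono) auto
      then have M: "real n * ?g / 2 \<le> measure_pmf.prob (rset W p) {x. x \<noteq> {}} * real (card X)"
        using fin by (simp add: prob_nbhd_nonempty mult.commute)
      have "measure_pmf.prob (Pi_pmf X {} (\<lambda>_. rset W p)) {N. \<Phi>1 E N} \<le>
          measure_pmf.prob (Pi_pmf X {} (\<lambda>_. rset W p))
            {N. real (card {v \<in> X. N v \<noteq> {}}) \<le> (1 - 1 / 2) * (real n * ?g / 2)}"
        by (intro measure_pmf.finite_measure_mono) (auto simp: \<Phi>1_def X_def)
      also have "\<dots> \<le> exp (- (1 / 2)\<^sup>2 * (real n * ?g / 2) / 4)"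
        by (rule Pi_pmf_count_lower_tail[OF fin(2) M]) (use reach_rate_nonneg in auto)
      also have "- (1 / 2)\<^sup>2 * (real n * ?g / 2) / 4 = - real n * ?g / 32"
        by (simp add: power2_eq_square)
      finally show ?thesis by (simp add: X_def W_def)
    qed
  qed (use p0 p1 in auto)
  also have "prG {E. \<Phi>2 E (outer_nbhds n E {u} (Suc i))} \<le> real n * exp (- d * ?g / 4)"
  proof (rule random_graph_exposure[OF R])
    show "\<Phi>2 E N" if "\<And>S m. S \<subseteq> {u} \<Longrightarrow> m \<le> Suc (Suc i) \<Longrightarrow> reach F S m = reach E S m" "\<Phi>2 F N" for E F N
      using that(2) that(1)[of "{u}"] by (simp add: \<Phi>2_def outer_def layer_def)
    fix E assume E: "E \<subseteq> vertex_pairs n"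
    define W X where "W = layer E {u} (Suc i)" and "X = outer n E {u} (Suc i)"
    have fin: "finite W" "finite X"
      using finite_layer[OF R E] finite_outer by (auto simp: W_def X_def)
    show "measure_pmf.prob (Pi_pmf (outer n E {u} (Suc i)) {} (\<lambda>_. rset (layer E {u} (Suc i)) p)) {N. \<Phi>2 E N}
        \<le> real n * exp (- d * ?g / 4)"
    proof (cases "real n * ?g / 4 \<le> real (card W)")
      case False
      then show ?thesis by (simp add: \<Phi>2_def W_def)
    next
      case True
      have one: "measure_pmf.prob (Pi_pmf X {} (\<lambda>_. rset W p)) {N. N v = {}} \<le> exp (- d * ?g / 4)" if v: "v \<in> X" for v
      proof -
        have "measure_pmf.prob (Pi_pmf X {} (\<lambda>_. rset W p)) {N. N v = {}} =
            measure_pmf.prob (map_pmf (\<lambda>N. N v) (Pi_pmf X {} (\<lambda>_. rset W p))) {N. N = {}}"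
          by (simp add: measure_map_pmf vimage_def)
        also have "map_pmf (\<lambda>N. N v) (Pi_pmf X {} (\<lambda>_. rset W p)) = rset W p"
          using v fin by (simp add: Pi_pmf_component)
        also have "measure_pmf.prob (rset W p) {N. N = {}} = measure_pmf.prob (rset W p) {N. N \<inter> W = {}}"
          using set_pmf_rset[of W p] by (intro measure_pmf.finite_measure_eq_AE AE_pmfI) auto
        also have "\<dots> = (1 - p) ^ card W" using fin p0 p1 by (simp add: prob_rset_avoid)
        also have "\<dots> \<le> exp (- p * real (card W))" using p1 by (intro one_minus_power_le_exp) auto
        also have "\<dots> \<le> exp (- d * ?g / 4)"
        proof -
          have "d * ?g / 4 \<le> p * (real n * ?g / 4)"
            using p0 reach_rate_nonneg by (simp add: d_eq algebra_simps)
          also have "\<dots> \<le> p * real (card W)" using True p0 by (intro mult_left_mono) auto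
          finally show ?thesis by simp
        qed
        finally show ?thesis .
      qed
      have "measure_pmf.prob (Pi_pmf X {} (\<lambda>_. rset W p)) {N. \<Phi>2 E N} \<le>
          measure_pmf.prob (Pi_pmf X {} (\<lambda>_. rset W p)) {N. \<exists>v\<in>X. N v = {}}"
        by (intro measure_pmf.finite_measure_mono) (auto simp: \<Phi>2_def X_def)
      also have "\<dots> \<le> (\<Sum>v\<in>X. measure_pmf.prob (Pi_pmf X {} (\<lambda>_. rset W p)) {N. N v = {}})"
        by (rule prob_bex_le[OF fin(2)])
      also have "\<dots> \<le> (\<Sum>v\<in>X. exp (- d * ?g / 4))" by (intro sum_mono one)
      also have "\<dots> \<le> real n * exp (- d * ?g / 4)"
        using card_mono[of "{1..n}" X] by (simp add: X_def outer_def)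
      finally show ?thesis by (simp add: X_def W_def)
    qed
  qed (use p0 p1 in auto)
  finally show ?thesis by simp
qed

end

subsection \<open>Collisions of distance vectors\<close>

text \<open>On the right every point of \<open>W\<close> is counted at least once and every shared
  point at least twice. So if the sizes nearly add up to that of the union, few points are
  shared.\<close>

lemma card_multicover_le:
  fixes D :: "'r \<Rightarrow> 'a set"
  assumes "finite R" "finite W"
    and D: "\<And>r. r \<in> R \<Longrightarrow> D r \<subseteq> W" and cover: "W \<subseteq> (\<Union>r\<in>R. D r)"
  shows "card W + card {w \<in> W. \<exists>r\<in>R. \<exists>r'\<in>R. r \<noteq> r' \<and> w \<in> D r \<and> w \<in> D r'} \<le> (\<Sum>r\<in>R. card (D r))"
proof -
  define C where "C = {w \<in> W. \<exists>r\<in>R. \<exists>r'\<in>R. r \<noteq> r' \<and> w \<in> D r \<and> w \<in> D r'}"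
  have "C \<subseteq> W" by (auto simp: C_def)
  then have "(\<Sum>w\<in>W. if w \<in> C then 1 else 0) = card C"
    using \<open>finite W\<close> by (simp add: sum.If_cases Int_absorb1)
  then have "card W + card C = (\<Sum>w\<in>W. 1 + (if w \<in> C then 1 else 0))"
    unfolding sum.distrib by simp
  also have "\<dots> \<le> (\<Sum>w\<in>W. card {r \<in> R. w \<in> D r})"
  proof (rule sum_mono)
    fix w assume w: "w \<in> W"
    obtain r where r: "r \<in> R" "w \<in> D r" using w cover by blast
    show "1 + (if w \<in> C then 1 else 0) \<le> card {r \<in> R. w \<in> D r}"
    proof (cases "w \<in> C")
      case True
      then obtain r1 r2 where "r1 \<in> R" "r2 \<in> R" "r1 \<noteq> r2" "w \<in> D r1" "w \<in> D r2" by (auto simp: C_def)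
      then have "card {r1, r2} \<le> card {r \<in> R. w \<in> D r}" using assms by (intro card_mono) auto
      then show ?thesis using True \<open>r1 \<noteq> r2\<close> by simp
    next
      case False
      have "card {r} \<le> card {r \<in> R. w \<in> D r}" using r assms by (intro card_mono) auto
      then show ?thesis using False by simp
    qed
  qed
  also have "\<dots> = (\<Sum>r\<in>R. card {w \<in> W. w \<in> D r})"
    using sum.swap_restrict[OF \<open>finite W\<close> \<open>finite R\<close>, of "\<lambda>_ _. 1" "\<lambda>w r. w \<in> D r"]
    by (simp only: card_eq_sum)
  also have "\<dots> = (\<Sum>r\<in>R. card (D r))"
    using D by (intro sum.cong refl arg_cong[of _ _ card]) auto
  finally show ?thesis by (simp add: C_def)
qed

text \<open>Evaluates union bounds over source sets of all sizes whose terms are geometric in the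
  size.\<close>

lemma sum_Pow_power_card:
  fixes x :: real
  assumes "finite A"
  shows "(\<Sum>S\<in>Pow A. x ^ card S) = (1 + x) ^ card A"
  using prod_add[OF assms, of "\<lambda>_. x" "\<lambda>_. 1"] by (simp add: add.commute)

context gnp
begin

definition edge_rate :: real where
  "edge_rate = - ln (1 - p) * d ^ i"

text \<open>Up to error terms, the traces of two vertices on \<open>R\<close> agree with probability at least
  \<open>exp (- card R * code_rate c)\<close>. Of the constant 38, avoiding the overlaps of the layers costs 6
  and the deficits of their private parts cost 32.\<close>

definition code_rate :: "real \<Rightarrow> real" where
  "code_rate c = - ln (agree c) + 4 * \<bar>edge_rate - c\<bar> + 38 * edge_rate * real i * \<eta>"

lemma edge_rate_nonneg: "0 \<le> edge_rate"
  using p0 p1 d2 by (auto simp: edge_rate_def mult_le_0_iff)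

lemma agree_le_1:
  assumes "0 \<le> c"
  shows "agree c \<le> 1"
proof -
  have "1 - agree c = 2 * exp (- c) * (1 - exp (- c))"
    by (simp add: agree_def power2_eq_square algebra_simps)
  moreover have "0 \<le> 2 * exp (- c) * (1 - exp (- c))" using assms by simp
  ultimately show ?thesis by linarith
qed

lemma code_rate_nonneg:
  assumes "0 \<le> c"
  shows "0 \<le> code_rate c"
proof -
  have "ln (agree c) \<le> 0" using agree_le_1[OF assms] agree_ge_half[of c] by simp
  moreover have "0 \<le> 38 * edge_rate * real i * \<eta>" using edge_rate_nonneg eta0 by simp
  ultimately show ?thesis unfolding code_rate_def by (intro add_nonneg_nonneg) auto
qed

text \<open>A single private part \<open>P r\<close> is bounded only from above, by the sphere
  around \<open>r\<close>. From below only the sum of all sizes is known, through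
  \<open>card W\<close> and the multicover bound. This is enough, because the exponents are summed
  over \<open>R\<close>.\<close>

lemma collision_prob_ge:
  assumes R: "R \<subseteq> {1..n}" and E: "E \<subseteq> vertex_pairs n" and g: "good E R i"
    and single: "\<And>r. r \<in> R \<Longrightarrow> real (card (layer E {r} i)) \<le> d ^ i * (1 + \<eta>) ^ i" and c: "0 \<le> c"
  defines "\<mu> \<equiv> map_pmf (\<lambda>N. {r \<in> R. N \<inter> reach E {r} (Suc i) \<noteq> {}}) (rset (layer E R i) p)"
  shows "exp (- real (card R) * code_rate c) \<le> measure_pmf.expectation \<mu> (pmf \<mu>)"
proof -
  define W where "W = layer E R i"
  define D where "D = (\<lambda>r. W \<inter> reach E {r} (Suc i))"
  define C where "C = {w \<in> W. \<exists>r\<in>R. \<exists>r'\<in>R. r \<noteq> r' \<and> w \<in> D r \<and> w \<in> D r'}"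
  define P where "P = (\<lambda>r. D r - C)"
  define \<rho> \<theta> L where "\<rho> = real (card R)" and "\<theta> = - ln (1 - p)" and "L = d ^ i"
  have finR: "finite R" using R finite_subset by blast
  have finW: "finite W" using finite_layer[OF R E] by (simp add: W_def)
  have fin: "finite C" "finite (P r)" "finite (D r)" for r using finW by (auto simp: C_def P_def D_def)
  have \<theta>: "0 \<le> \<theta>" using p0 p1 by (simp add: \<theta>_def)
  have L: "0 \<le> L" using d2 by (simp add: L_def)
  have cover: "W \<subseteq> (\<Union>r\<in>R. D r)"
    using reach_UN[where E = E and R = R and k = "Suc i"] by (auto simp: W_def D_def layer_def)
  have D_layer: "D r \<subseteq> layer E {r} i" if "r \<in> R" for r
    using reach_mono_sources[of "{r}" R E i] that by (auto simp: D_def W_def layer_def)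
  have D_card: "real (card (D r)) \<le> L * (1 + 2 * real i * \<eta>)" if r: "r \<in> R" for r
  proof -
    have "card (D r) \<le> card (layer E {r} i)"
      using D_layer[OF r] finite_layer[of "{r}" E i] r R E by (intro card_mono) auto
    then have "real (card (D r)) \<le> L * (1 + \<eta>) ^ i" using single[OF r] by (simp add: L_def)
    also have "\<dots> \<le> L * (1 + 2 * real i * \<eta>)" using L by (intro mult_left_mono power_up) auto
    finally show ?thesis .
  qed
  have W_card: "\<rho> * L * (1 - real i * \<eta>) \<le> real (card W)"
  proof -
    have "\<rho> * L * (1 - real i * \<eta>) \<le> \<rho> * L * (1 - \<eta>) ^ i"
      using L by (intro mult_left_mono power_down) (auto simp: \<rho>_def)
    also have "\<dots> \<le> real (card W)" using g by (auto simp: good_def \<rho>_def L_def W_def)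
    finally show ?thesis .
  qed
  have "card W + card C \<le> (\<Sum>r\<in>R. card (D r))"
    unfolding C_def by (rule card_multicover_le) (use finR finW cover in \<open>auto simp: D_def\<close>)
  then have "real (card W) + real (card C) \<le> (\<Sum>r\<in>R. real (card (D r)))"
    by (metis of_nat_add of_nat_mono of_nat_sum)
  also have "\<dots> \<le> (\<Sum>r\<in>R. L * (1 + 2 * real i * \<eta>))" by (intro sum_mono D_card)
  also have "\<dots> = \<rho> * L * (1 + 2 * real i * \<eta>)" by (simp add: \<rho>_def)
  finally have "real (card C) \<le> \<rho> * L * (1 + 2 * real i * \<eta>) - \<rho> * L * (1 - real i * \<eta>)"
    using W_card by linarith
  also have "\<dots> = 3 * (\<rho> * L * real i * \<eta>)" by (simp add: algebra_simps)
  finally have C_card: "real (card C) \<le> 3 * (\<rho> * L * real i * \<eta>)" .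
  have disj: "disjoint_family_on P R"
    unfolding disjoint_family_on_def P_def C_def D_def by blast
  have UP: "W - C = (\<Union>r\<in>R. P r)" using cover by (auto simp: P_def D_def)
  have "card (\<Union>r\<in>R. P r) = (\<Sum>r\<in>R. card (P r))"
    using finR fin disj by (intro card_UN_disjoint) (auto simp: disjoint_family_on_def)
  then have "card (W - C) = (\<Sum>r\<in>R. card (P r))" by (simp only: UP)
  moreover have "card C \<le> card W" "card (W - C) = card W - card C"
    using finW by (auto simp: C_def intro!: card_mono card_Diff_subset)
  ultimately have P_sum: "(\<Sum>r\<in>R. real (card (P r))) = real (card W) - real (card C)"
    by (metis of_nat_diff of_nat_sum)
  have P_card: "real (card (P r)) \<le> L * (1 + 2 * real i * \<eta>)" if "r \<in> R" for r
  proof -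
    have "card (P r) \<le> card (D r)" using fin by (intro card_mono) (auto simp: P_def)
    then show ?thesis using D_card[OF that] by linarith
  qed
  \<comment> \<open>The deviation is charged to the deficit of \<open>P r\<close> against its upper
    bound. Deficits are nonnegative, so they can be summed over \<open>R\<close> without absolute
    values.\<close>
  have dev: "\<bar>\<theta> * real (card (P r)) - c\<bar> \<le>
      \<theta> * (L * (1 + 2 * real i * \<eta>) - real (card (P r))) + \<theta> * (L * (2 * real i * \<eta>)) + \<bar>edge_rate - c\<bar>" if r: "r \<in> R" for r
  proof -
    have "0 \<le> \<theta> * (L * (1 + 2 * real i * \<eta>) - real (card (P r)))" "0 \<le> \<theta> * (L * (2 * real i * \<eta>))"
      using P_card[OF r] \<theta> L eta0 by auto
    moreover have "edge_rate = \<theta> * L" by (simp add: edge_rate_def \<theta>_def L_def)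
    ultimately show ?thesis by (simp add: algebra_simps)
  qed
  have pw: "(1 - p) ^ m = exp (- (\<theta> * real m))" for m
    using p1 by (simp add: \<theta>_def exp_of_nat_mult mult.commute)
  have one: "exp (- (- ln (agree c) + 4 * \<bar>\<theta> * real (card (P r)) - c\<bar>)) \<le>
      (1 - (1 - p) ^ card (P r))\<^sup>2 + ((1 - p) ^ card (P r))\<^sup>2" for r
  proof -
    have "ln (agree c) - 4 * \<bar>\<theta> * real (card (P r)) - c\<bar> \<le> ln (agree (\<theta> * real (card (P r))))"
      using \<theta> c by (intro ln_agree_ge) auto
    then have "exp (ln (agree c) - 4 * \<bar>\<theta> * real (card (P r)) - c\<bar>) \<le> agree (\<theta> * real (card (P r)))"
      using agree_ge_half[of "\<theta> * real (card (P r))"] by (metis exp_le_cancel_iff exp_ln less_le_trans zero_less_divide_1_iff zero_less_numeral)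
    then show ?thesis by (simp add: agree_def pw add.commute)
  qed
  have "(\<Sum>r\<in>R. - ln (agree c) + 4 * \<bar>\<theta> * real (card (P r)) - c\<bar>) \<le>
      (\<Sum>r\<in>R. - ln (agree c) + 4 * (\<theta> * (L * (1 + 2 * real i * \<eta>) - real (card (P r))) + \<theta> * (L * (2 * real i * \<eta>)) + \<bar>edge_rate - c\<bar>))"
    by (intro sum_mono add_left_mono mult_left_mono dev) auto
  also have "\<dots> = \<rho> * (- ln (agree c) + 4 * \<bar>edge_rate - c\<bar>) +
      4 * \<theta> * (\<rho> * L * (1 + 4 * real i * \<eta>) - (\<Sum>r\<in>R. real (card (P r))))"
    by (simp add: sum.distrib sum_subtractf sum_distrib_left[symmetric] sum_distrib_right[symmetric] \<rho>_def algebra_simps)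
  also have "\<dots> \<le> \<rho> * (- ln (agree c) + 4 * \<bar>edge_rate - c\<bar>) +
      4 * \<theta> * (8 * (\<rho> * L * real i * \<eta>))"
  proof (intro add_left_mono mult_left_mono)
    \<comment> \<open>The 5 is 4 from the upper bounds plus 1 from the lower bound on
      \<open>card W\<close>. Removing \<open>C\<close> adds 3, which gives the 8 above.\<close>
    have "\<rho> * L * (1 + 4 * real i * \<eta>) - \<rho> * L * (1 - real i * \<eta>) = 5 * (\<rho> * L * real i * \<eta>)"
      by (simp add: algebra_simps)
    then show "\<rho> * L * (1 + 4 * real i * \<eta>) - (\<Sum>r\<in>R. real (card (P r))) \<le> 8 * (\<rho> * L * real i * \<eta>)"
      using P_sum W_card C_card by linarith
  qed (use \<theta> in auto)
  finally have sum_le: "(\<Sum>r\<in>R. - ln (agree c) + 4 * \<bar>\<theta> * real (card (P r)) - c\<bar>) \<le>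
      \<rho> * (- ln (agree c) + 4 * \<bar>edge_rate - c\<bar>) + 32 * (\<theta> * (\<rho> * L * real i * \<eta>))" by simp
  have "exp (- \<rho> * code_rate c) \<le> exp (- (\<theta> * real (2 * card C))) *
      exp (- (\<Sum>r\<in>R. - ln (agree c) + 4 * \<bar>\<theta> * real (card (P r)) - c\<bar>))"
  proof -
    have "\<theta> * real (card C) \<le> \<theta> * (3 * (\<rho> * L * real i * \<eta>))" using C_card \<theta> by (intro mult_left_mono) auto
    moreover have "\<rho> * code_rate c = \<rho> * (- ln (agree c) + 4 * \<bar>edge_rate - c\<bar>) + 38 * (\<theta> * (\<rho> * L * real i * \<eta>))"
      by (simp add: code_rate_def edge_rate_def \<theta>_def L_def algebra_simps)
    ultimately have "\<theta> * real (2 * card C) + (\<Sum>r\<in>R. - ln (agree c) + 4 * \<bar>\<theta> * real (card (P r)) - c\<bar>) \<le> \<rho> * code_rate c"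
      using sum_le by simp
    then show ?thesis unfolding exp_add[symmetric] by simp
  qed
  also have "\<dots> = (1 - p) ^ (2 * card C) * (\<Prod>r\<in>R. exp (- (- ln (agree c) + 4 * \<bar>\<theta> * real (card (P r)) - c\<bar>)))"
    unfolding pw exp_sum[OF finR, symmetric] sum_negf ..
  also have "\<dots> \<le> (1 - p) ^ (2 * card C) * (\<Prod>r\<in>R. (1 - (1 - p) ^ card (P r))\<^sup>2 + ((1 - p) ^ card (P r))\<^sup>2)"
    using p1 by (intro mult_left_mono prod_mono conjI one) auto
  also have "\<dots> \<le> measure_pmf.expectation \<mu> (pmf \<mu>)"
    unfolding \<mu>_def W_def[symmetric]
    by (rule trace_collision_ge[OF finW finR _ _ _ disj]) (use p0 p1 in \<open>auto simp: C_def P_def D_def\<close>)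
  finally show ?thesis by (simp add: \<rho>_def)
qed

text \<open>At least half of the vertices are outer, so both halves of the birthday sample can have
  n div 4 elements. Using \<open>r\<close> in place of \<open>card R\<close> makes the bound the
  same for all \<open>R\<close>.\<close>

lemma collision:
  assumes R: "R \<subseteq> {1..n}" "1 \<le> card R" "card R \<le> r" and c: "0 \<le> c"
    and big: "1 \<le> real (n div 4) * exp (- real r * code_rate c / 2)"
  shows "prG {E. good E R i \<and> (\<forall>u\<in>R. good E {u} i) \<and>
      inj_on (\<lambda>v. {u \<in> R. outer_nbhds n E R i v \<inter> reach E {u} (Suc i) \<noteq> {}}) (outer n E R i)}
    \<le> exp (- real (n div 4) * exp (- real r * code_rate c / 2) / 2)"
proof -
  define Q where "Q = exp (- real r * code_rate c)"
  have sqrtQ: "sqrt Q = exp (- real r * code_rate c / 2)"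
  proof (rule real_sqrt_unique)
    show "(exp (- real r * code_rate c / 2))\<^sup>2 = Q" by (simp add: Q_def flip: exp_double)
  qed simp
  have Q0: "0 \<le> Q" by (simp add: Q_def)
  define \<Phi> where "\<Phi> = (\<lambda>E (N :: nat \<Rightarrow> nat set). good E R i \<and> (\<forall>u\<in>R. good E {u} i) \<and>
      inj_on (\<lambda>v. {u \<in> R. N v \<inter> reach E {u} (Suc i) \<noteq> {}}) (outer n E R i))"
  have "prG {E. \<Phi> E (outer_nbhds n E R i)} \<le> exp (- real (n div 4) * sqrt Q / 2)"
  proof (rule random_graph_exposure[OF R(1)])
    show "\<Phi> E N" if same: "\<And>S m. S \<subseteq> R \<Longrightarrow> m \<le> Suc i \<Longrightarrow> reach F S m = reach E S m" and "\<Phi> F N" for E F N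
    proof -
      have "good F R i \<longleftrightarrow> good E R i" by (intro good_cong same) auto
      moreover have "good F {u} i \<longleftrightarrow> good E {u} i" if "u \<in> R" for u
        using that by (intro good_cong same) auto
      moreover have "{u \<in> R. N v \<inter> reach F {u} (Suc i) \<noteq> {}} = {u \<in> R. N v \<inter> reach E {u} (Suc i) \<noteq> {}}" for v
        using same[of "{_}" "Suc i"] by (intro Collect_cong conj_cong) auto
      moreover have "outer n F R i = outer n E R i" using same[of R "Suc i"] by (simp add: outer_def)
      ultimately show ?thesis using \<open>\<Phi> F N\<close> by (simp add: \<Phi>_def)
    qed
    fix E assume E: "E \<subseteq> vertex_pairs n"
    define W X where "W = layer E R i" and "X = outer n E R i"
    define T where "T = (\<lambda>N. {u \<in> R. N \<inter> reach E {u} (Suc i) \<noteq> {}})"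
    show "measure_pmf.prob (Pi_pmf (outer n E R i) {} (\<lambda>_. rset (layer E R i) p)) {N. \<Phi> E N}
        \<le> exp (- real (n div 4) * sqrt Q / 2)"
    proof (cases "good E R i \<and> (\<forall>u\<in>R. good E {u} i)")
      case False
      then have "{N. \<Phi> E N} = {}" by (auto simp: \<Phi>_def)
      then show ?thesis by simp
    next
      case True
      have finX: "finite X" by (simp add: X_def finite_outer)
      have "real n / 2 \<le> real (card X)"
        unfolding X_def using True by (intro card_outer_ge_half[OF R(1,3) E]) simp
      then have s: "2 * (n div 4) \<le> card X" by linarith
      have single: "real (card (layer E {u} i)) \<le> d ^ i * (1 + \<eta>) ^ i" if "u \<in> R" for u
        using True that by (auto simp: good_def)
      define \<mu> where "\<mu> = map_pmf T (rset W p)"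
      have "Q \<le> exp (- real (card R) * code_rate c)"
        using R code_rate_nonneg[OF c] by (simp add: Q_def mult_right_mono)
      also have "\<dots> \<le> measure_pmf.expectation \<mu> (pmf \<mu>)"
        unfolding \<mu>_def T_def W_def using True by (intro collision_prob_ge[OF R(1) E _ single c]) auto
      finally have Q: "Q \<le> measure_pmf.expectation \<mu> (pmf \<mu>)" .
      have "measure_pmf.prob (Pi_pmf X {} (\<lambda>_. rset W p)) {N. \<Phi> E N} \<le>
          measure_pmf.prob (Pi_pmf X {} (\<lambda>_. rset W p)) {N. inj_on (\<lambda>v. T (N v)) X}"
        by (intro measure_pmf.finite_measure_mono) (auto simp: \<Phi>_def X_def T_def)
      also have "\<dots> = measure_pmf.prob (map_pmf (\<lambda>N. T \<circ> N) (Pi_pmf X {} (\<lambda>_. rset W p))) {N. inj_on N X}"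
        by (simp add: measure_map_pmf vimage_def o_def)
      \<comment> \<open>\<open>T\<close> maps the default \<open>{}\<close> to \<open>{}\<close>, so
        independence carries over to the traces.\<close>
      also have "map_pmf (\<lambda>N. T \<circ> N) (Pi_pmf X {} (\<lambda>_. rset W p)) = Pi_pmf X {} (\<lambda>_. \<mu>)"
        unfolding \<mu>_def by (rule Pi_pmf_map[OF finX, symmetric]) (simp add: T_def)
      also have "measure_pmf.prob (Pi_pmf X {} (\<lambda>_. \<mu>)) {N. inj_on N X} \<le> exp (- real (n div 4) * sqrt Q / 2)"
        using big by (intro prob_Pi_pmf_inj_on_le[OF finX s Q0 Q]) (simp only: sqrtQ)
      finally show ?thesis by (simp add: X_def W_def)
    qed
  qed (use p0 p1 in auto)
  then show ?thesis by (simp only: \<Phi>_def sqrtQ)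
qed

text \<open>Three union bounds: irregular layers over all nonempty source sets, the diameter over
  all start vertices, and missing collisions over all candidates of size at most
  \<open>r\<close>.\<close>

definition fail_bound :: "real \<Rightarrow> real" where
  "fail_bound c =
     2 * real i * ((1 + exp (- 4 * ln (real n))) ^ n - 1) +
     real n * (2 * real i * exp (- 4 * ln (real n)) + exp (- real n * reach_rate / 32) +
       real n * exp (- d * reach_rate / 4)) +
     3 * real n ^ r * exp (- real (n div 4) * exp (- real r * code_rate c / 2) / 2)"

lemma prob_metric_dimension_le:
  assumes c: "0 \<le> c" and big: "1 \<le> real (n div 4) * exp (- real r * code_rate c / 2)"
  shows "prG {E. metric_dimension {1..n} E \<le> r} \<le> fail_bound c"
proof -
  define Rs where "Rs = {R. R \<subseteq> {1..n} \<and> 1 \<le> card R \<and> card R \<le> r}"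
  have finS: "finite Rs" by (rule finite_subset[of _ "Pow {1..n}"]) (auto simp: Rs_def)
  have nonempty: "Rs \<subseteq> Pow {1..n} - {{}}" by (auto simp: Rs_def)
  define inj where "inj = (\<lambda>R E. good E R i \<and> (\<forall>u\<in>R. good E {u} i) \<and>
      inj_on (\<lambda>v. {u \<in> R. outer_nbhds n E R i v \<inter> reach E {u} (Suc i) \<noteq> {}}) (outer n E R i))"
  have ln0: "0 < ln (real n)" using n2 by simp
  have "prG {E. metric_dimension {1..n} E \<le> r} \<le>
      prG {E. (\<exists>R\<in>Rs. \<not> good E R i) \<or> ((\<exists>u\<in>{1..n}. \<exists>v\<in>{1..n}. v \<notin> reach E {u} (i + 3)) \<or> (\<exists>R\<in>Rs. inj R E))}"
  proof (rule prob_random_graph_mono, rule ccontr)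
    fix E assume E: "E \<subseteq> vertex_pairs n" and le: "metric_dimension {1..n} E \<le> r"
      and neg: "\<not> ((\<exists>R\<in>Rs. \<not> good E R i) \<or> ((\<exists>u\<in>{1..n}. \<exists>v\<in>{1..n}. v \<notin> reach E {u} (i + 3)) \<or> (\<exists>R\<in>Rs. inj R E)))"
    obtain R where res: "resolving {1..n} E R" and card: "card R = metric_dimension {1..n} E"
      using metric_dimension_attained[of "{1..n}" E] by auto
    have R: "R \<subseteq> {1..n}" using res by (simp add: resolving_def)
    have "R \<noteq> {}"
    proof
      assume "R = {}"
      then have "dist_vector E R 1 = dist_vector E R 2" by (simp add: dist_vector_def restrict_def)
      then show False using res n2 by (auto simp: resolving_def)
    qed
    then have RS: "R \<in> Rs" using R card le finite_subset[OF R] by (auto simp: Rs_def Suc_le_eq card_gt_0_iff)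
    \<comment> \<open>Hence irregular growth for some member of \<open>Rs\<close> also covers the
      spheres around single vertices.\<close>
    have sing: "{u} \<in> Rs" if "u \<in> R" for u using that R r1 by (auto simp: Rs_def)
    have "inj_on (\<lambda>v. {u \<in> R. outer_nbhds n E R i v \<inter> reach E {u} (Suc i) \<noteq> {}}) (outer n E R i)"
      using neg by (intro resolving_imp_inj_on_trace[OF res E]) auto
    then have "inj R E" using neg RS sing unfolding inj_def by blast
    then show False using neg RS by blast
  qed
  also have "\<dots> \<le> prG {E. \<exists>R\<in>Rs. \<not> good E R i} +
      (prG {E. \<exists>u\<in>{1..n}. \<exists>v\<in>{1..n}. v \<notin> reach E {u} (i + 3)} + prG {E. \<exists>R\<in>Rs. inj R E})"
    by (intro order_trans[OF prob_disj_le] add_mono order_refl prob_disj_le)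
  also have "prG {E. \<exists>R\<in>Rs. \<not> good E R i} \<le> 2 * real i * ((1 + exp (- 4 * ln (real n))) ^ n - 1)"
  proof -
    have "prG {E. \<exists>R\<in>Rs. \<not> good E R i} \<le> (\<Sum>R\<in>Rs. prG {E. \<not> good E R i})"
      by (rule prob_bex_le[OF finS])
    also have "\<dots> \<le> (\<Sum>R\<in>Rs. 2 * real i * exp (- 4 * ln (real n)) ^ card R)"
    proof (rule sum_mono)
      fix R assume "R \<in> Rs"
      then have "prG {E. \<not> good E R i} \<le> 2 * real i * exp (- 4 * real (card R) * ln (real n))"
        by (intro growth) (auto simp: Rs_def)
      also have "exp (- 4 * real (card R) * ln (real n)) = exp (- 4 * ln (real n)) ^ card R"
        by (simp add: exp_of_nat_mult[symmetric] mult_ac)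
      finally show "prG {E. \<not> good E R i} \<le> 2 * real i * exp (- 4 * ln (real n)) ^ card R" .
    qed
    also have "\<dots> \<le> (\<Sum>R\<in>Pow {1..n} - {{}}. 2 * real i * exp (- 4 * ln (real n)) ^ card R)"
      using nonempty by (intro sum_mono2) auto
    also have "\<dots> = 2 * real i * ((\<Sum>R\<in>Pow {1..n}. exp (- 4 * ln (real n)) ^ card R) - 1)"
      by (simp add: sum_distrib_left[symmetric] sum_diff1)
    finally show ?thesis by (simp only: sum_Pow_power_card[OF finite_atLeastAtMost] card_atLeastAtMost) simp
  qed
  also have "prG {E. \<exists>u\<in>{1..n}. \<exists>v\<in>{1..n}. v \<notin> reach E {u} (i + 3)} \<le>
      real n * (2 * real i * exp (- 4 * ln (real n)) + exp (- real n * reach_rate / 32) +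
       real n * exp (- d * reach_rate / 4))"
  proof -
    have "prG {E. \<exists>u\<in>{1..n}. \<exists>v\<in>{1..n}. v \<notin> reach E {u} (i + 3)} \<le>
        (\<Sum>u\<in>{1..n}. prG {E. \<exists>v\<in>{1..n}. v \<notin> reach E {u} (i + 3)})"
      by (rule prob_bex_le) simp
    also have "\<dots> \<le> (\<Sum>u\<in>{1..n}. 2 * real i * exp (- 4 * ln (real n)) + exp (- real n * reach_rate / 32) +
       real n * exp (- d * reach_rate / 4))"
      by (intro sum_mono diameter)
    finally show ?thesis by simp
  qed
  also have "prG {E. \<exists>R\<in>Rs. inj R E} \<le>
      3 * real n ^ r * exp (- real (n div 4) * exp (- real r * code_rate c / 2) / 2)"
  proof -
    define b where "b = exp (- real (n div 4) * exp (- real r * code_rate c / 2) / 2)"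
    have "prG {E. \<exists>R\<in>Rs. inj R E} \<le> (\<Sum>R\<in>Rs. prG {E. inj R E})"
      by (rule prob_bex_le[OF finS])
    \<comment> \<open>The inserted weight is at least 1, and summed over all subsets it gives n^r (1
      + 1 / n)^n, at most 3 n^r.\<close>
    also have "\<dots> \<le> (\<Sum>R\<in>Rs. real n ^ r * (1 / real n) ^ card R * b)"
    proof (rule sum_mono)
      fix R assume R: "R \<in> Rs"
      then have "prG {E. inj R E} \<le> 1 * b"
        using collision[OF _ _ _ c big, of R] by (simp add: Rs_def inj_def b_def)
      also have "\<dots> \<le> real n ^ r * (1 / real n) ^ card R * b"
      proof (rule mult_right_mono)
        have "real n ^ card R \<le> real n ^ r" using R n2 by (intro power_increasing) (auto simp: Rs_def)
        then show "1 \<le> real n ^ r * (1 / real n) ^ card R" using n2 by (simp add: power_one_over field_simps)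
      qed (simp add: b_def)
      finally show "prG {E. inj R E} \<le> real n ^ r * (1 / real n) ^ card R * b" .
    qed
    also have "\<dots> \<le> (\<Sum>R\<in>Pow {1..n}. real n ^ r * (1 / real n) ^ card R * b)"
      using nonempty by (intro sum_mono2) (auto simp: b_def)
    also have "\<dots> = real n ^ r * b * (\<Sum>R\<in>Pow {1..n}. (1 / real n) ^ card R)"
      by (simp add: sum_distrib_left mult_ac)
    also have "(\<Sum>R\<in>Pow {1..n}. (1 / real n) ^ card R) = (1 + 1 / real n) ^ n"
      by (simp only: sum_Pow_power_card[OF finite_atLeastAtMost] card_atLeastAtMost) simp
    also have "real n ^ r * b * (1 + 1 / real n) ^ n \<le> real n ^ r * b * 3"
    proof (rule mult_left_mono)
      have "(1 + 1 / real n) ^ n \<le> exp (1 / real n) ^ n" by (intro power_mono) auto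
      also have "\<dots> = exp 1" using n2 by (simp add: exp_of_nat_mult[symmetric])
      also have "\<dots> \<le> 3" by (rule exp_le)
      finally show "(1 + 1 / real n) ^ n \<le> 3" .
    qed (simp add: b_def)
    finally show ?thesis by (simp add: b_def mult_ac)
  qed
  finally show ?thesis by (simp add: fail_bound_def)
qed

end

subsection \<open>Asymptotics\<close>

text \<open>The instance \<eta> = 1 / L^2 of \<open>gnp\<close>. In \<open>dM\<close>, 256 serves
  \<open>conc\<close>, 32 C serves \<open>sparse\<close>, and 96 / g with 96 = 3 * 32 brings both
  exponentials of \<open>diameter\<close> down to n^(-3). The condition \<open>\<kappa>\<close> puts
  the sample above the birthday threshold.\<close>

lemma prob_metric_dimension_le_explicit:
  fixes n r i :: nat and p d c c' C \<kappa> \<gamma> g L :: real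
  assumes n: "8 \<le> n" and L: "L = ln (real n)" "2 \<le> L" and p1: "p < 1" and d: "d = p * (real n - 1)"
    and r: "1 \<le> r" "real r * c \<le> 2 * C * L\<^sup>2" "real r \<le> L\<^sup>2"
    and c: "d ^ (i + 1) = c * real n" "0 < \<gamma>" "\<gamma> \<le> c" and i: "real i \<le> L"
    and g: "g = 1 - exp (- \<gamma> / 2)" and C: "0 < C" and dM: "(256 + 32 * C + 96 / g) * L ^ 5 \<le> d"
    and c': "0 \<le> c'"
    and rate: "real r * (- ln (agree c') + 4 * \<bar>- ln (1 - p) * d ^ i - c'\<bar> + 38 * (- ln (1 - p) * d ^ i) * real i / L\<^sup>2)
      \<le> (2 - \<kappa>) * L"
    and \<kappa>: "8 \<le> exp (\<kappa> * L / 2)"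
  shows "measure_pmf.prob (random_graph n p) {E. metric_dimension {1..n} E \<le> r} \<le>
    8 * L / real n ^ 3 + 1 / real n ^ 2 + 1 / real n + 3 * exp (L ^ 3 - exp (\<kappa> * L / 2) / 16)"
proof -
  have g0: "0 < g" using g c by simp
  have L5: "L \<le> L ^ 5" "L ^ 4 \<le> L ^ 5" using L by (auto intro: self_le_power power_increasing)
  have C_parts: "0 \<le> 256 * L ^ 5" "0 \<le> 32 * C * L ^ 5" "0 \<le> 96 / g * L ^ 5"
    using L C g0 by auto
  then have dM': "256 * L ^ 5 \<le> d" "32 * C * L ^ 5 \<le> d" "96 / g * L ^ 5 \<le> d"
    using dM unfolding distrib_right by linarith+
  have d2: "2 \<le> d" using dM'(1) L5 L by linarith
  then have "0 < p * (real n - 1)" using d by simp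
  then have p0: "0 < p" by (rule zero_less_mult_pos2) (use n in simp)
  have n_exp: "exp L = real n" using n L by simp
  have exp4: "exp (- 4 * L) = 1 / real n ^ 4"
    using n_exp exp_of_nat_mult[of 4 L] by (simp add: exp_minus field_simps)
  have exp3: "exp (- 3 * L) = 1 / real n ^ 3"
    using n_exp exp_of_nat_mult[of 3 L] by (simp add: exp_minus field_simps)
  have d_i: "d ^ i * d = c * real n" using c by (simp add: mult.commute)
  have sparse: "8 * real r * d ^ i \<le> 1 / L\<^sup>2 * (real n - 1)"
  proof -
    have "8 * real r * d ^ i * d = 8 * (real r * c) * real n" using d_i by (simp add: algebra_simps)
    also have "\<dots> \<le> 8 * (2 * C * L\<^sup>2) * real n" using r by (intro mult_right_mono mult_left_mono) auto
    also have "\<dots> = 16 * C * L\<^sup>2 * real n" by simp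
    also have "\<dots> \<le> 16 * C * L\<^sup>2 * (2 * (real n - 1))" using n C by (intro mult_left_mono) auto
    also have "\<dots> = 32 * C * L ^ 4 * ((real n - 1) / L\<^sup>2)" using L by (simp add: field_simps power2_eq_square power4_eq_xxxx)
    also have "\<dots> \<le> d * ((real n - 1) / L\<^sup>2)"
    proof (rule mult_right_mono)
      have "32 * C * L ^ 4 \<le> 32 * C * L ^ 5" using L5 C by (intro mult_left_mono) auto
      then show "32 * C * L ^ 4 \<le> d" using dM' by linarith
    qed (use n in auto)
    finally have "8 * real r * d ^ i * d \<le> 1 / L\<^sup>2 * (real n - 1) * d" by (simp add: mult.commute[of d])
    then show ?thesis by (rule mult_right_le_imp_le) (use d2 in simp)
  qed
  have i_eta: "real i * (1 / L\<^sup>2) \<le> 1 / 2"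
  proof -
    have "real i * 2 \<le> L * L" using i L by (intro mult_mono) auto
    then show ?thesis using L by (simp add: power2_eq_square field_simps)
  qed
  interpret gnp n r i p d "1 / L\<^sup>2"
  proof
    show "256 * ln (real n) \<le> (1 / L\<^sup>2)\<^sup>2 * d"
    proof -
      have "256 * L * (L ^ 4) \<le> d" using dM' by (simp add: power_Suc2[symmetric] numeral_eq_Suc mult_ac)
      then show ?thesis using L by (simp add: power_divide field_simps)
    qed
    have "2 * 1 \<le> L * L" using L by (intro mult_mono) auto
    then show "1 / L\<^sup>2 \<le> 1 / 2" using L by (simp add: power2_eq_square field_simps)
  qed (use n p0 p1 d d2 L sparse i_eta r in auto)
  have rr: "g \<le> reach_rate"
  proof -
    have "\<gamma> \<le> p * d ^ i"
    proof -
      have "c * real n = p * d ^ i * (real n - 1)" using d_i by (subst (asm) d) (simp add: algebra_simps)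
      also have "\<dots> \<le> p * d ^ i * real n" using p0 d2 by (intro mult_left_mono) auto
      finally have "c \<le> p * d ^ i" using n by simp
      then show ?thesis using c by simp
    qed
    then show ?thesis by (simp add: g reach_rate_def)
  qed
  have dL: "96 * L \<le> d * g"
  proof -
    have "96 / g * L \<le> 96 / g * L ^ 5" using L5 g0 by (intro mult_left_mono) auto
    then have "96 / g * L \<le> d" using dM' by linarith
    then show ?thesis using g0 by (simp add: field_simps)
  qed
  have d_rr: "96 * L \<le> d * reach_rate"
    by (rule order_trans[OF dL mult_left_mono[OF rr]]) (use d2 in simp)
  have "d \<le> real n" unfolding d using p0 p1 n mult_mono[of p 1 "real n - 1" "real n"] by simp
  then have n_rr: "96 * L \<le> real n * reach_rate"
    using mult_right_mono[OF _ reach_rate_nonneg] d_rr by (meson order_trans)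
  have r_rate: "real r * code_rate c' \<le> (2 - \<kappa>) * L"
    using rate by (simp add: code_rate_def edge_rate_def)
  have s: "real n / 8 \<le> real (n div 4)"
  proof -
    have "real n / 4 < real (n div 4) + 1" by linarith
    then show ?thesis using n by linarith
  qed
  define y where "y = real (n div 4) * exp (- real r * code_rate c' / 2)"
  \<comment> \<open>The square root of the collision probability is at least n^(-1 + \<kappa> / 2),
    so a sample of linear size exceeds the threshold by a factor of order n^(\<kappa> / 2).\<close>
  have y: "exp (\<kappa> * L / 2) / 8 \<le> y"
  proof -
    have "exp (\<kappa> * L / 2) / 8 = real n / 8 * exp (- ((2 - \<kappa>) * L) / 2)"
      unfolding n_exp[symmetric] by (simp add: exp_add[symmetric] field_simps)
    also have "\<dots> \<le> y"
      unfolding y_def using s r_rate by (intro mult_mono) auto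
    finally show ?thesis .
  qed
  have "prG {E. metric_dimension {1..n} E \<le> r} \<le> fail_bound c'"
    by (rule prob_metric_dimension_le[OF c']) (use y \<kappa> in \<open>simp add: y_def\<close>)
  also have "fail_bound c' \<le> 2 * L * (2 / real n ^ 3) + real n * (2 * L * (1 / real n ^ 4) + 1 / real n ^ 3 + real n * (1 / real n ^ 3)) +
      3 * exp (L ^ 3 - exp (\<kappa> * L / 2) / 16)"
  proof -
    define x where "x = exp (- 4 * ln (real n))"
    have x: "x = 1 / real n ^ 4" unfolding x_def L(1)[symmetric] by (rule exp4)
    have nx: "real n * x = 1 / real n ^ 3" using n by (simp add: x field_simps power_numeral_reduce)
    have "real n ^ 3 \<ge> 1" using n by (simp add: one_le_power)
    then have nx1: "0 \<le> real n * x" "real n * x \<le> 1" unfolding nx by (auto simp: divide_le_eq)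
    have "(1 + x) ^ n \<le> exp x ^ n" by (intro power_mono) (auto simp: x_def)
    also have "\<dots> = exp (real n * x)" by (simp add: exp_of_nat_mult)
    also have "\<dots> \<le> 1 + real n * x + (real n * x)\<^sup>2" using nx1 by (intro exp_bound)
    also have "(real n * x)\<^sup>2 \<le> real n * x * 1" unfolding power2_eq_square using nx1 by (intro mult_left_mono) auto
    finally have "(1 + x) ^ n - 1 \<le> 2 / real n ^ 3" using nx by simp
    moreover have "0 \<le> (1 + x) ^ n - 1" by (simp add: one_le_power x_def)
    ultimately have t1: "2 * real i * ((1 + x) ^ n - 1) \<le> 2 * L * (2 / real n ^ 3)"
      using i L by (intro mult_mono) auto
    have t2: "2 * real i * x \<le> 2 * L * (1 / real n ^ 4)"
      using i unfolding x by (intro mult_right_mono) auto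
    have "exp (- real n * reach_rate / 32) \<le> exp (- 3 * L)" using n_rr by simp
    then have t3: "exp (- real n * reach_rate / 32) \<le> 1 / real n ^ 3" by (simp only: exp3)
    have "exp (- d * reach_rate / 4) \<le> exp (- 3 * L)" using d_rr L by simp
    then have "exp (- d * reach_rate / 4) \<le> 1 / real n ^ 3" by (simp only: exp3)
    then have t4: "real n * exp (- d * reach_rate / 4) \<le> real n * (1 / real n ^ 3)" by (intro mult_left_mono) auto
    have "3 * real n ^ r * exp (- real (n div 4) * exp (- real r * code_rate c' / 2) / 2) = 3 * exp (real r * L - y / 2)"
      unfolding n_exp[symmetric] by (simp add: exp_of_nat_mult[symmetric] exp_add[symmetric] y_def)
    also have "\<dots> \<le> 3 * exp (L ^ 3 - exp (\<kappa> * L / 2) / 16)"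
    proof -
      have "real r * L \<le> L\<^sup>2 * L" using r L by (intro mult_right_mono) auto
      then have "real r * L - y / 2 \<le> L ^ 3 - exp (\<kappa> * L / 2) / 16"
        using y by (simp add: power3_eq_cube power2_eq_square)
      then show ?thesis by simp
    qed
    finally have t5: "3 * real n ^ r * exp (- real (n div 4) * exp (- real r * code_rate c' / 2) / 2)
      \<le> 3 * exp (L ^ 3 - exp (\<kappa> * L / 2) / 16)" .
    show ?thesis
      unfolding fail_bound_def x_def[symmetric]
      by (intro add_mono t1 t5 mult_left_mono[OF add_mono[OF add_mono[OF t2 t3] t4]]) simp
  qed
  also have "2 * L * (2 / real n ^ 3) + real n * (2 * L * (1 / real n ^ 4) + 1 / real n ^ 3 + real n * (1 / real n ^ 3)) =
      6 * L / real n ^ 3 + 1 / real n ^ 2 + 1 / real n"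
    using n by (simp add: field_simps power_numeral_reduce)
  also have "6 * L / real n ^ 3 \<le> 8 * L / real n ^ 3" using L by (intro divide_right_mono) auto
  finally show ?thesis by simp
qed

text \<open>Otherwise d^(i + 1) / n would become arbitrarily small along some sequence of indices.
  Raising the exponent by one exactly there would keep d^j = o(n) while exceeding \<open>i\<close>
  infinitely often.\<close>

lemma largest_exponent_power_lower_bound:
  assumes i: "largest_exponent d i" and d: "\<And>n. 1 \<le> n \<Longrightarrow> 0 \<le> d n"
  obtains \<gamma> where "0 < \<gamma>" "\<forall>\<^sub>F n in sequentially. \<gamma> \<le> d n ^ (i n + 1) / real n"
proof -
  define c where "c = (\<lambda>n. d n ^ (i n + 1) / real n)"
  have "\<exists>\<gamma>>0. \<forall>\<^sub>F n in sequentially. \<gamma> \<le> c n"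
  proof (rule ccontr)
    assume "\<not> (\<exists>\<gamma>>0. \<forall>\<^sub>F n in sequentially. \<gamma> \<le> c n)"
    then have small: "\<exists>n\<ge>N. c n < \<gamma>" if "0 < \<gamma>" for \<gamma> N
      using that by (meson eventually_sequentially not_le)
    have "\<exists>f. \<forall>k. (c (f k) < 1 / real (Suc k)) \<and> f k < f (Suc k)"
    proof (rule dependent_nat_choice)
      show "\<exists>x. c x < 1 / real (Suc 0)" using small[of 1 0] by auto
      show "\<exists>y. c y < 1 / real (Suc (Suc k)) \<and> x < y" for x k
        using small[of "1 / real (Suc (Suc k))" "Suc x"] by (auto simp: Suc_le_eq)
    qed
    then obtain f where f: "\<And>k. c (f k) < 1 / real (Suc k)" "\<And>k. f k < f (Suc k)" by blast
    have mono: "strict_mono f" using f(2) by (simp add: strict_mono_Suc_iff)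
    define j where "j = (\<lambda>n. if n \<in> range f then i n + 1 else i n)"
    have "(\<lambda>n. d n ^ j n) \<in> o(\<lambda>n. real n)"
    proof (rule landau_o.smallI)
      fix e :: real assume e: "0 < e"
      obtain K where K: "1 / real (Suc K) < e" using e by (metis nat_approx_posE)
      have "\<forall>\<^sub>F n in sequentially. norm (d n ^ i n) \<le> e * norm (real n)"
        using i e by (intro landau_o.smallD) (auto simp: largest_exponent_def)
      then show "\<forall>\<^sub>F n in sequentially. norm (d n ^ j n) \<le> e * norm (real n)"
        using eventually_ge_at_top[of "max 1 (f K)"]
      proof eventually_elim
        case (elim n)
        show ?case
        proof (cases "n \<in> range f")
          case True
          then obtain k where k: "n = f k" by auto
          then have "f K \<le> f k" using elim by simp
          then have "K \<le> k" using mono by (simp add: strict_mono_less_eq)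
          have "c n < 1 / real (Suc k)" using f(1) k by simp
          also have "\<dots> \<le> 1 / real (Suc K)" using \<open>K \<le> k\<close> by (simp add: frac_le)
          finally have "c n \<le> e" using K by simp
          then have "d n ^ (i n + 1) \<le> e * real n" using elim by (simp add: c_def field_simps)
          then show ?thesis using d[of n] elim True by (simp add: j_def)
        next
          case False
          then show ?thesis using elim by (simp add: j_def)
        qed
      qed
    qed
    then have "\<forall>\<^sub>F n in sequentially. j n \<le> i n" using i by (auto simp: largest_exponent_def)
    then obtain N where N: "\<And>n. n \<ge> N \<Longrightarrow> j n \<le> i n" by (auto simp: eventually_sequentially)
    have "N \<le> f N" using mono by (rule strict_mono_imp_increasing)
    from N[OF this] show False by (simp add: j_def)
  qed
  then show thesis using that by (auto simp: c_def)
qed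

lemma diagonal_limit_one:
  fixes P :: "real \<Rightarrow> nat \<Rightarrow> real"
  assumes lim: "\<And>\<kappa>. 0 < \<kappa> \<Longrightarrow> \<kappa> < 1 \<Longrightarrow> P \<kappa> \<longlonglongrightarrow> 1" and le: "\<And>\<kappa> n. P \<kappa> n \<le> 1"
  shows "\<exists>\<delta> :: nat \<Rightarrow> real. \<delta> \<in> o(\<lambda>_. 1) \<and> (\<lambda>n. P (- \<delta> n) n) \<longlonglongrightarrow> 1"
proof -
  define S where "S = (\<lambda>n. {k. k \<le> n \<and> (k = 0 \<or> 1 - 1 / (real k + 1) \<le> P (1 / (real k + 1)) n)})"
  define K where "K = (\<lambda>n. Max (S n))"
  have fin: "finite (S n)" for n by (rule finite_subset[of _ "{..n}"]) (auto simp: S_def)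
  have "0 \<in> S n" for n by (simp add: S_def)
  then have KS: "K n \<in> S n" for n unfolding K_def using fin by (intro Max_in) auto
  have K_ge: "\<forall>\<^sub>F n in sequentially. k \<le> K n" if k: "1 \<le> k" for k
  proof -
    have "P (1 / (real k + 1)) \<longlonglongrightarrow> 1" using k by (intro lim) auto
    then have "\<forall>\<^sub>F n in sequentially. 1 - 1 / (real k + 1) < P (1 / (real k + 1)) n"
      by (rule order_tendstoD) auto
    then show ?thesis using eventually_ge_at_top[of k]
    proof eventually_elim
      case (elim n)
      then have "k \<in> S n" by (simp add: S_def)
      then show ?case unfolding K_def using fin by (intro Max_ge)
    qed
  qed
  have K: "filterlim K at_top sequentially"
    unfolding filterlim_at_top
  proof
    fix Z
    show "\<forall>\<^sub>F n in sequentially. Z \<le> K n"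
      using K_ge[OF max.cobounded1[of 1 Z]] by eventually_elim simp
  qed
  then have inv: "(\<lambda>n. 1 / (real (K n) + 1)) \<longlonglongrightarrow> 0"
  proof -
    have "(\<lambda>k. 1 / (real k + 1)) \<longlonglongrightarrow> 0" by real_asymp
    then show ?thesis using K by (rule filterlim_compose)
  qed
  define \<delta> where "\<delta> = (\<lambda>n. - (1 / (real (K n) + 1)))"
  have "\<delta> \<longlonglongrightarrow> 0"
    unfolding \<delta>_def using tendsto_minus[OF inv] by (simp only: minus_zero)
  then have "\<delta> \<in> o(\<lambda>_. 1)" by (intro smalloI_tendsto) auto
  moreover have "(\<lambda>n. P (- \<delta> n) n) \<longlonglongrightarrow> 1"
  proof (rule tendsto_sandwich[OF _ _ _ tendsto_const])
    show "(\<lambda>n. 1 - 1 / (real (K n) + 1)) \<longlonglongrightarrow> 1"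
      using tendsto_diff[OF tendsto_const[of 1] inv] by simp
    have "\<forall>\<^sub>F n in sequentially. 1 \<le> K n" using K by (auto simp: filterlim_at_top)
    then show "\<forall>\<^sub>F n in sequentially. 1 - 1 / (real (K n) + 1) \<le> P (- \<delta> n) n"
    proof eventually_elim
      case (elim n)
      then show ?case using KS[of n] by (auto simp: S_def \<delta>_def)
    qed
  qed (use le in auto)
  ultimately show ?thesis by blast
qed

section \<open>The hypotheses common to both cases of \<open>q\<close>\<close>

locale metric_dimension_regime =
  fixes p d c q \<epsilon> :: "nat \<Rightarrow> real" and i :: "nat \<Rightarrow> nat"
  assumes eps: "\<And>n. \<epsilon> n = 3 * ln (ln (real n)) / ln (real n)"
    and p: "\<And>n. 0 \<le> p n \<and> p n \<le> 1"
    and d: "\<And>n. d n = p n * (real n - 1)"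
    and d_lower: "(\<lambda>n. ln (real n) ^ 5) \<in> o(d)"
    and d_upper: "\<forall>\<^sub>F n in sequentially. d n \<le> real n * (1 - \<epsilon> n)"
    and i: "largest_exponent d i"
    and c: "\<And>n. c n = d n ^ (i n + 1) / real n"
    and exp_c: "\<forall>\<^sub>F n in sequentially. exp (c n) \<le> 1 / \<epsilon> n"
begin

lemma d_nonneg: "1 \<le> n \<Longrightarrow> 0 \<le> d n"
  using p[of n] by (simp add: d)

lemma d_ge:
  assumes "0 < M"
  shows "\<forall>\<^sub>F n in sequentially. M * ln (real n) ^ 5 \<le> d n"
proof -
  have "\<forall>\<^sub>F n in sequentially. norm (ln (real n) ^ 5) \<le> 1 / M * norm (d n)"
    using d_lower assms by (intro landau_o.smallD) auto
  then show ?thesis using eventually_ge_at_top[of 1]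
  proof eventually_elim
    case (elim n)
    have "ln (real n) ^ 5 \<le> 1 / M * d n" using elim d_nonneg[of n] by simp
    then show ?case using assms by (simp add: field_simps)
  qed
qed

lemma lnln_ge: "\<forall>\<^sub>F n in sequentially. M \<le> ln (ln (real n))"
  by real_asymp

lemma ln_ge: "\<forall>\<^sub>F n in sequentially. M \<le> ln (real n)"
  by real_asymp

text \<open>Eventually (ln n)^(5 i) \<le> d^i \<le> n. The saved factor ln (ln n) compensates for
  \<open>c\<close> possibly being as large as ln (ln n).\<close>

lemma exponent_le: "\<forall>\<^sub>F n in sequentially. 5 * real (i n) * ln (ln (real n)) \<le> ln (real n)"
proof -
  have "(\<lambda>n. d n ^ i n) \<in> o(\<lambda>n. real n)" using i by (simp add: largest_exponent_def)
  then have "\<forall>\<^sub>F n in sequentially. norm (d n ^ i n) \<le> 1 * norm (real n)" by (rule landau_o.smallD) simp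
  then show ?thesis using d_ge[of 1, simplified] ln_ge[of 2] eventually_ge_at_top[of 1]
  proof eventually_elim
    case (elim n)
    have "ln (real n) ^ (5 * i n) \<le> d n ^ i n"
      unfolding power_mult using elim by (intro power_mono) auto
    also have "\<dots> \<le> real n" using elim d_nonneg[of n] by simp
    finally have "ln (ln (real n) ^ (5 * i n)) \<le> ln (real n)"
    proof (subst ln_le_cancel_iff)
      show "0 < ln (real n) ^ (5 * i n)" using elim by (intro zero_less_power) linarith
    qed (use elim in auto)
    then show ?case using elim by (simp add: ln_realpow)
  qed
qed

lemma c_le: "\<forall>\<^sub>F n in sequentially. c n \<le> ln (ln (real n))"
  using exp_c lnln_ge[of 1] ln_ge[of 2]
proof eventually_elim
  case (elim n)
  have "exp (c n) \<le> ln (real n) / (3 * ln (ln (real n)))" using elim by (simp add: eps)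
  also have "\<dots> \<le> ln (real n) / 1" using elim by (intro divide_left_mono) auto
  finally have "exp (c n) \<le> ln (real n)" by simp
  then show ?case using elim by (simp add: ln_ge_iff)
qed

text \<open>The part of \<open>code_rate\<close> beyond \<open>- ln (agree (c' n))\<close>, at
  \<eta> = 1 / (ln n)^2.\<close>

definition rate_error :: "(nat \<Rightarrow> real) \<Rightarrow> nat \<Rightarrow> real" where
  "rate_error c' n = 4 * \<bar>- ln (1 - p n) * d n ^ i n - c' n\<bar> +
     38 * (- ln (1 - p n) * d n ^ i n) * real (i n) / (ln (real n))\<^sup>2"

text \<open>A parameter \<open>c'\<close> with \<open>q = agree c'\<close>: it is \<open>c\<close> for \<open>p = o(1)\<close> and \<open>- ln (1 - p)\<close> for
  \<open>p = \<Theta>(1)\<close>. The middle condition makes sets of size \<open>2 ln n / ln (1 / q)\<close> as small as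
  \<open>O(ln n ^ 2 / ln (ln n))\<close>; the last one makes the total rate error of such a set \<open>o(ln n)\<close>.\<close>

definition admissible :: "(nat \<Rightarrow> real) \<Rightarrow> real \<Rightarrow> bool" where
  "admissible c' C \<longleftrightarrow> 0 < C \<and>
     (\<forall>\<^sub>F n in sequentially. 0 \<le> c' n \<and> q n = agree (c' n) \<and> p n < 1 \<and>
        ln (ln (real n)) \<le> C * ln (real n) * ln (1 / q n)) \<and>
     (\<forall>\<kappa>>0. \<forall>\<^sub>F n in sequentially.
        (ln (real n))\<^sup>2 / ln (ln (real n)) * rate_error c' n \<le> \<kappa> * ln (real n))"

lemma ln_inverse_ge:
  fixes x :: real
  assumes "0 < x"
  shows "1 - x \<le> ln (1 / x)"
  using ln_le_minus_one[OF assms] assms by (simp add: ln_div)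

text \<open>As p = o(1), eventually i \<ge> 1, so d^2 \<le> c n and p = O(sqrt (ln n / n)). Hence -
  ln (1 - p) d^i differs negligibly from c.\<close>

lemma admissible_sparse:
  assumes po: "p \<in> o(\<lambda>_. 1)" and q: "\<And>n. q n = exp (- c n) ^ 2 + (1 - exp (- c n)) ^ 2"
  shows "\<exists>C. admissible c C"
proof -
  obtain \<gamma> where \<gamma>: "0 < \<gamma>" "\<forall>\<^sub>F n in sequentially. \<gamma> \<le> c n"
    using largest_exponent_power_lower_bound[OF i d_nonneg] unfolding c by blast
  have "(\<lambda>n. d n ^ 1) \<in> o(\<lambda>n. real n)"
  proof (rule landau_o.smallI)
    fix e :: real assume "0 < e"
    then have "\<forall>\<^sub>F n in sequentially. norm (p n) \<le> e * norm (1 :: real)"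
      using po by (intro landau_o.smallD) auto
    then show "\<forall>\<^sub>F n in sequentially. norm (d n ^ 1) \<le> e * norm (real n)"
      using eventually_ge_at_top[of 1]
    proof eventually_elim
      case (elim n)
      have "p n * (real n - 1) \<le> e * real n" using elim p[of n] by (intro mult_mono) auto
      then show ?case using elim d_nonneg[of n] by (simp add: d)
    qed
  qed
  then have i1: "\<forall>\<^sub>F n in sequentially. 1 \<le> i n"
    using i unfolding largest_exponent_def by (elim conjE allE[of _ "\<lambda>_. 1"]) simp
  have p_half: "\<forall>\<^sub>F n in sequentially. p n \<le> 1 / 2"
  proof -
    have "\<forall>\<^sub>F n in sequentially. norm (p n) \<le> 1 / 2 * norm (1 :: real)"
      using po by (intro landau_o.smallD) auto
    then show ?thesis by eventually_elim auto
  qed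
  \<comment> \<open>From 1 - q = 2 exp (- c) (1 - exp (- c)) \<ge> 2 \<epsilon> (1 - exp (-
    \<gamma>)); this \<open>C\<close> makes C ln n times the last expression equal to ln (ln
    n).\<close>
  define C where "C = 1 / (6 * (1 - exp (- \<gamma>)))"
  have C: "0 < C" using \<gamma> by (simp add: C_def)
  have agree: "q n = agree (c n)" for n by (simp add: q agree_def)
  have "\<forall>\<^sub>F n in sequentially. 0 \<le> c n \<and> q n = agree (c n) \<and> p n < 1 \<and>
        ln (ln (real n)) \<le> C * ln (real n) * ln (1 / q n)"
    using \<gamma>(2) p_half exp_c lnln_ge[of 1] ln_ge[of 2]
  proof eventually_elim
    case (elim n)
    have "0 < ln (real n)" "0 < ln (ln (real n))" using elim by linarith+
    then have "0 < \<epsilon> n" by (simp add: eps)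
    then have "\<epsilon> n \<le> exp (- c n)" using elim by (simp add: exp_minus field_simps)
    then have "2 * \<epsilon> n * (1 - exp (- \<gamma>)) \<le> 2 * exp (- c n) * (1 - exp (- c n))"
      using elim \<open>0 < \<epsilon> n\<close> \<gamma> by (intro mult_mono) auto
    also have "\<dots> = 1 - q n" by (simp add: q power2_eq_square algebra_simps)
    also have "\<dots> \<le> ln (1 / q n)"
      unfolding agree using agree_ge_half[of "c n"] by (intro ln_inverse_ge) simp
    finally have "C * ln (real n) * (2 * \<epsilon> n * (1 - exp (- \<gamma>))) \<le> C * ln (real n) * ln (1 / q n)"
      using C elim by (intro mult_left_mono) auto
    moreover have "C * ln (real n) * (2 * \<epsilon> n * (1 - exp (- \<gamma>))) = ln (ln (real n))"
    proof -
      define a where "a = 1 - exp (- \<gamma>)"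
      have "0 < a" using \<gamma> by (simp add: a_def)
      then show ?thesis
        unfolding C_def eps a_def[symmetric] using \<open>0 < ln (real n)\<close> by (simp add: field_simps)
    qed
    ultimately show ?case using elim \<gamma> agree by simp
  qed
  moreover have "\<forall>\<^sub>F n in sequentially.
      (ln (real n))\<^sup>2 / ln (ln (real n)) * rate_error c n \<le> \<kappa> * ln (real n)" if \<kappa>: "0 < \<kappa>" for \<kappa>
  proof -
    have lim: "((\<lambda>n. 4 * ln (real n) * (8 * sqrt (ln (real n) / real n) + 2 / real n) + 31 / ln (ln (real n))) \<longlongrightarrow> 0) sequentially"
      by real_asymp
    have "\<forall>\<^sub>F n in sequentially. 4 * ln (real n) * (8 * sqrt (ln (real n) / real n) + 2 / real n) + 31 / ln (ln (real n)) < \<kappa>"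
      using order_tendstoD(2)[OF lim \<kappa>] .
    then show ?thesis
      using \<gamma>(2) p_half c_le exponent_le i1 d_ge[of 1, simplified] lnln_ge[of 1] ln_ge[of 2] eventually_ge_at_top[of 4]
    proof eventually_elim
      case (elim n)
      define L where "L = ln (real n)"
      define l where "l = ln L"
      have L: "1 \<le> L" and l: "1 \<le> l" using elim by (auto simp: L_def l_def)
      have lL: "l \<le> L" using ln_le_minus_one[of L] L by (simp add: l_def)
      have "1 \<le> L ^ 5" using L by (rule one_le_power)
      then have d1: "1 \<le> d n" using elim unfolding L_def by linarith
      have cn: "d n ^ (i n + 1) = c n * real n" using elim by (simp add: c)
      have cl: "c n \<le> l" "0 \<le> c n" using elim \<gamma> by (auto simp: l_def L_def)
      have p_small: "p n \<le> 2 * sqrt (L / real n)"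
      proof -
        have "(d n)\<^sup>2 \<le> d n ^ (i n + 1)" using d1 elim by (intro power_increasing) auto
        also have "\<dots> \<le> L * real n" unfolding cn using cl lL by (intro mult_right_mono) auto
        finally have "d n \<le> sqrt (L * real n)" by (simp add: real_le_rsqrt)
        moreover have "p n * (real n / 2) \<le> d n" unfolding d using p[of n] elim by (intro mult_left_mono) auto
        ultimately have "p n * (real n / 2) \<le> sqrt (L * real n)" by linarith
        also have "\<dots> = sqrt (L / real n) * real n"
          using elim by (simp add: real_sqrt_mult real_sqrt_divide field_simps)
        finally show ?thesis using elim by (simp add: field_simps)
      qed
      define x where "x = - ln (1 - p n) * d n ^ i n"
      have pd: "p n * d n ^ i n * (real n - 1) = c n * real n"
        using cn by (simp add: d mult_ac)
      have n1: "0 < real n - 1" using elim by simp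
      have x_ge: "c n \<le> x"
      proof -
        have "p n * d n ^ i n \<le> x"
          unfolding x_def using ln_one_minus_pos_upper_bound[of "p n"] p[of n] elim d1
          by (intro mult_right_mono) auto
        moreover have "c n * (real n - 1) \<le> p n * d n ^ i n * (real n - 1)"
          unfolding pd using cl by (intro mult_left_mono) auto
        then have "c n \<le> p n * d n ^ i n" using n1 by simp
        ultimately show ?thesis by simp
      qed
      have x_le: "x \<le> c n * (1 + (4 * p n + 2 / real n))"
      proof -
        have "x \<le> (p n + 2 * (p n)\<^sup>2) * d n ^ i n"
          unfolding x_def using ln_one_minus_pos_lower_bound[of "p n"] p[of n] elim d1
          by (intro mult_right_mono) auto
        also have "\<dots> = (1 + 2 * p n) * (p n * d n ^ i n)" by (simp add: algebra_simps power2_eq_square)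
        also have "p n * d n ^ i n = c n * (real n / (real n - 1))" using pd n1 by (simp add: field_simps)
        also have "(1 + 2 * p n) * (c n * (real n / (real n - 1))) = c n * ((1 + 2 * p n) * (real n / (real n - 1)))"
          by simp
        also have "\<dots> \<le> c n * (1 + (4 * p n + 2 / real n))"
        proof (rule mult_left_mono)
          have a: "1 / (real n - 1) \<le> 2 / real n" using elim by (simp add: field_simps)
          have b: "real n / (real n - 1) = 1 + 1 / (real n - 1)" using n1 by (simp add: field_simps)
          have e: "real n / (real n - 1) \<le> 2" using elim by (simp add: field_simps)
          have "(1 + 2 * p n) * (real n / (real n - 1)) = real n / (real n - 1) + 2 * p n * (real n / (real n - 1))"
            by (simp only: distrib_right mult_1_left)
          also have "\<dots> \<le> (1 + 2 / real n) + 2 * p n * 2"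
            using a b p[of n] by (intro add_mono mult_left_mono e) auto
          finally show "(1 + 2 * p n) * (real n / (real n - 1)) \<le> 1 + (4 * p n + 2 / real n)" by simp
        qed (use cl in auto)
        finally show ?thesis .
      qed
      have x4: "x \<le> 4 * l"
      proof -
        have "2 / real n \<le> 1" "4 * p n \<le> 2" using elim by auto
        then have "c n * (1 + (4 * p n + 2 / real n)) \<le> l * 4" using cl p[of n] by (intro mult_mono) auto
        then show ?thesis using x_le by simp
      qed
      have dev: "\<bar>x - c n\<bar> \<le> l * (8 * sqrt (L / real n) + 2 / real n)"
      proof -
        have "x - c n \<le> c n * (4 * p n + 2 / real n)" using x_le by (simp add: algebra_simps)
        also have "\<dots> \<le> l * (8 * sqrt (L / real n) + 2 / real n)"
        proof (rule mult_mono)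
          show "4 * p n + 2 / real n \<le> 8 * sqrt (L / real n) + 2 / real n" using p_small by simp
        qed (use cl p[of n] l in auto)
        finally show ?thesis using x_ge by simp
      qed
      have il: "real (i n) \<le> L / (5 * l)" using elim l by (simp add: L_def l_def field_simps)
      have "rate_error c n = 4 * \<bar>x - c n\<bar> + 38 * x * real (i n) / L\<^sup>2"
        by (simp add: rate_error_def x_def L_def)
      \<comment> \<open>With x \<le> 4 l and i \<le> L / (5 l) the factors l cancel in the last
        term, leaving 38 * 4 / 5 over L.\<close>
      also have "\<dots> \<le> 4 * (l * (8 * sqrt (L / real n) + 2 / real n)) + 38 * (4 * l) * (L / (5 * l)) / L\<^sup>2"
        using dev x4 il x_ge cl l L by (intro add_mono mult_left_mono divide_right_mono mult_mono) auto
      also have "\<dots> = l / L * (4 * L * (8 * sqrt (L / real n) + 2 / real n)) + 152 / 5 / L"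
        using l L by (simp add: field_simps power2_eq_square)
      finally have "L\<^sup>2 / l * rate_error c n \<le>
          L\<^sup>2 / l * (l / L * (4 * L * (8 * sqrt (L / real n) + 2 / real n)) + 152 / 5 / L)"
        using l by (intro mult_left_mono) auto
      also have "\<dots> = (4 * L * (8 * sqrt (L / real n) + 2 / real n) + 152 / 5 / l) * L"
        using l L by (simp add: field_simps power2_eq_square)
      also have "\<dots> \<le> (4 * L * (8 * sqrt (L / real n) + 2 / real n) + 31 / l) * L"
        using l L by (intro mult_right_mono add_left_mono divide_right_mono) auto
      also have "\<dots> \<le> \<kappa> * L" using elim(1) L by (intro mult_right_mono) (auto simp: L_def l_def)
      finally show ?case by (simp add: L_def l_def)
    qed
  qed
  ultimately show ?thesis using C unfolding admissible_def by blast
qed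

text \<open>Here d has order n, so eventually i = 0 and the sphere around r is r itself. The edge
  rate is then exactly - ln (1 - p), and the rate error vanishes. It remains to bound 1 - q = 2 p (1
  - p) from below, for which \<open>d_upper\<close> keeps p away from 1.\<close>

lemma admissible_dense:
  assumes p\<Theta>: "p \<in> \<Theta>(\<lambda>_. 1)" and q: "\<And>n. q n = p n ^ 2 + (1 - p n) ^ 2"
  shows "\<exists>C. admissible (\<lambda>n. - ln (1 - p n)) C"
proof -
  have "p \<in> \<Omega>(\<lambda>_. 1)" using p\<Theta> by auto
  then obtain p0 where p0: "0 < p0" "\<forall>\<^sub>F n in sequentially. norm (p n) \<ge> p0 * norm (1 :: real)"
    by (rule landau_omega.bigE)
  from p0(2) have p_ge: "\<forall>\<^sub>F n in sequentially. p0 \<le> p n"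
    by eventually_elim (use p in auto)
  have "(\<lambda>n. d n ^ i n) \<in> o(\<lambda>n. real n)" using i by (simp add: largest_exponent_def)
  then have "\<forall>\<^sub>F n in sequentially. norm (d n ^ i n) \<le> p0 / 4 * norm (real n)"
    using p0 by (intro landau_o.smallD) auto
  then have i0: "\<forall>\<^sub>F n in sequentially. i n = 0"
    using p_ge d_ge[of 1, simplified] ln_ge[of 2] eventually_ge_at_top[of 4]
  proof eventually_elim
    case (elim n)
    show ?case
    proof (rule ccontr)
      assume "i n \<noteq> 0"
      have "1 \<le> ln (real n) ^ 5" using elim by (intro one_le_power) linarith
      then have d1: "1 \<le> d n" using elim by linarith
      have "p0 * (real n / 2) \<le> d n" unfolding d using elim p0 by (intro mult_mono) auto
      also have "\<dots> \<le> d n ^ i n" using d1 \<open>i n \<noteq> 0\<close> by (intro self_le_power) auto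
      also have "\<dots> \<le> p0 / 4 * real n" using elim d1 by simp
      finally show False using p0 elim by simp
    qed
  qed
  have gap: "\<forall>\<^sub>F n in sequentially. \<epsilon> n / 2 \<le> 1 - p n"
  proof -
    \<comment> \<open>\<open>d_upper\<close> is stated with n, but d = p (n - 1); the discrepancy is
      absorbed by half of \<epsilon>.\<close>
    have "\<forall>\<^sub>F n in sequentially. 1 / (real n - 1) \<le> 3 * ln (ln (real n)) / ln (real n) / 2"
      by real_asymp
    then show ?thesis using d_upper lnln_ge[of 1] ln_ge[of 2] eventually_ge_at_top[of 2]
    proof eventually_elim
      case (elim n)
      have n1: "0 < real n - 1" using elim by simp
      have e0: "0 \<le> \<epsilon> n" using elim by (simp add: eps)
      have "p n * (real n - 1) \<le> real n * (1 - \<epsilon> n)" using elim by (simp add: d)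
      also have "\<dots> \<le> (1 + 1 / (real n - 1) - \<epsilon> n) * (real n - 1)"
        using n1 e0 mult_right_mono[of 1 "real n" "\<epsilon> n"] by (simp add: field_simps)
      finally have "p n \<le> 1 + 1 / (real n - 1) - \<epsilon> n" using n1 by simp
      moreover have "1 / (real n - 1) \<le> \<epsilon> n / 2" using elim by (simp add: eps)
      ultimately show ?case by linarith
    qed
  qed
  define C where "C = 1 / (3 * p0)"
  have C: "0 < C" using p0 by (simp add: C_def)
  have "\<forall>\<^sub>F n in sequentially. 0 \<le> - ln (1 - p n) \<and> q n = agree (- ln (1 - p n)) \<and> p n < 1 \<and>
        ln (ln (real n)) \<le> C * ln (real n) * ln (1 / q n)"
    using gap p_ge lnln_ge[of 1] ln_ge[of 2]
  proof eventually_elim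
    case (elim n)
    have "0 < ln (real n)" "0 < ln (ln (real n))" using elim by linarith+
    then have e0: "0 < \<epsilon> n" by (simp add: eps)
    then have p1: "p n < 1" using elim by linarith
    have agree: "q n = agree (- ln (1 - p n))" using p1 by (simp add: q agree_def)
    have "2 * p0 * (\<epsilon> n / 2) \<le> 2 * p n * (1 - p n)"
      using elim p0 e0 by (intro mult_mono) auto
    also have "\<dots> = 1 - q n" by (simp add: q power2_eq_square algebra_simps)
    also have "\<dots> \<le> ln (1 / q n)"
      unfolding agree using agree_ge_half[of "- ln (1 - p n)"] by (intro ln_inverse_ge) simp
    finally have "C * ln (real n) * (2 * p0 * (\<epsilon> n / 2)) \<le> C * ln (real n) * ln (1 / q n)"
      using C elim by (intro mult_left_mono) auto
    moreover have "C * ln (real n) * (2 * p0 * (\<epsilon> n / 2)) = ln (ln (real n))"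
      using elim p0 by (simp add: C_def eps)
    ultimately show ?case using agree p1 p[of n] by simp
  qed
  moreover have "\<forall>\<^sub>F n in sequentially.
      (ln (real n))\<^sup>2 / ln (ln (real n)) * rate_error (\<lambda>n. - ln (1 - p n)) n \<le> \<kappa> * ln (real n)" if "0 < \<kappa>" for \<kappa>
    using i0 ln_ge[of 2]
    by eventually_elim (use that in \<open>simp add: rate_error_def\<close>)
  ultimately show ?thesis using C unfolding admissible_def by blast
qed

text \<open>The factor 1 - \<kappa> gives r ln (1 / q) \<le> (2 - 2 \<kappa>) ln n. Half of the
  slack 2 \<kappa> ln n absorbs the rate errors, the other half keeps the collision probability
  above n^(-2 + \<kappa>).\<close>

lemma prob_metric_dimension_tendsto_1:
  assumes adm: "admissible c' C" and \<kappa>: "0 < \<kappa>" "\<kappa> < 1"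
  shows "(\<lambda>n. measure_pmf.prob (random_graph n (p n))
    {E. real (metric_dimension {1..n} E) \<ge> (1 - \<kappa>) * (2 * ln (real n) / ln (1 / q n))}) \<longlonglongrightarrow> 1"
    (is "?P \<longlonglongrightarrow> 1")
proof -
  have C: "0 < C" using adm by (simp add: admissible_def)
  obtain \<gamma> where \<gamma>: "0 < \<gamma>" "\<forall>\<^sub>F n in sequentially. \<gamma> \<le> c n"
    using largest_exponent_power_lower_bound[OF i d_nonneg] unfolding c by blast
  define g where "g = 1 - exp (- \<gamma> / 2)"
  have g: "0 < g" using \<gamma> by (simp add: g_def)
  define H where "H = (\<lambda>n. 8 * ln (real n) / real n ^ 3 + 1 / real n ^ 2 + 1 / real n +
    3 * exp (ln (real n) ^ 3 - exp (\<kappa> * ln (real n) / 2) / 16))"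
  have H: "H \<longlonglongrightarrow> 0" unfolding H_def using \<kappa> by real_asymp
  have exp_large: "\<forall>\<^sub>F n in sequentially. 8 \<le> exp (\<kappa> * ln (real n) / 2)"
    using \<kappa> by real_asymp
  have M: "0 < 256 + 32 * C + 96 / g" using C g by (simp add: add_pos_pos)
  \<comment> \<open>The tolerance \<kappa> / (2 C) is later multiplied by the 2 C from the bound on
    \<open>r\<close>.\<close>
  have err: "\<forall>\<^sub>F n in sequentially.
      (ln (real n))\<^sup>2 / ln (ln (real n)) * rate_error c' n \<le> \<kappa> / (2 * C) * ln (real n)"
  proof -
    have "0 < \<kappa> / (2 * C)" using \<kappa> C by simp
    then show ?thesis using adm unfolding admissible_def by blast
  qed
  have main: "\<forall>\<^sub>F n in sequentially. 0 \<le> c' n \<and> q n = agree (c' n) \<and> p n < 1 \<and>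
        ln (ln (real n)) \<le> C * ln (real n) * ln (1 / q n)"
    using adm by (simp add: admissible_def)
  have "\<forall>\<^sub>F n in sequentially. 1 - H n \<le> ?P n"
    using main err exp_large \<gamma>(2) c_le exponent_le d_ge[OF M] lnln_ge[of "max 1 (2 * C)"]
      ln_ge[of "max 2 (1 / (1 - \<kappa>))"] eventually_ge_at_top[of 8]
  proof eventually_elim
    case (elim n)
    define L where "L = ln (real n)"
    define l where "l = ln L"
    define Q where "Q = ln (1 / q n)"
    define x where "x = (1 - \<kappa>) * (2 * L / Q)"
    \<comment> \<open>Excluding dimensions up to \<open>r\<close> leaves at least r + 1 > x.\<close>
    define r where "r = nat \<lfloor>x\<rfloor>"
    have L: "2 \<le> L" "1 / (1 - \<kappa>) \<le> L" and l: "1 \<le> l" "2 * C \<le> l" using elim by (auto simp: L_def l_def)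
    have lCQ: "l \<le> C * L * Q" using elim(1) unfolding L_def l_def Q_def by blast
    have qh: "1 / 2 \<le> q n" using elim agree_ge_half by simp
    have Q0: "0 < Q"
    proof (rule ccontr)
      assume "\<not> 0 < Q"
      then have "C * L * Q \<le> 0" using C L by (intro mult_nonneg_nonpos) auto
      then show False using lCQ l by linarith
    qed
    have Q1: "Q \<le> 1"
    proof -
      have "Q \<le> 1 / q n - 1" unfolding Q_def using qh by (intro ln_le_minus_one) simp
      also have "\<dots> \<le> 1" using qh by (simp add: field_simps)
      finally show ?thesis .
    qed
    have x0: "0 \<le> x" using \<kappa> L Q0 by (simp add: x_def)
    have rx: "real r \<le> x" "x < real r + 1" using x0 by (auto simp: r_def)
    have "1 \<le> x"
    proof -
      have "1 \<le> (1 - \<kappa>) * L" using L \<kappa> by (simp add: field_simps)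
      also have "\<dots> \<le> (1 - \<kappa>) * (2 * L / 1)" using L \<kappa> by simp
      also have "\<dots> \<le> x" unfolding x_def using L \<kappa> Q0 Q1 by (intro mult_left_mono divide_left_mono) auto
      finally show ?thesis .
    qed
    then have r1: "1 \<le> r" by (simp add: r_def le_nat_iff)
    have r_le: "real r \<le> 2 * C * (L\<^sup>2 / l)"
    proof -
      have "x \<le> 1 * (2 * L / Q)" unfolding x_def using \<kappa> L Q0 by (intro mult_right_mono) auto
      also have "\<dots> \<le> 2 * C * (L\<^sup>2 / l)"
      proof -
        have "2 * L * l \<le> 2 * L * (C * L * Q)" using lCQ L by (intro mult_left_mono) auto
        then show ?thesis using Q0 l by (simp add: field_simps power2_eq_square)
      qed
      finally show ?thesis using rx by linarith
    qed
    have cn: "d n ^ (i n + 1) = c n * real n" using elim by (simp add: c)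
    have c0: "0 \<le> c n" "c n \<le> l" using elim \<gamma> by (auto simp: l_def L_def)
    have rc: "real r * c n \<le> 2 * C * L\<^sup>2"
    proof -
      have "real r * c n \<le> 2 * C * (L\<^sup>2 / l) * l" using r_le c0 C l by (intro mult_mono) auto
      then show ?thesis using l by simp
    qed
    have rL: "real r \<le> L\<^sup>2"
    proof -
      have "2 * C * (L\<^sup>2 / l) \<le> l * (L\<^sup>2 / l)" using l by (intro mult_right_mono) auto
      then show ?thesis using r_le l by simp
    qed
    have iL: "real (i n) \<le> L"
    proof -
      have "real (i n) * 1 \<le> 5 * real (i n) * l" using l by (intro mult_mono) auto
      then show ?thesis using elim by (simp add: L_def l_def)
    qed
    have err0: "0 \<le> rate_error c' n"
    proof -
      define y where "y = - ln (1 - p n) * d n ^ i n"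
      have "0 \<le> y"
        unfolding y_def using elim p[of n] d_nonneg[of n] by (intro mult_nonneg_nonneg) auto
      then show ?thesis unfolding rate_error_def y_def[symmetric] by simp
    qed
    have rate: "real r * (- ln (agree (c' n)) + rate_error c' n) \<le> (2 - \<kappa>) * L"
    proof -
      have "- ln (agree (c' n)) = Q" using elim qh by (simp add: Q_def ln_div)
      moreover have "real r * Q \<le> x * Q" using rx Q0 by (intro mult_right_mono) auto
      moreover have "x * Q = (1 - \<kappa>) * (2 * L)" using Q0 by (simp add: x_def)
      moreover have "real r * rate_error c' n \<le> 2 * C * (L\<^sup>2 / l) * rate_error c' n"
        using r_le err0 by (intro mult_right_mono)
      moreover have "2 * C * (L\<^sup>2 / l) * rate_error c' n \<le> 2 * C * (\<kappa> / (2 * C) * L)"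
        unfolding mult.assoc using elim C by (intro mult_left_mono) (auto simp: L_def l_def)
      ultimately show ?thesis using C by (simp add: algebra_simps)
    qed
    have rate': "real r * (- ln (agree (c' n)) + 4 * \<bar>- ln (1 - p n) * d n ^ i n - c' n\<bar> +
        38 * (- ln (1 - p n) * d n ^ i n) * real (i n) / L\<^sup>2) \<le> (2 - \<kappa>) * L"
      using rate unfolding rate_error_def L_def[symmetric] by (simp only: add.assoc)
    have "measure_pmf.prob (random_graph n (p n)) {E. metric_dimension {1..n} E \<le> r} \<le> H n"
      unfolding H_def L_def[symmetric]
      by (rule prob_metric_dimension_le_explicit[where d = "d n" and i = "i n" and c = "c n" and c' = "c' n"
            and C = C and \<gamma> = \<gamma> and g = g])
         (use elim L r1 rc rL cn \<gamma> iL g_def C rate' d[of n] in \<open>simp_all add: L_def\<close>)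
    moreover have "1 - measure_pmf.prob (random_graph n (p n)) {E. metric_dimension {1..n} E \<le> r} =
        measure_pmf.prob (random_graph n (p n)) (- {E. metric_dimension {1..n} E \<le> r})"
      using measure_pmf.prob_compl[of "{E. metric_dimension {1..n} E \<le> r}" "random_graph n (p n)"]
      by (simp add: Compl_eq_Diff_UNIV)
    moreover have "measure_pmf.prob (random_graph n (p n)) (- {E. metric_dimension {1..n} E \<le> r}) \<le> ?P n"
    proof (intro measure_pmf.finite_measure_mono subsetI)
      fix E assume "E \<in> - {E. metric_dimension {1..n} E \<le> r}"
      then have "real r + 1 \<le> real (metric_dimension {1..n} E)" by simp
      then show "E \<in> {E. real (metric_dimension {1..n} E) \<ge> (1 - \<kappa>) * (2 * ln (real n) / ln (1 / q n))}"
        using rx by (simp add: x_def L_def Q_def)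
    qed simp
    ultimately show ?case by linarith
  qed
  moreover have "\<forall>\<^sub>F n in sequentially. ?P n \<le> 1" by simp
  moreover have "(\<lambda>n. 1 - H n) \<longlonglongrightarrow> 1" using tendsto_diff[OF tendsto_const[of 1] H] by simp
  ultimately show ?thesis by (rule tendsto_sandwich[OF _ _ _ tendsto_const])
qed

end

theorem theorem4p2:
  fixes p d c q \<epsilon> :: "nat \<Rightarrow> real" and i :: "nat \<Rightarrow> nat"
  assumes eps: "\<And>n. \<epsilon> n = 3 * ln (ln (real n)) / ln (real n)"
    and p: "\<And>n. 0 \<le> p n \<and> p n \<le> 1"
    and d: "\<And>n. d n = p n * (real n - 1)"
    and d_lower: "(\<lambda>n. ln (real n) ^ 5) \<in> o(d)"
    and d_upper: "\<forall>\<^sub>F n in sequentially. d n \<le> real n * (1 - \<epsilon> n)"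
    and i: "largest_exponent d i"
    and c: "\<And>n. c n = d n ^ (i n + 1) / real n"
    and q: "(p \<in> o(\<lambda>_. 1) \<and> (\<forall>n. q n = exp (- c n) ^ 2 + (1 - exp (- c n)) ^ 2)) \<or>
            (p \<in> \<Theta>(\<lambda>_. 1) \<and> (\<forall>n. q n = p n ^ 2 + (1 - p n) ^ 2))"
    and exp_c: "\<forall>\<^sub>F n in sequentially. exp (c n) \<le> 1 / \<epsilon> n"
  shows "\<exists>\<delta> :: nat \<Rightarrow> real. \<delta> \<in> o(\<lambda>_. 1) \<and>
    (\<lambda>n. measure_pmf.prob (random_graph n (p n))
       {E. real (metric_dimension {1..n} E) \<ge> (1 + \<delta> n) * (2 * ln (real n) / ln (1 / q n))})
    \<longlonglongrightarrow> 1"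
proof -
  interpret metric_dimension_regime p d c q \<epsilon> i
    using assms by unfold_locales auto
  obtain c' C where adm: "admissible c' C"
    using q admissible_sparse admissible_dense by blast
  \<comment> \<open>With \<kappa> = - \<delta> n the factor 1 - \<kappa> becomes the required 1 +
    \<delta> n.\<close>
  define P where "P = (\<lambda>\<kappa> n. measure_pmf.prob (random_graph n (p n))
       {E. real (metric_dimension {1..n} E) \<ge> (1 - \<kappa>) * (2 * ln (real n) / ln (1 / q n))})"
  have "P \<kappa> \<longlonglongrightarrow> 1" if "0 < \<kappa>" "\<kappa> < 1" for \<kappa>
    unfolding P_def using prob_metric_dimension_tendsto_1[OF adm that] .
  moreover have "P \<kappa> n \<le> 1" for \<kappa> n by (simp add: P_def)
  ultimately have "\<exists>\<delta> :: nat \<Rightarrow> real. \<delta> \<in> o(\<lambda>_. 1) \<and> (\<lambda>n. P (- \<delta> n) n) \<longlonglongrightarrow> 1"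
    by (rule diagonal_limit_one)
  then show ?thesis by (simp add: P_def)
qed

end
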